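(* Let $(B_t)_{t\in[0,1]}$ be a Brownian bridge in $\mathbb{R}$ with $B_0=B_1=0$. For $N\in\mathbb{N}$ and $t\in[0,1]$, let $$F_t^{N,1}=\sqrt{N}\left(B_t-\sum_{k=1}^N\frac{2\sin(k\pi t)}{k\pi}\int_0^1\cos(k\pi r)\,\mathrm{d}B_r\right)$$ and $$F_t^{N,2}=\sqrt{2N}\left(B_t-\frac{1}{2}a_0-\sum_{k=1}^N\bigl(a_k\cos(2k\pi t)+b_k\sin(2k\pi t)\bigr)\right),$$ where, for $k\in\mathbb{N}_0$, $a_k=2\int_0^1\cos(2k\pi r)B_r\,\mathrm{d}r$ and $b_k=2\int_0^1\sin(2k\pi r)B_r\,\mathrm{d}r$. Then the processes $(F_t^{N,1})_{t\in[0,1]}$ converge in finite dimensional distributions as $N\to\infty$ to the collection $(F_t^1)_{t\in[0,1]}$ of independent Gaussian random variables with mean zero and variance $$\mathbb{E}\left[(F_t^1)^2\right]=\begin{cases}\frac{1}{\pi^2} & \text{if }t\in(0,1),\\ 0 & \text{if }t=0\text{ or }t=1.\end{cases}$$ The processes $(F_t^{N,2})_{t\in[0,1]}$ converge in finite dimensional distributions as $N\to\infty$ to the collection $(F_t^2)_{t\in[0,1]}$ of zero-mean (jointly) Gaussian random variables whose covariance structure is given by, for $s,t\in[0,1]$, $$\mathbb{E}\left[F_s^2F_t^2\right]=\begin{cases}\frac{1}{\pi^2} & \text{if }s=t\text{ or }s,t\in\{0,1\},\\ 0 & \text{otherwise.}\end{cases}$$ (Here the superscripts $1,2$ on $F_t^1$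 and $F_t^2$ are indices, and $\mathbb{E}[(F_t^1)^2]$ is the second moment of $F_t^1$.)
   Context: $\mathbb{N}$ denotes the positive integers and $\mathbb{N}_0$ the non-negative integers. A Brownian bridge $(B_t)_{t\in[0,1]}$ in $\mathbb{R}$ with $B_0=B_1=0$ is a continuous Gaussian process with mean zero and covariance $\mathbb{E}[B_sB_t]=\min(s,t)-st$ for $s,t\in[0,1]$. For a continuously differentiable deterministic function $f$ on $[0,1]$, the stochastic integral satisfies $\int_0^1 f(r)\,\mathrm{d}B_r=-\int_0^1 f'(r)B_r\,\mathrm{d}r$ (integration by parts, using $B_0=B_1=0$). Convergence in finite dimensional distributions means that for all $n\in\mathbb{N}$ and $t_1,\dots,t_n\in[0,1]$ the random vectors $(F^{N,i}_{t_1},\dots,F^{N,i}_{t_n})$ converge in distribution to $(F^{i}_{t_1},\dots,F^{i}_{t_n})$ as $N\to\infty$. *)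

theory Defs
  imports "HOL-Probability.Probability" "HOL-Analysis.Abstract_Euclidean_Space"
begin

text \<open>Point masses count as (degenerate) Gaussian random variables.\<close>

definition gaussian_rv :: "'a measure \<Rightarrow> ('a \<Rightarrow> real) \<Rightarrow> bool" where
  "gaussian_rv M X \<longleftrightarrow> X \<in> borel_measurable M \<and>
     ((\<exists>\<mu>. AE \<omega> in M. X \<omega> = \<mu>) \<or>
      (\<exists>\<mu> \<sigma>. 0 < \<sigma> \<and> distributed M lborel X (\<lambda>x. ennreal (normal_density \<mu> \<sigma> x))))"

definition gaussian_process :: "'a measure \<Rightarrow> (real \<Rightarrow> 'a \<Rightarrow> real) \<Rightarrow> real set \<Rightarrow> bool" where
  "gaussian_process M X T \<longleftrightarrow>
     (\<forall>S c. finite S \<longrightarrow> S \<subseteq> T \<longrightarrow> gaussian_rv M (\<lambda>\<omega>. \<Sum>t\<in>S. c t * X t \<omega>))"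

definition brownian_bridge :: "'a measure \<Rightarrow> (real \<Rightarrow> 'a \<Rightarrow> real) \<Rightarrow> bool" where
  "brownian_bridge M B \<longleftrightarrow> prob_space M \<and>
     gaussian_process M B {0..1} \<and>
     (\<forall>\<omega>\<in>space M. continuous_on {0..1} (\<lambda>t. B t \<omega>) \<and> B 0 \<omega> = 0 \<and> B 1 \<omega> = 0) \<and>
     (\<forall>t\<in>{0..1}. (\<integral>\<omega>. B t \<omega> \<partial>M) = 0) \<and>
     (\<forall>s\<in>{0..1}. \<forall>t\<in>{0..1}. (\<integral>\<omega>. B s \<omega> * B t \<omega> \<partial>M) = min s t - s * t)"

definition converges_in_probability ::
    "'a measure \<Rightarrow> (nat \<Rightarrow> 'a \<Rightarrow> real) \<Rightarrow> ('a \<Rightarrow> real) \<Rightarrow> bool" where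
  "converges_in_probability M X Y \<longleftrightarrow>
     (\<forall>n. X n \<in> borel_measurable M) \<and> Y \<in> borel_measurable M \<and>
     (\<forall>\<epsilon>>0. (\<lambda>n. measure M {\<omega> \<in> space M. \<epsilon> < \<bar>X n \<omega> - Y \<omega>\<bar>}) \<longlonglongrightarrow> 0)"

text \<open>The integral over [0,1] of a continuous \<open>f\<close> against \<open>B\<close> is the limit in probability of
  left-endpoint Riemann sums. Such a limit is only determined up to a null set; the choice
  operator picks one version, and it is unspecified if there is no limit.\<close>

definition stoch_integral ::
    "'a measure \<Rightarrow> (real \<Rightarrow> 'a \<Rightarrow> real) \<Rightarrow> (real \<Rightarrow> real) \<Rightarrow> 'a \<Rightarrow> real" where
  "stoch_integral M B f = (SOME I. converges_in_probability M
     (\<lambda>n \<omega>. \<Sum>i<n. f (real i / real n) * (B (real (Suc i) / real n) \<omega> - B (real i / real n) \<omega>)) I)"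

definition F_process1 ::
    "'a measure \<Rightarrow> (real \<Rightarrow> 'a \<Rightarrow> real) \<Rightarrow> nat \<Rightarrow> real \<Rightarrow> 'a \<Rightarrow> real" where
  "F_process1 M B N t \<omega> = sqrt (real N) *
     (B t \<omega> - (\<Sum>k=1..N. 2 * sin (real k * pi * t) / (real k * pi) *
        stoch_integral M B (\<lambda>r. cos (real k * pi * r)) \<omega>))"

definition fourier_a :: "(real \<Rightarrow> 'a \<Rightarrow> real) \<Rightarrow> nat \<Rightarrow> 'a \<Rightarrow> real" where
  "fourier_a B k \<omega> = 2 * (LBINT r:{0..1}. cos (2 * real k * pi * r) * B r \<omega>)"

definition fourier_b :: "(real \<Rightarrow> 'a \<Rightarrow> real) \<Rightarrow> nat \<Rightarrow> 'a \<Rightarrow> real" where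
  "fourier_b B k \<omega> = 2 * (LBINT r:{0..1}. sin (2 * real k * pi * r) * B r \<omega>)"

definition F_process2 :: "(real \<Rightarrow> 'a \<Rightarrow> real) \<Rightarrow> nat \<Rightarrow> real \<Rightarrow> 'a \<Rightarrow> real" where
  "F_process2 B N t \<omega> = sqrt (2 * real N) *
     (B t \<omega> - 1 / 2 * fourier_a B 0 \<omega> -
      (\<Sum>k=1..N. fourier_a B k \<omega> * cos (2 * real k * pi * t)
                + fourier_b B k \<omega> * sin (2 * real k * pi * t)))"

definition converges_in_distribution ::
    "'c topology \<Rightarrow> 'a measure \<Rightarrow> (nat \<Rightarrow> 'a \<Rightarrow> 'c) \<Rightarrow> 'b measure \<Rightarrow> ('b \<Rightarrow> 'c) \<Rightarrow> bool" where
  "converges_in_distribution E M X L Y \<longleftrightarrow>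
     (\<forall>g. continuous_map E euclideanreal g \<and> bounded (g ` topspace E) \<longrightarrow>
        (\<lambda>N. \<integral>\<omega>. g (X N \<omega>) \<partial>M) \<longlonglongrightarrow> (\<integral>\<omega>. g (Y \<omega>) \<partial>L))"

text \<open>\<open>Euclidean_space n\<close> consists of the sequences vanishing from index \<open>n\<close> on. Random vectors
  with values there must have measurable components, since otherwise the integrals above
  would be meaningless.\<close>

definition converges_fdd ::
    "real set \<Rightarrow> 'a measure \<Rightarrow> (nat \<Rightarrow> real \<Rightarrow> 'a \<Rightarrow> real) \<Rightarrow>
     'b measure \<Rightarrow> (real \<Rightarrow> 'b \<Rightarrow> real) \<Rightarrow> bool" where
  "converges_fdd T M X L Y \<longleftrightarrow>
     (\<forall>N. \<forall>t\<in>T. X N t \<in> borel_measurable M) \<and> (\<forall>t\<in>T. Y t \<in> borel_measurable L) \<and>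
     (\<forall>n>0. \<forall>t::nat \<Rightarrow> real. (\<forall>i<n. t i \<in> T) \<longrightarrow>
        converges_in_distribution (Euclidean_space n)
          M (\<lambda>N \<omega> i. if i < n then X N (t i) \<omega> else 0)
          L (\<lambda>\<omega> i. if i < n then Y (t i) \<omega> else 0))"

definition limit_collection1 :: "'b measure \<Rightarrow> (real \<Rightarrow> 'b \<Rightarrow> real) \<Rightarrow> bool" where
  "limit_collection1 L F \<longleftrightarrow> prob_space L \<and>
     prob_space.indep_vars L (\<lambda>_. borel) F {0..1} \<and>
     (\<forall>t\<in>{0..1}. gaussian_rv L (F t) \<and> (\<integral>\<omega>. F t \<omega> \<partial>L) = 0 \<and>
        (\<integral>\<omega>. (F t \<omega>)\<^sup>2 \<partial>L) = (if 0 < t \<and> t < 1 then 1 / pi\<^sup>2 else 0))"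

definition limit_collection2 :: "'b measure \<Rightarrow> (real \<Rightarrow> 'b \<Rightarrow> real) \<Rightarrow> bool" where
  "limit_collection2 L F \<longleftrightarrow> prob_space L \<and>
     gaussian_process L F {0..1} \<and>
     (\<forall>t\<in>{0..1}. (\<integral>\<omega>. F t \<omega> \<partial>L) = 0) \<and>
     (\<forall>s\<in>{0..1}. \<forall>t\<in>{0..1}. (\<integral>\<omega>. F s \<omega> * F t \<omega> \<partial>L) =
        (if s = t \<or> s \<in> {0, 1} \<and> t \<in> {0, 1} then 1 / pi\<^sup>2 else 0))"

end

(*
  Everything is transported to L2[0,1].  Since the kernels e_t(r) = 1[r <= t] - t have inner
  products min s t - s t, mapping e_t to B_t extends to an isometry of a subspace of L2[0,1] into
  the centered Gaussian variables; integrals of a C1 function f against B correspond to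
  f minus its mean.  Both fluctuation processes are images of scaled Fourier remainders, of e_t in
  the cosine basis and of the sawtooth 1[r <= t] - (t - r) - 1/2 in the full trigonometric basis, so
  their covariances are explicit: with
    D_N(x) = pi^2/6 - pi x/2 + x^2/4 - sum_{k <= N} cos(k x)/k^2,
  which is sum_{k > N} cos(k x)/k^2 on [0, 2 pi], they are N (D_N(pi |s - t|) - D_N(pi (s + t))) / pi^2 and N D_N(2 pi |s - t|) / pi^2.
  The sum over k > N behaves like 1/N at x = 0 and x = 2 pi, and is O(1/N^2) in between
  (summation by parts), which gives the limiting covariances.  Convergence in distribution of the
  centered Gaussian vectors then follows from convergence of their characteristic functions.
*)
theory Submission
  imports Defs "HOL-Real_Asymp.Real_Asymp"
begin

section \<open>Remainders of the series of cos(k x)/k^2\<close>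

text \<open>The obstacle is that the stochastic integral is fixed only up to a null set. The
  isometry is therefore extended along combinations of \<open>B\<close> that converge at every
  sample point and whose kernels converge boundedly on (0,1); dominated convergence then carries the
  variances. Such sequences exist because every integrand is C1: Abel summation moves the increments
  from the merely continuous paths to the integrand, and \<open>B 0 = B 1 = 0\<close> removes the
  boundary terms. The polynomial in D_N is pi^2 times the Bernoulli polynomial B_2(y) = y^2 - y +
  1/6 at y = x / (2 pi). It comes from the inner products of the kernels before projection, so the
  covariances are exact finite identities for each N, and the infinite series enters only in the
  limit. The extra 2 in \<open>sqrt (2 * real N)\<close> balances the frequencies 2 k pi, which
  produce D_N / (2 pi^2). In the last step, test functions are only bounded and continuous, while
  characteristic functions control cosines; the trigonometric approximation has to stay bounded on
  the whole space, not only on a box.\<close>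

definition cosine_remainder :: "nat \<Rightarrow> real \<Rightarrow> real" where
  "cosine_remainder N x = pi\<^sup>2 / 6 - pi * x / 2 + x\<^sup>2 / 4 - (\<Sum>k=1..N. cos (real k * x) / (real k)\<^sup>2)"

lemma sin_half_pos: "sin (x / 2) > 0" if "0 < x" "x < 2 * pi" for x :: real
  using that by (intro sin_gt_zero) auto

text \<open>A discrete primitive of k -> cos (k x). It telescopes to the Dirichlet kernel and
  supplies the bounded partial sums in \<open>scaled_cosine_remainder_interior\<close>.\<close>

lemma cos_eq_dirichlet_diff:
  assumes "sin (x / 2) \<noteq> 0"
  shows "cos (real (Suc k) * x) =
     sin ((real (Suc k) + 1/2) * x) / (2 * sin (x / 2)) - sin ((real k + 1/2) * x) / (2 * sin (x / 2))"
proof -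
  have "sin ((real (Suc k) + 1/2) * x) - sin ((real k + 1/2) * x) = 2 * sin (x / 2) * cos (real (Suc k) * x)"
  proof -
    have "((real (Suc k) + 1/2) * x - (real k + 1/2) * x) / 2 = x / 2"
      "((real (Suc k) + 1/2) * x + (real k + 1/2) * x) / 2 = real (Suc k) * x"
      by (simp_all add: field_simps)
    then show ?thesis by (simp only: sin_diff_sin)
  qed
  then show ?thesis using assms by (simp add: field_simps)
qed

lemma dirichlet_kernel:
  assumes "sin (x / 2) \<noteq> 0"
  shows "1/2 + (\<Sum>k=1..N. cos (real k * x)) = sin ((real N + 1/2) * x) / (2 * sin (x / 2))"
proof (induction N)
  case 0
  then show ?case using assms by simp
next
  case (Suc N)
  then show ?case using cos_eq_dirichlet_diff[OF assms, of N] by simp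
qed

text \<open>On (0, 2 pi) this is minus the tail of the sawtooth series sum sin (k x) / k = (pi - x)
  / 2; it arises as the derivative of \<open>cosine_remainder\<close>.\<close>

definition sine_remainder :: "nat \<Rightarrow> real \<Rightarrow> real" where
  "sine_remainder N x = (x - pi) / 2 + (\<Sum>k=1..N. sin (real k * x) / real k)"

lemma cosine_remainder_deriv:
  "(cosine_remainder N has_real_derivative sine_remainder N x) (at x)"
proof -
  have "((\<lambda>x. pi\<^sup>2 / 6 - pi * x / 2 + x\<^sup>2 / 4 - (\<Sum>k=1..N. cos (real k * x) / (real k)\<^sup>2)) has_real_derivative
     (- pi / 2 + 2 * x / 4 - (\<Sum>k=1..N. - sin (real k * x) * real k / (real k)\<^sup>2))) (at x)"
  proof (intro DERIV_diff DERIV_sum)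
    show "((\<lambda>x. pi\<^sup>2 / 6 - pi * x / 2 + x\<^sup>2 / 4) has_real_derivative (- pi / 2 + 2 * x / 4)) (at x)"
      by (auto intro!: derivative_eq_intros)
    show "((\<lambda>x. cos (real k * x) / (real k)\<^sup>2) has_real_derivative (- sin (real k * x) * real k / (real k)\<^sup>2)) (at x)" for k
      by (rule DERIV_cdivide) (auto intro!: derivative_eq_intros)
  qed
  also have "(- pi / 2 + 2 * x / 4 - (\<Sum>k=1..N. - sin (real k * x) * real k / (real k)\<^sup>2)) = sine_remainder N x"
  proof -
    have "(\<Sum>k=1..N. - sin (real k * x) * real k / (real k)\<^sup>2) = (\<Sum>k=1..N. - (sin (real k * x) / real k))"
      by (intro sum.cong) (auto simp: power2_eq_square)
    then show ?thesis by (simp add: sine_remainder_def sum_negf field_simps)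
  qed
  finally show ?thesis by (simp add: cosine_remainder_def[abs_def])
qed

lemma sine_remainder_deriv:
  assumes "sin (x / 2) \<noteq> 0"
  shows "(sine_remainder N has_real_derivative sin ((real N + 1/2) * x) / (2 * sin (x / 2))) (at x)"
proof -
  have "((\<lambda>x. (x - pi) / 2 + (\<Sum>k=1..N. sin (real k * x) / real k)) has_real_derivative
     (1/2 + (\<Sum>k=1..N. cos (real k * x) * real k / real k))) (at x)"
    by (auto intro!: derivative_eq_intros)
  also have "(\<Sum>k=1..N. cos (real k * x) * real k / real k) = (\<Sum>k=1..N. cos (real k * x))"
    by (intro sum.cong) auto
  finally show ?thesis using dirichlet_kernel[OF assms, of N] by (simp add: sine_remainder_def[abs_def])
qed

lemma cos_half_odd_pi: "cos ((real N + 1/2) * pi) = 0"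
proof -
  have "(real N + 1/2) * pi = real N * pi + pi / 2" by (simp add: algebra_simps)
  then show ?thesis by (simp add: cos_add)
qed

lemma sine_remainder_pi: "sine_remainder N pi = 0"
  by (simp add: sine_remainder_def)

text \<open>Adding the boundary term of one integration by parts of the Dirichlet kernel
  makes the derivative of order \<open>1/N\<close>.\<close>

lemma sine_remainder_bound:
  assumes "0 < \<delta>" "\<delta> < pi" "\<delta> \<le> x" "x \<le> 2 * pi - \<delta>"
  shows "\<bar>sine_remainder N x\<bar> \<le> (pi / (sin (\<delta>/2))\<^sup>2 + 1 / sin (\<delta>/2)) / real (2 * N + 1)"
proof -
  define m where "m = sin (\<delta>/2)"
  have m: "0 < m" unfolding m_def using assms by (intro sin_half_pos) auto
  have sm: "m \<le> sin (y/2)" if "\<delta> \<le> y" "y \<le> 2*pi - \<delta>" for y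
  proof (cases "y \<le> pi")
    case True
    then show ?thesis unfolding m_def using that assms by (intro sin_monotone_2pi_le) auto
  next
    case False
    have "sin (\<delta>/2) \<le> sin (pi - y/2)" using False that assms by (intro sin_monotone_2pi_le) auto
    then show ?thesis by (simp add: m_def)
  qed
  define E where "E y = sine_remainder N y + cos ((real N + 1/2) * y) / (real (2*N+1) * sin (y/2))" for y
  define E' where "E' y = - cos ((real N + 1/2) * y) * cos (y/2) / (real (2*N+1) * (2 * (sin (y/2))\<^sup>2))" for y
  have dE: "(E has_real_derivative E' y) (at y)" if "\<delta> \<le> y" "y \<le> 2*pi - \<delta>" for y
  proof -
    have nz: "sin (y/2) \<noteq> 0" using sm[OF that] m by auto
    have q: "real (2*N+1) * sin (y/2) \<noteq> 0" using nz by auto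
    have "((\<lambda>y. cos ((real N + 1/2) * y) / (real (2*N+1) * sin (y/2))) has_real_derivative
        (- sin ((real N + 1/2) * y) * (real N + 1/2) * (real (2*N+1) * sin (y/2))
          - cos ((real N + 1/2) * y) * (real (2*N+1) * (cos (y/2) * (1/2)))) /
        ((real (2*N+1) * sin (y/2)) * (real (2*N+1) * sin (y/2)))) (at y)"
      by (rule DERIV_divide) (use q in \<open>auto intro!: derivative_eq_intros\<close>)
    from DERIV_add[OF sine_remainder_deriv[OF nz, of N] this]
    have d: "(E has_real_derivative (sin ((real N + 1/2) * y) / (2 * sin (y/2)) +
       (- sin ((real N + 1/2) * y) * (real N + 1/2) * (real (2*N+1) * sin (y/2))
          - cos ((real N + 1/2) * y) * (real (2*N+1) * (cos (y/2) * (1/2)))) /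
        ((real (2*N+1) * sin (y/2)) * (real (2*N+1) * sin (y/2))))) (at y)"
      by (simp add: E_def[abs_def])
    have alg: "A / (2 * s) + (- A * (p/2) * (p * s) - C * (p * (c * (1/2)))) / ((p * s) * (p * s))
        = - C * c / (p * (2 * s\<^sup>2))" if "p \<noteq> 0" "s \<noteq> 0" for A C c p s :: real
      using that by (simp add: field_simps power2_eq_square)
    have p2: "real N + 1/2 = real (2*N+1) / 2" by simp
    show ?thesis using d unfolding E'_def
      unfolding p2 by (subst (asm) alg) (use nz in auto)
  qed
  have bE: "\<bar>E' y\<bar> \<le> 1 / (real (2*N+1) * m\<^sup>2)" if "\<delta> \<le> y" "y \<le> 2*pi - \<delta>" for y
  proof -
    have "m\<^sup>2 \<le> (sin (y/2))\<^sup>2" using sm[OF that] m by (intro power_mono) auto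
    moreover have "\<bar>cos ((real N + 1/2) * y)\<bar> * \<bar>cos (y/2)\<bar> \<le> 1 * 1" by (intro mult_mono) auto
    moreover have "m\<^sup>2 \<le> 2 * (sin (y/2))\<^sup>2" 
      using calculation(1) zero_le_power2[of "sin (y/2)"] by linarith
    ultimately show ?thesis unfolding E'_def abs_divide abs_mult abs_minus_cancel
      using m by (intro frac_le) (auto simp: abs_mult intro!: mult_pos_pos mult_left_mono)
  qed
  \<comment> \<open>Both summands of \<open>E\<close> vanish at pi, so integrating \<open>E'\<close>
    from there leaves no constant to identify.\<close>
  have Epi: "E pi = 0" by (simp add: E_def sine_remainder_pi cos_half_odd_pi)
  have "norm (E x - E pi) \<le> 1 / (real (2*N+1) * m\<^sup>2) * norm (x - pi)"
    by (rule field_differentiable_bound[where S="{\<delta>..2*pi-\<delta>}" and f'=E'])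
      (use assms dE bE in \<open>auto intro: DERIV_subset\<close>)
  also have "\<dots> \<le> 1 / (real (2*N+1) * m\<^sup>2) * pi"
    using assms m by (intro mult_left_mono) auto
  finally have 1: "\<bar>E x\<bar> \<le> pi / m\<^sup>2 / real (2*N+1)" using Epi by (simp add: field_simps)
  have 2: "\<bar>cos ((real N + 1/2) * x) / (real (2*N+1) * sin (x/2))\<bar> \<le> 1 / (real (2*N+1) * m)"
    unfolding abs_divide using sm[of x] m assms
    by (intro frac_le) (auto simp: abs_mult intro!: mult_pos_pos mult_left_mono)
  have "\<bar>sine_remainder N x\<bar> \<le> pi / m\<^sup>2 / real (2*N+1) + 1 / (real (2*N+1) * m)"
    using 1 2 unfolding E_def by linarith
  then show ?thesis by (simp add: m_def add_divide_distrib mult.commute)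
qed

lemma cosine_series_summable: "summable (\<lambda>k. cos (real (Suc k) * x) / (real (Suc k))\<^sup>2)"
proof (rule summable_comparison_test)
  show "\<exists>N. \<forall>n\<ge>N. norm (cos (real (Suc n) * x) / (real (Suc n))\<^sup>2) \<le> 1 / (real (Suc n))\<^sup>2"
    by (auto simp: divide_le_cancel intro!: divide_right_mono)
  show "summable (\<lambda>n. 1 / (real (Suc n))\<^sup>2)"
    using inverse_squares_sums by (simp add: sums_iff add.commute)
qed

lemma cosine_sum_shift:
  "(\<Sum>k=1..N. cos (real k * x) / (real k)\<^sup>2) = (\<Sum>k<N. cos (real (Suc k) * x) / (real (Suc k))\<^sup>2)"
  by (rule sum.reindex_bij_witness[of _ Suc "\<lambda>k. k - 1"]) auto

text \<open>The derivatives \<open>sine_remainder N\<close> tend to 0 uniformly on compact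
  subintervals of (0, 2 pi), so the limit \<open>D\<close> of the remainders is constant there. The
  Weierstrass test makes \<open>D\<close> continuous up to the endpoints, and the Basel sum gives
  \<open>D 0 = 0\<close>.\<close>

theorem cosine_series_bernoulli:
  assumes "x \<in> {0..2*pi}"
  shows "(\<lambda>k. cos (real (Suc k) * x) / (real (Suc k))\<^sup>2) sums (pi\<^sup>2 / 6 - pi * x / 2 + x\<^sup>2 / 4)"
proof -
  define S where "S x = (\<Sum>k. cos (real (Suc k) * x) / (real (Suc k))\<^sup>2)" for x :: real
  define D where "D x = pi\<^sup>2 / 6 - pi * x / 2 + x\<^sup>2 / 4 - S x" for x
  have lim: "(\<lambda>N. cosine_remainder N x) \<longlonglongrightarrow> D x" for x
    unfolding cosine_remainder_def D_def S_def cosine_sum_shift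
    by (intro tendsto_intros summable_LIMSEQ cosine_series_summable)
  have contS: "continuous_on UNIV S"
  proof (rule uniform_limit_theorem)
    show "uniform_limit UNIV (\<lambda>n x. \<Sum>i<n. cos (real (Suc i) * x) / (real (Suc i))\<^sup>2) S sequentially"
      unfolding S_def
    proof (rule Weierstrass_m_test)
      show "summable (\<lambda>n. 1 / (real (Suc n))\<^sup>2)"
        using inverse_squares_sums by (simp add: sums_iff add.commute)
    qed (auto intro!: divide_right_mono)
    show "\<forall>\<^sub>F n in sequentially. continuous_on UNIV (\<lambda>x. \<Sum>i<n. cos (real (Suc i) * x) / (real (Suc i))\<^sup>2)"
      by (auto intro!: always_eventually continuous_intros)
  qed auto
  have contD: "continuous_on A D" for A
    unfolding D_def using continuous_on_subset[OF contS] by (auto intro!: continuous_intros)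
  have const: "D y = D pi" if y: "y \<in> {0<..<2*pi}" for y
  proof -
    \<comment> \<open>The entry \<open>pi/2\<close> guarantees \<delta> < pi also when y =
      pi.\<close>
    define \<delta> where "\<delta> = Min {y, 2*pi - y, pi/2}"
    have \<delta>: "0 < \<delta>" "\<delta> < pi" "\<delta> \<le> y" "y \<le> 2*pi - \<delta>" "\<delta> \<le> pi" using y by (auto simp: \<delta>_def min_def)
    define C where "C = pi / (sin (\<delta>/2))\<^sup>2 + 1 / sin (\<delta>/2)"
    have b: "norm (cosine_remainder N y - cosine_remainder N pi) \<le> C / real (2*N+1) * norm (y - pi)" for N
      by (rule field_differentiable_bound[where S="{\<delta>..2*pi-\<delta>}" and f'="sine_remainder N"])
        (use \<delta> sine_remainder_bound[of \<delta>] in \<open>auto intro!: DERIV_subset[OF cosine_remainder_deriv] simp: C_def\<close>)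
    have "(\<lambda>N. C / real (2*N+1) * norm (y - pi)) \<longlonglongrightarrow> 0" by real_asymp
    then have "(\<lambda>N. cosine_remainder N y - cosine_remainder N pi) \<longlonglongrightarrow> 0"
      by (rule Lim_null_comparison[OF always_eventually, rotated]) (use b in simp)
    moreover have "(\<lambda>N. cosine_remainder N y - cosine_remainder N pi) \<longlonglongrightarrow> D y - D pi"
      by (intro tendsto_intros lim)
    ultimately show ?thesis using LIMSEQ_unique by fastforce
  qed
  have cl: "closure {0<..<2*pi} = {0..2*pi}" by simp
  have all: "D y = D pi" if "y \<in> {0..2*pi}" for y
    using continuous_constant_on_closure[where S="{0<..<2*pi}", OF contD const, where x=y] that unfolding cl by blast
  have "D 0 = 0"
    using inverse_squares_sums by (simp add: D_def S_def sums_iff add.commute)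
  then have "D x = 0" using all[of 0] all[OF assms] by simp
  then show ?thesis
    using summable_sums[OF cosine_series_summable, of x] by (simp add: D_def S_def)
qed

text \<open>Turns the closed form, in which the covariances are computed, into the tail of a series,
  in which the asymptotics are read off. The restriction to one period is harmless, since all
  arguments pi |s - t|, pi (s + t) and 2 pi |s - t| lie in it.\<close>

lemma cosine_remainder_sums:
  assumes "x \<in> {0..2*pi}"
  shows "(\<lambda>k. cos (real (Suc (k + N)) * x) / (real (Suc (k + N)))\<^sup>2) sums cosine_remainder N x"
  using sums_split_initial_segment[OF cosine_series_bernoulli[OF assms], of N]
  by (simp only: cosine_remainder_def cosine_sum_shift)

section \<open>Asymptotics of the remainders scaled by N\<close>

lemma sums_inverse_square_diff:
  "(\<lambda>k. 1 / (real (Suc (k + N)))\<^sup>2 - 1 / (real (Suc (Suc (k + N))))\<^sup>2) sums (1 / (real (Suc N))\<^sup>2)"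
proof -
  have "(\<lambda>k. 1 / (real (Suc (k + N)))\<^sup>2) \<longlonglongrightarrow> 0" by real_asymp
  from telescope_sums'[OF this] show ?thesis by simp
qed

text \<open>Bounding each term by 1/k^2 would only give a tail of order 1/N, which the factor N does
  not kill. Here sin (x/2) > 0 keeps the primitives \<open>c\<close> bounded by 1/(2s). The boundary
  term and the telescoping differences of 1/k^2 then contribute at most 1/(2s (N+1)^2) each.\<close>

lemma scaled_cosine_remainder_interior:
  assumes "0 < x" "x < 2 * pi"
  shows "(\<lambda>N. real N * cosine_remainder N x) \<longlonglongrightarrow> 0"
proof -
  define s where "s = sin (x/2)"
  have s: "s > 0" unfolding s_def using assms by (rule sin_half_pos)
  define c where "c k = sin ((real k + 1/2) * x) / (2 * s)" for k
  have cb: "\<bar>c k\<bar> \<le> 1 / (2 * s)" for k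
    unfolding c_def abs_divide using s by (simp add: divide_right_mono)
  have cd: "cos (real (Suc k) * x) = c (Suc k) - c k" for k
    unfolding c_def s_def using cos_eq_dirichlet_diff[of x k] s by (simp add: s_def)
  have b: "\<bar>cosine_remainder N x\<bar> \<le> (1 / s) / (real (Suc N))\<^sup>2" for N
  proof -
    have "(\<lambda>k. c (k + N) / (real (Suc (k + N)))\<^sup>2) \<longlonglongrightarrow> 0"
    proof (rule tendsto_0_le[where K=1])
      show "(\<lambda>k. (1 / (2 * s)) / (real (Suc (k + N)))\<^sup>2) \<longlonglongrightarrow> 0" by real_asymp
      show "\<forall>\<^sub>F k in sequentially. norm (c (k + N) / (real (Suc (k + N)))\<^sup>2) \<le> norm ((1 / (2 * s)) / (real (Suc (k + N)))\<^sup>2) * 1"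
      proof (intro always_eventually allI)
        fix k
        have "\<bar>c (k + N)\<bar> / (real (Suc (k + N)))\<^sup>2 \<le> (1 / (2 * s)) / (real (Suc (k + N)))\<^sup>2"
          by (intro divide_right_mono cb) auto
        then show "norm (c (k + N) / (real (Suc (k + N)))\<^sup>2) \<le> norm ((1 / (2 * s)) / (real (Suc (k + N)))\<^sup>2) * 1"
          using s by (simp add: abs_divide)
      qed
    qed
    from telescope_sums[OF this]
    have t: "(\<lambda>k. c (Suc k + N) / (real (Suc (Suc k + N)))\<^sup>2 - c (k + N) / (real (Suc (k + N)))\<^sup>2)
        sums (- (c N / (real (Suc N))\<^sup>2))" by simp
    \<comment> \<open>Summation by parts as an identity of series: subtracting the telescoping
      series \<open>t\<close> moves the differences from \<open>c\<close> to the weights.\<close>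
    have "(\<lambda>k. cos (real (Suc (k + N)) * x) / (real (Suc (k + N)))\<^sup>2 -
        (c (Suc k + N) / (real (Suc (Suc k + N)))\<^sup>2 - c (k + N) / (real (Suc (k + N)))\<^sup>2))
        sums (cosine_remainder N x - (- (c N / (real (Suc N))\<^sup>2)))"
      by (intro sums_diff cosine_remainder_sums t) (use assms in auto)
    moreover have "cos (real (Suc (k + N)) * x) / (real (Suc (k + N)))\<^sup>2 -
        (c (Suc k + N) / (real (Suc (Suc k + N)))\<^sup>2 - c (k + N) / (real (Suc (k + N)))\<^sup>2)
        = c (Suc (k + N)) * (1 / (real (Suc (k + N)))\<^sup>2 - 1 / (real (Suc (Suc (k + N))))\<^sup>2)" for k
      unfolding cd by (simp add: diff_divide_distrib right_diff_distrib)
    ultimately have S: "(\<lambda>k. c (Suc (k + N)) * (1 / (real (Suc (k + N)))\<^sup>2 - 1 / (real (Suc (Suc (k + N))))\<^sup>2))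
        sums (cosine_remainder N x + c N / (real (Suc N))\<^sup>2)" by simp
    have T: "(\<lambda>k. 1 / (2 * s) * (1 / (real (Suc (k + N)))\<^sup>2 - 1 / (real (Suc (Suc (k + N))))\<^sup>2))
        sums (1 / (2 * s) * (1 / (real (Suc N))\<^sup>2))"
      by (intro sums_mult sums_inverse_square_diff)
    have pos: "0 \<le> 1 / (real (Suc (k + N)))\<^sup>2 - 1 / (real (Suc (Suc (k + N))))\<^sup>2" for k
    proof -
      have "1 / (real (Suc (Suc (k + N))))\<^sup>2 \<le> 1 / (real (Suc (k + N)))\<^sup>2"
        by (intro frac_le power_mono) auto
      then show ?thesis by linarith
    qed
    have le: "norm (c (Suc (k + N)) * (1 / (real (Suc (k + N)))\<^sup>2 - 1 / (real (Suc (Suc (k + N))))\<^sup>2))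
       \<le> 1 / (2 * s) * (1 / (real (Suc (k + N)))\<^sup>2 - 1 / (real (Suc (Suc (k + N))))\<^sup>2)" for k
      unfolding real_norm_def abs_mult abs_of_nonneg[OF pos] by (intro mult_right_mono cb pos)
    have "\<bar>cosine_remainder N x + c N / (real (Suc N))\<^sup>2\<bar> \<le> 1 / (2 * s) * (1 / (real (Suc N))\<^sup>2)"
      using norm_sums_le[OF S T le] by simp
    moreover have "\<bar>c N / (real (Suc N))\<^sup>2\<bar> \<le> 1 / (2 * s) * (1 / (real (Suc N))\<^sup>2)"
      using divide_right_mono[OF cb[of N], of "(real (Suc N))\<^sup>2"] by (simp add: abs_divide)
    ultimately have "\<bar>cosine_remainder N x\<bar> \<le> 1 / (2 * s) * (1 / (real (Suc N))\<^sup>2) + 1 / (2 * s) * (1 / (real (Suc N))\<^sup>2)"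
      by linarith
    then show ?thesis using s by (simp add: field_simps)
  qed
  show ?thesis
  proof (rule Lim_null_comparison[OF always_eventually])
    have "(\<lambda>N. real N / (real (Suc N))\<^sup>2) \<longlonglongrightarrow> 0" by real_asymp
    from tendsto_mult_right_zero[OF this]
    show "(\<lambda>N. (1 / s) * (real N / (real (Suc N))\<^sup>2)) \<longlonglongrightarrow> 0" .
    show "\<forall>N. norm (real N * cosine_remainder N x) \<le> (1 / s) * (real N / (real (Suc N))\<^sup>2)"
    proof
      fix N
      have "real N * \<bar>cosine_remainder N x\<bar> \<le> real N * ((1 / s) / (real (Suc N))\<^sup>2)"
        by (intro mult_left_mono b) auto
      then show "norm (real N * cosine_remainder N x) \<le> (1 / s) * (real N / (real (Suc N))\<^sup>2)"
        by (simp add: abs_mult)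
    qed
  qed
qed

text \<open>The telescoping 1/(a (a + 1)) lies between 1/(a + 1)^2 and 1/a^2; this traps the tail of
  the Basel series between 1/(N + 1) and 1/N.\<close>

lemma inverse_square_telescope_bounds:
  assumes "a > (0::real)"
  shows "1 / a - 1 / (a + 1) \<le> 1 / a\<^sup>2" "1 / (a + 1)\<^sup>2 \<le> 1 / a - 1 / (a + 1)"
proof -
  have eq: "1 / a - 1 / (a + 1) = 1 / (a * (a + 1))" using assms by (simp add: field_simps)
  show "1 / a - 1 / (a + 1) \<le> 1 / a\<^sup>2"
    unfolding eq power2_eq_square using assms by (intro frac_le mult_left_mono) auto
  show "1 / (a + 1)\<^sup>2 \<le> 1 / a - 1 / (a + 1)"
    unfolding eq power2_eq_square using assms by (intro frac_le mult_right_mono) auto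
qed

lemma scaled_cosine_remainder_0: "(\<lambda>N. real N * cosine_remainder N 0) \<longlonglongrightarrow> 1"
proof -
  have tel: "(\<lambda>k. 1 / real (Suc (k + N)) - 1 / real (Suc (Suc (k + N)))) sums (1 / real (Suc N))" for N
  proof -
    have "(\<lambda>k. 1 / real (Suc (k + N))) \<longlonglongrightarrow> 0" by real_asymp
    from telescope_sums'[OF this] show ?thesis by simp
  qed
  have S: "(\<lambda>k. 1 / (real (Suc (k + N)))\<^sup>2) sums cosine_remainder N 0" for N
    using cosine_remainder_sums[of 0 N] by simp
  have e: "real (Suc (k + N)) + 1 = real (Suc (Suc (k + N)))" for k N by simp
  have lo: "1 / real (Suc N) \<le> cosine_remainder N 0" for N
  proof (rule sums_le[OF _ tel S])
    show "1 / real (Suc (k + N)) - 1 / real (Suc (Suc (k + N))) \<le> 1 / (real (Suc (k + N)))\<^sup>2" for k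
      using inverse_square_telescope_bounds(1)[of "real (Suc (k + N))", unfolded e] by simp
  qed
  \<comment> \<open>Stated at \<open>Suc N\<close> so that a = k + N + 1 is positive even for N = 0;
    \<open>step\<close> returns to index N at the cost of a term of order 1/N^2.\<close>
  have up: "cosine_remainder (Suc N) 0 \<le> 1 / real (Suc N)" for N
  proof (rule sums_le[OF _ S tel])
    show "1 / (real (Suc (k + Suc N)))\<^sup>2 \<le> 1 / real (Suc (k + N)) - 1 / real (Suc (Suc (k + N)))" for k
      using inverse_square_telescope_bounds(2)[of "real (Suc (k + N))", unfolded e] by simp
  qed
  have step: "cosine_remainder N 0 = cosine_remainder (Suc N) 0 + 1 / (real (Suc N))\<^sup>2" for N
    by (simp add: cosine_remainder_def)
  show ?thesis
  proof (rule tendsto_sandwich)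
    show "\<forall>\<^sub>F N in sequentially. real N * (1 / real (Suc N)) \<le> real N * cosine_remainder N 0"
      using lo by (intro always_eventually allI mult_left_mono) auto
    show "\<forall>\<^sub>F N in sequentially. real N * cosine_remainder N 0 \<le> real N * (1 / real (Suc N) + 1 / (real (Suc N))\<^sup>2)"
      by (subst step, intro always_eventually allI mult_left_mono add_right_mono up) auto
    show "(\<lambda>N. real N * (1 / real (Suc N))) \<longlonglongrightarrow> 1" by real_asymp
    show "(\<lambda>N. real N * (1 / real (Suc N) + 1 / (real (Suc N))\<^sup>2)) \<longlonglongrightarrow> 1" by real_asymp
  qed
qed

text \<open>The polynomial part is symmetric about pi. This equality is behind both endpoint
  effects: it cancels the variance of the first process at t = 1 and correlates the second process
  at 0 and 1 completely.\<close>

lemma cosine_remainder_2pi: "cosine_remainder N (2 * pi) = cosine_remainder N 0"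
proof -
  have "cos (real k * (2 * pi)) = 1" for k
    using cos_2npi[of k] by (simp add: mult_ac)
  then show ?thesis by (simp add: cosine_remainder_def power2_eq_square)
qed

lemma scaled_cosine_remainder:
  assumes "x \<in> {0..2*pi}"
  shows "(\<lambda>N. real N * cosine_remainder N x) \<longlonglongrightarrow> (if x = 0 \<or> x = 2 * pi then 1 else 0)"
  using assms scaled_cosine_remainder_0 scaled_cosine_remainder_interior[of x]
  by (auto simp: cosine_remainder_2pi)

section \<open>Centered Gaussian variables\<close>

text \<open>The second moment is only bounded by \<open>v\<close>: this form passes to pointwise limits by Fatou's lemma.\<close>

definition centered_gaussian :: "'a measure \<Rightarrow> ('a \<Rightarrow> real) \<Rightarrow> real \<Rightarrow> bool" where
  "centered_gaussian M Z v \<longleftrightarrow> Z \<in> borel_measurable M \<and>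
     (\<forall>a b. (\<integral>\<omega>. cos (a * Z \<omega> + b) \<partial>M) = exp (- (a\<^sup>2 * v / 2)) * cos b) \<and>
     integrable M (\<lambda>\<omega>. (Z \<omega>)\<^sup>2) \<and> (\<integral>\<omega>. (Z \<omega>)\<^sup>2 \<partial>M) \<le> v"

lemma centered_gaussian_expectation_cos:
  assumes "centered_gaussian M Z v"
  shows "(\<integral>\<omega>. cos (Z \<omega> + b) \<partial>M) = exp (- (v / 2)) * cos b"
proof -
  have "(\<integral>\<omega>. cos (1 * Z \<omega> + b) \<partial>M) = exp (- (1\<^sup>2 * v / 2)) * cos b"
    using assms unfolding centered_gaussian_def by fast
  then show ?thesis by simp
qed

context prob_space
begin

text \<open>The phase \<open>b\<close> keeps the argument real-valued: b = 0 and b = - pi/2 give the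
  real and the imaginary part of the characteristic function. The latter is 0 for the standard
  normal law, which leaves the factor cos b.\<close>

lemma std_normal_expectation_cos:
  assumes "distributed M lborel X std_normal_density"
  shows "expectation (\<lambda>\<omega>. cos (a * X \<omega> + b)) = exp (- (a\<^sup>2 / 2)) * cos b"
proof -
  have [measurable]: "X \<in> borel_measurable M"
    using distributed_measurable[OF assms] by simp
  have d: "distr M borel X = std_normal_distribution"
    using distributed_distr_eq_density[OF assms] by (simp cong: distr_cong)
  have int: "integrable M (\<lambda>\<omega>. iexp (a * X \<omega>))"
    by (rule integrable_const_bound[where B=1]) auto
  have "complex_of_real (exp (- (a\<^sup>2) / 2)) = (CLINT x|distr M borel X. iexp (a * x))"
    using fun_cong[OF char_std_normal_distribution, of a] by (simp add: d char_def)
  also have "\<dots> = (CLINT \<omega>|M. iexp (a * X \<omega>))"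
    by (subst integral_distr) auto
  finally have e: "(CLINT \<omega>|M. iexp (a * X \<omega>)) = complex_of_real (exp (- (a\<^sup>2) / 2))" by simp
  have c: "expectation (\<lambda>\<omega>. cos (a * X \<omega>)) = exp (- (a\<^sup>2 / 2))"
    using arg_cong[OF e, of Re] by (subst (asm) integral_Re[OF int, symmetric]) (simp add: Re_exp)
  have s: "expectation (\<lambda>\<omega>. sin (a * X \<omega>)) = 0"
    using arg_cong[OF e, of Im] by (subst (asm) integral_Im[OF int, symmetric]) (simp add: Im_exp)
  have i: "integrable M (\<lambda>\<omega>. cos (a * X \<omega>))" "integrable M (\<lambda>\<omega>. sin (a * X \<omega>))"
    by (rule integrable_const_bound[where B=1]; simp)+
  show ?thesis using i by (simp add: cos_add c s)
qed

lemma centered_gaussianI: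
  assumes "gaussian_rv M Z" "expectation Z = 0"
  shows "centered_gaussian M Z (expectation (\<lambda>\<omega>. (Z \<omega>)\<^sup>2))"
proof -
  have [measurable]: "Z \<in> borel_measurable M" using assms by (simp add: gaussian_rv_def)
  consider \<mu> where "AE \<omega> in M. Z \<omega> = \<mu>"
    | \<mu> \<sigma> where "0 < \<sigma>" "distributed M lborel Z (\<lambda>x. ennreal (normal_density \<mu> \<sigma> x))"
    using assms by (auto simp: gaussian_rv_def)
  then show ?thesis
  proof cases
    case 1
    have "expectation Z = expectation (\<lambda>_. \<mu>)"
      by (rule integral_cong_AE) (use 1 in auto)
    then have z: "AE \<omega> in M. Z \<omega> = 0" using 1 assms by (simp add: prob_space)
    have "expectation (\<lambda>\<omega>. (Z \<omega>)\<^sup>2) = expectation (\<lambda>_. 0)"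
      by (rule integral_cong_AE) (use z in auto)
    moreover have "expectation (\<lambda>\<omega>. cos (a * Z \<omega> + b)) = expectation (\<lambda>_. cos b)" for a b
      by (rule integral_cong_AE) (use z in auto)
    moreover have "integrable M (\<lambda>\<omega>. (Z \<omega>)\<^sup>2) \<longleftrightarrow> integrable M (\<lambda>\<omega>. 0::real)"
      by (rule integrable_cong_AE) (use z in auto)
    ultimately show ?thesis by (simp add: centered_gaussian_def prob_space)
  next
    case 2
    have m: "\<mu> = 0" using normal_distributed_expectation[OF 2] assms by simp
    have v: "expectation (\<lambda>\<omega>. (Z \<omega>)\<^sup>2) = \<sigma>\<^sup>2"
      using normal_distributed_variance[OF 2] assms by simp
    have "distributed M lborel (\<lambda>\<omega>. (Z \<omega> - \<mu>) / \<sigma>) std_normal_density"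
      using normal_standard_normal_convert[OF 2(1), of Z \<mu>] 2(2) by simp
    note sn = std_normal_expectation_cos[OF this]
    have "expectation (\<lambda>\<omega>. cos (a * Z \<omega> + b)) = exp (- (a\<^sup>2 * \<sigma>\<^sup>2 / 2)) * cos b" for a b
      using sn[of "a * \<sigma>" b] 2(1) m by (simp add: power_mult_distrib)
    \<comment> \<open>The integral of a non-integrable function is 0 by convention, so the positive
      value \<sigma>^2 forces integrability.\<close>
    moreover have "integrable M (\<lambda>\<omega>. (Z \<omega>)\<^sup>2)"
      using v 2(1) not_integrable_integral_eq by fastforce
    ultimately show ?thesis by (simp add: centered_gaussian_def v)
  qed
qed

text \<open>The cosines are bounded by 1, so their expectations pass to the limit by dominated
  convergence, whereas the second moments are only lower semicontinuous.\<close>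

lemma centered_gaussian_limit:
  assumes g: "\<And>m. centered_gaussian M (Z m) (v m)"
    and lim: "\<And>\<omega>. \<omega> \<in> space M \<Longrightarrow> (\<lambda>m. Z m \<omega>) \<longlonglongrightarrow> Y \<omega>" and v: "v \<longlonglongrightarrow> w"
  shows "centered_gaussian M Y w"
proof -
  have [measurable]: "Z m \<in> borel_measurable M" for m using g by (simp add: centered_gaussian_def)
  have [measurable]: "Y \<in> borel_measurable M" by (rule borel_measurable_LIMSEQ_real[OF lim]) auto
  have "expectation (\<lambda>\<omega>. cos (a * Y \<omega> + b)) = exp (- (a\<^sup>2 * w / 2)) * cos b" for a b
  proof (rule LIMSEQ_unique)
    show "(\<lambda>m. expectation (\<lambda>\<omega>. cos (a * Z m \<omega> + b))) \<longlonglongrightarrow> expectation (\<lambda>\<omega>. cos (a * Y \<omega> + b))"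
      by (rule integral_dominated_convergence[where w="\<lambda>_. 1"]) (auto intro!: tendsto_intros lim)
    show "(\<lambda>m. expectation (\<lambda>\<omega>. cos (a * Z m \<omega> + b))) \<longlonglongrightarrow> exp (- (a\<^sup>2 * w / 2)) * cos b"
      using g by (auto simp: centered_gaussian_def intro!: tendsto_intros v)
  qed
  moreover have nn: "(\<integral>\<^sup>+\<omega>. ennreal ((Y \<omega>)\<^sup>2) \<partial>M) \<le> ennreal w"
  proof -
    have "(\<integral>\<^sup>+\<omega>. ennreal ((Y \<omega>)\<^sup>2) \<partial>M) = (\<integral>\<^sup>+\<omega>. liminf (\<lambda>m. ennreal ((Z m \<omega>)\<^sup>2)) \<partial>M)"
      by (intro nn_integral_cong lim_imp_Liminf[symmetric] tendsto_intros) (auto intro!: tendsto_ennrealI tendsto_power lim)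
    also have "\<dots> \<le> liminf (\<lambda>m. \<integral>\<^sup>+\<omega>. ennreal ((Z m \<omega>)\<^sup>2) \<partial>M)"
      by (rule nn_integral_liminf) auto
    also have "\<dots> \<le> liminf (\<lambda>m. ennreal (v m))"
      using g by (intro Liminf_mono always_eventually allI)
        (auto simp: centered_gaussian_def nn_integral_eq_integral intro!: ennreal_leI)
    also have "\<dots> = ennreal w"
      by (intro lim_imp_Liminf tendsto_ennrealI v) auto
    finally show ?thesis .
  qed
  \<comment> \<open>\<open>ennreal\<close> sends negative numbers to 0, so the bound
    \<open>nn\<close> can be read back in the reals only for nonnegative \<open>w\<close>.\<close>
  moreover have "w \<ge> 0"
  proof (rule LIMSEQ_le_const[OF v])
    have "0 \<le> v m" for m
    proof -
      have "0 \<le> expectation (\<lambda>\<omega>. (Z m \<omega>)\<^sup>2)" by simp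
      also have "\<dots> \<le> v m" using g[of m] by (simp add: centered_gaussian_def)
      finally show ?thesis .
    qed
    then show "\<exists>N. \<forall>n\<ge>N. 0 \<le> v n" by auto
  qed
  moreover have i: "integrable M (\<lambda>\<omega>. (Y \<omega>)\<^sup>2)"
    by (rule integrableI_nonneg) (use nn in \<open>auto simp: less_top[symmetric] top_unique\<close>)
  ultimately show ?thesis
    by (simp add: centered_gaussian_def nn_integral_eq_integral)
qed

end

section \<open>Convergence in distribution from characteristic functions\<close>

text \<open>The generators are exactly the functions whose expectations are known from
  characteristic functions, and convergence extends to sums and multiples by linearity. The phase
  brings in sines and constants, and product-to-sum formulas make the class an algebra, as
  Stone-Weierstrass demands.\<close>

inductive trig_poly :: "nat \<Rightarrow> ((nat \<Rightarrow> real) \<Rightarrow> real) \<Rightarrow> bool" for n where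
  cos: "trig_poly n (\<lambda>x. cos ((\<Sum>i<n. u i * x i) + b))"
| add: "trig_poly n f \<Longrightarrow> trig_poly n g \<Longrightarrow> trig_poly n (\<lambda>x. f x + g x)"
| scale: "trig_poly n f \<Longrightarrow> trig_poly n (\<lambda>x. c * f x)"

lemma trig_poly_const: "trig_poly n (\<lambda>_. c)"
  using trig_poly.scale[OF trig_poly.cos[of n "\<lambda>_. 0" 0], of c] by simp

lemma trig_poly_cos_mult:
  assumes "trig_poly n g"
  shows "trig_poly n (\<lambda>x. cos ((\<Sum>i<n. u i * x i) + b) * g x)"
  using assms
proof induction
  case (cos u' b')
  have "trig_poly n (\<lambda>x. (1/2) * cos ((\<Sum>i<n. (u i - u' i) * x i) + (b - b'))
      + (1/2) * cos ((\<Sum>i<n. (u i + u' i) * x i) + (b + b')))"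
    by (intro trig_poly.intros)
  also have "(\<lambda>x. (1/2) * cos ((\<Sum>i<n. (u i - u' i) * x i) + (b - b'))
      + (1/2) * cos ((\<Sum>i<n. (u i + u' i) * x i) + (b + b')))
    = (\<lambda>x. cos ((\<Sum>i<n. u i * x i) + b) * cos ((\<Sum>i<n. u' i * x i) + b'))"
    by (auto simp: cos_times_cos algebra_simps sum.distrib sum_subtractf add_divide_distrib)
  finally show ?case .
next
  case (add f g)
  from trig_poly.add[OF add.IH] show ?case by (simp add: distrib_left)
next
  case (scale f c)
  from trig_poly.scale[OF scale.IH, of c] show ?case by (simp add: mult_ac)
qed

lemma trig_poly_mult:
  assumes "trig_poly n f" "trig_poly n g"
  shows "trig_poly n (\<lambda>x. f x * g x)"
  using assms(1)
proof induction
  case (cos u b)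
  show ?case by (rule trig_poly_cos_mult[OF assms(2)])
next
  case (add f h)
  from trig_poly.add[OF add.IH] show ?case by (simp add: distrib_right)
next
  case (scale f c)
  from trig_poly.scale[OF scale.IH, of c] show ?case by (simp add: mult_ac)
qed

lemma trig_poly_sin_coord:
  assumes "j < n" shows "trig_poly n (\<lambda>x. sin (c * x j))"
proof -
  have "trig_poly n (\<lambda>x. cos ((\<Sum>i<n. (if i = j then c else 0) * x i) + (- (pi/2))))"
    by (rule trig_poly.cos)
  moreover have "(\<Sum>i<n. (if i = j then c else 0) * x i) = c * x j" for x :: "nat \<Rightarrow> real"
    using assms by (simp add: if_distrib[where f="\<lambda>z. z * _"] cong: if_cong)
  ultimately show ?thesis by (simp add: cos_diff)
qed

section \<open>Folding into a box and trigonometric approximation\<close>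

lemma continuous_on_coord: "continuous_on A (\<lambda>x::nat \<Rightarrow> real. x i)"
  by (rule continuous_on_product_then_coordinatewise[OF continuous_on_id])

lemma trig_poly_continuous: "trig_poly n f \<Longrightarrow> continuous_on A f"
  by (induction rule: trig_poly.induct) (auto intro!: continuous_intros continuous_on_coord)

text \<open>The factor \<open>pi / (2 * R)\<close> carries [-R, R] onto [-pi/2, pi/2], the interval
  on which arcsin inverts the sine.\<close>

definition triangle_wave :: "real \<Rightarrow> real \<Rightarrow> real" where
  "triangle_wave R x = arcsin (sin (pi / (2 * R) * x)) * (2 * R / pi)"

lemma sin_triangle_wave: "R > 0 \<Longrightarrow> sin (pi / (2 * R) * triangle_wave R x) = sin (pi / (2 * R) * x)"
  by (simp add: triangle_wave_def)

lemma triangle_wave_id: "R > 0 \<Longrightarrow> \<bar>x\<bar> \<le> R \<Longrightarrow> triangle_wave R x = x"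
proof -
  assume R: "R > 0" "\<bar>x\<bar> \<le> R"
  then have "\<bar>pi / (2 * R) * x\<bar> \<le> pi / (2 * R) * R"
    unfolding abs_mult by (intro mult_mono) auto
  then have "\<bar>pi / (2 * R) * x\<bar> \<le> pi / 2" using R by simp
  then have "arcsin (sin (pi / (2 * R) * x)) = pi / (2 * R) * x"
    by (intro arcsin_sin) linarith+
  then show ?thesis using R by (simp add: triangle_wave_def)
qed

lemma triangle_wave_bound: 
  assumes "R > 0" shows "\<bar>triangle_wave R x\<bar> \<le> R"
proof -
  have "\<bar>arcsin (sin (pi / (2 * R) * x))\<bar> \<le> pi / 2"
    using arcsin_bounded[of "sin (pi / (2 * R) * x)"] by auto
  then have "\<bar>arcsin (sin (pi / (2 * R) * x))\<bar> * (2 * R / pi) \<le> pi / 2 * (2 * R / pi)"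
    using assms by (intro mult_right_mono) auto
  then show ?thesis using assms by (simp add: triangle_wave_def abs_mult)
qed

text \<open>Vectors of length \<open>n\<close> are modelled by sequences vanishing from
  \<open>n\<close> on, so the remaining coordinates are pinned to 0 and Tychonoff's theorem applies
  to the whole product.\<close>

lemma compact_coord_box: "compact {x :: nat \<Rightarrow> real. \<forall>i. x i \<in> (if i < n then {-R..R} else {0})}"
proof -
  have "compactin (product_topology (\<lambda>i::nat. euclidean::real topology) UNIV) (PiE UNIV (\<lambda>i. if i < n then {-R..R} else {0}))"
    by (subst compactin_PiE) auto
  then show ?thesis by (simp add: euclidean_product_topology PiE_UNIV_domain Pi_def)
qed

text \<open>Folding each coordinate into \<open>[-R, R]\<close> by a triangle wave of period \<open>4R\<close> does not change
  a polynomial in \<open>sin (pi x\<^sub>i / (2R))\<close>, so that a Stone-Weierstrass approximation on the box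
  is uniform on the whole space.\<close>

lemma trig_poly_approximation:
  fixes g :: "(nat \<Rightarrow> real) \<Rightarrow> real"
  assumes g: "continuous_on UNIV g" and R: "R > 0" and e: "e > 0"
  shows "\<exists>p. trig_poly n p \<and> (\<forall>x. (\<forall>i\<ge>n. x i = 0) \<longrightarrow> \<bar>g (\<lambda>i. triangle_wave R (x i)) - p x\<bar> < e)"
proof -
  define S where "S = {x :: nat \<Rightarrow> real. \<forall>i. x i \<in> (if i < n then {-R..R} else {0})}"
  define P where "P f \<longleftrightarrow> trig_poly n f \<and> (\<forall>x. f (\<lambda>i. triangle_wave R (x i)) = f x)" for f
  have "\<exists>p. P p \<and> (\<forall>x\<in>S. \<bar>g x - p x\<bar> < e)"
  proof (rule Stone_Weierstrass_HOL)
    show "compact S" unfolding S_def by (rule compact_coord_box)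
    show "P (\<lambda>x. c)" for c by (simp add: P_def trig_poly_const)
    show "continuous_on S f" if "P f" for f using that by (auto simp: P_def trig_poly_continuous)
    show "P (\<lambda>x. f x + h x)" if "P f \<and> P h" for f h
      using that by (auto simp: P_def intro: trig_poly.add)
    show "P (\<lambda>x. f x * h x)" if "P f \<and> P h" for f h
      using that by (auto simp: P_def intro: trig_poly_mult)
    show "\<exists>f. P f \<and> f x \<noteq> f y" if "x \<in> S \<and> y \<in> S \<and> x \<noteq> y" for x y
    proof -
      from that obtain j where j: "x j \<noteq> y j" by auto
      then have jn: "j < n" using that by (auto simp: S_def split: if_splits) (metis singletonD)
      then have b: "x j \<in> {-R..R}" "y j \<in> {-R..R}" using that by (auto simp: S_def dest!: spec[of _ j])
      \<comment> \<open>On [-R, R] the triangle wave recovers the coordinate from this sine, so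
        equal sines would give equal coordinates.\<close>
      have "sin (pi / (2 * R) * x j) \<noteq> sin (pi / (2 * R) * y j)"
        using j triangle_wave_id[OF R, of "x j"] triangle_wave_id[OF R, of "y j"] b
        unfolding triangle_wave_def by (metis abs_le_iff atLeastAtMost_iff minus_le_iff)
      moreover have "P (\<lambda>x. sin (pi / (2 * R) * x j))"
        unfolding P_def using trig_poly_sin_coord[OF jn] sin_triangle_wave[OF R] by blast
      ultimately show ?thesis by blast
    qed
    show "continuous_on S g" using g continuous_on_subset by blast
  qed (rule e)
  then obtain p where p: "P p" "\<And>x. x \<in> S \<Longrightarrow> \<bar>g x - p x\<bar> < e" by blast
  have "\<bar>g (\<lambda>i. triangle_wave R (x i)) - p x\<bar> < e" if "\<forall>i\<ge>n. x i = 0" for x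
  proof -
    have "(\<lambda>i. triangle_wave R (x i)) \<in> S"
      using that triangle_wave_bound[OF R] R by (auto simp: S_def triangle_wave_id abs_le_iff) (metis minus_le_iff)
    from p(2)[OF this] p(1) show ?thesis by (simp add: P_def)
  qed
  then show ?thesis using p(1) by (auto simp: P_def)
qed

lemma trig_poly_expectation_tendsto:
  fixes X :: "nat \<Rightarrow> 'a \<Rightarrow> nat \<Rightarrow> real" and Y :: "'b \<Rightarrow> nat \<Rightarrow> real"
  assumes "prob_space M" "prob_space L"
    and [measurable]: "\<And>N i. (\<lambda>\<omega>. X N \<omega> i) \<in> borel_measurable M" "\<And>i. (\<lambda>\<omega>. Y \<omega> i) \<in> borel_measurable L"
    and char: "\<And>u b. (\<lambda>N. \<integral>\<omega>. cos ((\<Sum>i<n. u i * X N \<omega> i) + b) \<partial>M) \<longlonglongrightarrow> (\<integral>\<omega>. cos ((\<Sum>i<n. u i * Y \<omega> i) + b) \<partial>L)"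
    and p: "trig_poly n p"
  shows "(\<forall>N. integrable M (\<lambda>\<omega>. p (X N \<omega>))) \<and> integrable L (\<lambda>\<omega>. p (Y \<omega>)) \<and>
    (\<lambda>N. \<integral>\<omega>. p (X N \<omega>) \<partial>M) \<longlonglongrightarrow> (\<integral>\<omega>. p (Y \<omega>) \<partial>L)"
proof -
  interpret M: prob_space M by fact
  interpret L: prob_space L by fact
  show ?thesis using p
  proof induction
    case (cos u b)
    show ?case using char[of u b] by (auto intro!: M.integrable_const_bound[where B=1] L.integrable_const_bound[where B=1])
  next
    case (add f g)
    then show ?case by (auto intro!: tendsto_add)
  next
    case (scale f c)
    then show ?case by (auto intro!: tendsto_mult)
  qed
qed

text \<open>Inside the box folding is the identity and the error is below \<open>e\<close>. Outside,
  \<open>p\<close> is still within \<open>e\<close> of some value of \<open>g\<close>, so the error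
  is at most 2 K + e there. Chebyshev's inequality, in the form 1 <= sum (X_i / R)^2 off the box,
  bounds the contribution of that event by 2 K n V / R^2.\<close>

lemma trig_poly_expectation_error:
  fixes X :: "'a \<Rightarrow> nat \<Rightarrow> real"
  assumes "prob_space M" and [measurable]: "\<And>i. (\<lambda>\<omega>. X \<omega> i) \<in> borel_measurable M"
    and zero: "\<And>\<omega> i. i \<ge> n \<Longrightarrow> X \<omega> i = 0"
    and var: "\<And>i. i < n \<Longrightarrow> integrable M (\<lambda>\<omega>. (X \<omega> i)\<^sup>2)" "\<And>i. i < n \<Longrightarrow> (\<integral>\<omega>. (X \<omega> i)\<^sup>2 \<partial>M) \<le> V"
    and g: "continuous_on UNIV g" "\<And>x. \<bar>g x\<bar> \<le> K" and R: "R > 0"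
    and p: "\<And>x. (\<forall>i\<ge>n. x i = 0) \<Longrightarrow> \<bar>g (\<lambda>i. triangle_wave R (x i)) - p x\<bar> < e"
    and pint: "integrable M (\<lambda>\<omega>. p (X \<omega>))"
  shows "\<bar>(\<integral>\<omega>. g (X \<omega>) \<partial>M) - (\<integral>\<omega>. p (X \<omega>) \<partial>M)\<bar> \<le> e + 2 * K * (real n * V) / R\<^sup>2"
proof -
  interpret M: prob_space M by fact
  have K: "K \<ge> 0" using g(2)[of undefined] by linarith
  have "X \<in> borel_measurable M"
    by (rule measurable_coordinatewise_then_product) measurable
  then have [measurable]: "(\<lambda>\<omega>. g (X \<omega>)) \<in> borel_measurable M"
    using borel_measurable_continuous_onI[OF g(1)] measurable_compose by blast
  have gint: "integrable M (\<lambda>\<omega>. g (X \<omega>))"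
    by (rule M.integrable_const_bound[where B=K]) (use g(2) in auto)
  have b: "\<bar>g (X \<omega>) - p (X \<omega>)\<bar> \<le> e + 2 * K / R\<^sup>2 * (\<Sum>i<n. (X \<omega> i)\<^sup>2)" for \<omega>
  proof (cases "\<forall>i<n. \<bar>X \<omega> i\<bar> \<le> R")
    case True
    then have "(\<lambda>i. triangle_wave R (X \<omega> i)) = X \<omega>"
      using zero R by (intro ext) (metis abs_zero less_imp_le linorder_not_less triangle_wave_id)
    then have "\<bar>g (X \<omega>) - p (X \<omega>)\<bar> < e" using p[of "X \<omega>"] zero by simp
    moreover have "0 \<le> 2 * K / R\<^sup>2 * (\<Sum>i<n. (X \<omega> i)\<^sup>2)" using K by (intro mult_nonneg_nonneg sum_nonneg) auto
    ultimately show ?thesis by linarith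
  next
    case False
    then obtain j where j: "j < n" "R < \<bar>X \<omega> j\<bar>" by auto
    have "R\<^sup>2 \<le> (X \<omega> j)\<^sup>2" using j R by (intro abs_le_square_iff[THEN iffD1]) auto
    also have "\<dots> \<le> (\<Sum>i<n. (X \<omega> i)\<^sup>2)" using j by (intro member_le_sum) auto
    finally have "2 * K * 1 \<le> 2 * K * ((\<Sum>i<n. (X \<omega> i)\<^sup>2) / R\<^sup>2)"
      using K R by (intro mult_left_mono) auto
    moreover have "\<bar>g (X \<omega>) - p (X \<omega>)\<bar> \<le> 2 * K + e"
      using p[of "X \<omega>"] zero g(2)[of "X \<omega>"] g(2)[of "\<lambda>i. triangle_wave R (X \<omega> i)"] by auto
    ultimately show ?thesis by simp
  qed
  have "\<bar>(\<integral>\<omega>. g (X \<omega>) \<partial>M) - (\<integral>\<omega>. p (X \<omega>) \<partial>M)\<bar> = \<bar>\<integral>\<omega>. g (X \<omega>) - p (X \<omega>) \<partial>M\<bar>"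
    using gint pint by simp
  also have "\<dots> \<le> (\<integral>\<omega>. \<bar>g (X \<omega>) - p (X \<omega>)\<bar> \<partial>M)" by (rule integral_abs_bound)
  also have "\<dots> \<le> (\<integral>\<omega>. e + 2 * K / R\<^sup>2 * (\<Sum>i<n. (X \<omega> i)\<^sup>2) \<partial>M)"
    by (intro integral_mono b Bochner_Integration.integrable_add integrable_mult_right
        Bochner_Integration.integrable_sum integrable_abs Bochner_Integration.integrable_diff gint pint)
      (use var(1) in auto)
  also have "\<dots> = e + 2 * K / R\<^sup>2 * (\<Sum>i<n. \<integral>\<omega>. (X \<omega> i)\<^sup>2 \<partial>M)"
  proof -
    have "integrable M (\<lambda>\<omega>. 2 * K / R\<^sup>2 * (\<Sum>i<n. (X \<omega> i)\<^sup>2))"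
      by (intro integrable_mult_right Bochner_Integration.integrable_sum) (use var(1) in auto)
    from Bochner_Integration.integral_add[OF _ this, of "\<lambda>_. e"]
    have "(\<integral>\<omega>. e + 2 * K / R\<^sup>2 * (\<Sum>i<n. (X \<omega> i)\<^sup>2) \<partial>M)
        = e + (\<integral>\<omega>. 2 * K / R\<^sup>2 * (\<Sum>i<n. (X \<omega> i)\<^sup>2) \<partial>M)"
      by (simp add: M.prob_space)
    also have "\<dots> = e + 2 * K / R\<^sup>2 * (\<integral>\<omega>. (\<Sum>i<n. (X \<omega> i)\<^sup>2) \<partial>M)"
      by (simp only: integral_mult_right_zero)
    also have "(\<integral>\<omega>. (\<Sum>i<n. (X \<omega> i)\<^sup>2) \<partial>M) = (\<Sum>i<n. \<integral>\<omega>. (X \<omega> i)\<^sup>2 \<partial>M)"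
      by (rule Bochner_Integration.integral_sum) (use var(1) in auto)
    finally show ?thesis .
  qed
  also have "\<dots> \<le> e + 2 * K / R\<^sup>2 * (real n * V)"
    using var(2) K sum_bounded_above[of "{..<n}" "\<lambda>i. \<integral>\<omega>. (X \<omega> i)\<^sup>2 \<partial>M" V]
    by (intro add_left_mono mult_left_mono) auto
  finally show ?thesis by simp
qed

text \<open>The bounded second moments supply the tightness in this form of Levy's continuity theorem.\<close>

theorem converges_in_distribution_charI:
  fixes X :: "nat \<Rightarrow> 'a \<Rightarrow> nat \<Rightarrow> real" and Y :: "'b \<Rightarrow> nat \<Rightarrow> real"
  assumes prob: "prob_space M" "prob_space L"
    and meas: "\<And>N i. (\<lambda>\<omega>. X N \<omega> i) \<in> borel_measurable M" "\<And>i. (\<lambda>\<omega>. Y \<omega> i) \<in> borel_measurable L"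
    and zero: "\<And>N \<omega> i. i \<ge> n \<Longrightarrow> X N \<omega> i = 0" "\<And>\<omega> i. i \<ge> n \<Longrightarrow> Y \<omega> i = 0"
    and var: "\<And>N i. i < n \<Longrightarrow> integrable M (\<lambda>\<omega>. (X N \<omega> i)\<^sup>2)" "\<And>N i. i < n \<Longrightarrow> (\<integral>\<omega>. (X N \<omega> i)\<^sup>2 \<partial>M) \<le> V"
      "\<And>i. i < n \<Longrightarrow> integrable L (\<lambda>\<omega>. (Y \<omega> i)\<^sup>2)" "\<And>i. i < n \<Longrightarrow> (\<integral>\<omega>. (Y \<omega> i)\<^sup>2 \<partial>L) \<le> V"
    and char: "\<And>u b. (\<lambda>N. \<integral>\<omega>. cos ((\<Sum>i<n. u i * X N \<omega> i) + b) \<partial>M) \<longlonglongrightarrow> (\<integral>\<omega>. cos ((\<Sum>i<n. u i * Y \<omega> i) + b) \<partial>L)"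
  shows "converges_in_distribution (Euclidean_space n) M X L Y"
  unfolding converges_in_distribution_def
proof (intro allI impI)
  fix g0 :: "(nat \<Rightarrow> real) \<Rightarrow> real"
  assume g0: "continuous_map (Euclidean_space n) euclideanreal g0 \<and> bounded (g0 ` topspace (Euclidean_space n))"
  \<comment> \<open>\<open>g0\<close> is controlled only on the sequences vanishing from
    \<open>n\<close> on; composing with the projection extends it to a bounded continuous function
    of all sequences.\<close>
  define g where "g x = g0 (\<lambda>i. if i < n then x i else 0)" for x
  have "continuous_on {x. \<forall>i\<ge>n. x i = 0} g0"
    using g0 by (simp add: Euclidean_space_def euclidean_product_topology)
  moreover have "continuous_on UNIV (\<lambda>x::nat \<Rightarrow> real. (\<lambda>i. if i < n then x i else 0))"
  proof (rule continuous_on_coordinatewise_then_product)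
    show "continuous_on UNIV (\<lambda>x::nat \<Rightarrow> real. if i < n then x i else 0)" for i
      by (cases "i < n") (auto intro!: continuous_on_coord)
  qed
  ultimately have g: "continuous_on UNIV g"
    unfolding g_def by (rule continuous_on_compose2) auto
  obtain K where "\<And>x. x \<in> topspace (Euclidean_space n) \<Longrightarrow> \<bar>g0 x\<bar> \<le> K"
    using g0 by (auto simp: bounded_iff)
  then have K: "\<bar>g x\<bar> \<le> K" for x by (simp add: g_def topspace_Euclidean_space)
  have gX: "g0 (X N \<omega>) = g (X N \<omega>)" and gY: "g0 (Y \<omega>') = g (Y \<omega>')" for N \<omega> \<omega>'
    unfolding g_def using zero by (auto intro!: arg_cong[where f=g0])
  have "(\<lambda>N. \<integral>\<omega>. g (X N \<omega>) \<partial>M) \<longlonglongrightarrow> (\<integral>\<omega>. g (Y \<omega>) \<partial>L)"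
  proof (rule metric_LIMSEQ_I)
    fix e :: real assume e: "e > 0"
    \<comment> \<open>The tail bound C / R^2 does not depend on \<open>p\<close>, so R can be fixed
      before the approximation is chosen for it. The errors add up to 2 (e/6 + e/6) + e/6 <
      e.\<close>
    define C where "C = 2 * K * (real n * V)"
    have "(\<lambda>m. C / (real (Suc m))\<^sup>2) \<longlonglongrightarrow> 0" by real_asymp
    then obtain m where m: "C / (real (Suc m))\<^sup>2 < e / 6"
      using e order_tendstoD(2)[of _ 0 sequentially "e / 6"] by (fastforce simp: eventually_sequentially)
    have R: "real (Suc m) > 0" by simp
    obtain p where p: "trig_poly n p"
        "\<And>x. (\<forall>i\<ge>n. x i = 0) \<Longrightarrow> \<bar>g (\<lambda>i. triangle_wave (real (Suc m)) (x i)) - p x\<bar> < e / 6"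
      using trig_poly_approximation[OF g R, of "e/6" n] e by auto
    note pt = trig_poly_expectation_tendsto[OF prob meas char p(1)]
    have 1: "\<bar>(\<integral>\<omega>. g (X N \<omega>) \<partial>M) - (\<integral>\<omega>. p (X N \<omega>) \<partial>M)\<bar> \<le> e / 6 + C / (real (Suc m))\<^sup>2" for N
      unfolding C_def using pt
      by (intro trig_poly_expectation_error[OF prob(1) meas(1) zero(1) var(1,2) g K R p(2)]) auto
    have 2: "\<bar>(\<integral>\<omega>. g (Y \<omega>) \<partial>L) - (\<integral>\<omega>. p (Y \<omega>) \<partial>L)\<bar> \<le> e / 6 + C / (real (Suc m))\<^sup>2"
      unfolding C_def using pt
      by (intro trig_poly_expectation_error[OF prob(2) meas(2) zero(2) var(3,4) g K R p(2)]) auto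
    obtain N0 where N0: "\<And>N. N \<ge> N0 \<Longrightarrow> \<bar>(\<integral>\<omega>. p (X N \<omega>) \<partial>M) - (\<integral>\<omega>. p (Y \<omega>) \<partial>L)\<bar> < e / 6"
      using pt e unfolding lim_sequentially dist_real_def by (metis divide_pos_pos zero_less_numeral)
    have "dist (\<integral>\<omega>. g (X N \<omega>) \<partial>M) (\<integral>\<omega>. g (Y \<omega>) \<partial>L) < e" if "N \<ge> N0" for N
      using 1[of N] 2 N0[OF that] m e unfolding dist_real_def by linarith
    then show "\<exists>N0. \<forall>N\<ge>N0. dist (\<integral>\<omega>. g (X N \<omega>) \<partial>M) (\<integral>\<omega>. g (Y \<omega>) \<partial>L) < e" by blast
  qed
  then show "(\<lambda>N. \<integral>\<omega>. g0 (X N \<omega>) \<partial>M) \<longlonglongrightarrow> (\<integral>\<omega>. g0 (Y \<omega>) \<partial>L)" by (simp add: gX gY)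
qed

section \<open>The isometry between functionals of the bridge and L2[0,1]\<close>

text \<open>\<open>gaussian_process\<close> speaks of sums over sets of times, while a family
  \<open>t\<close> may repeat a time; the coefficients belonging to equal times are
  collected.\<close>

lemma gaussian_process_indexed:
  assumes gp: "gaussian_process M X T" and I: "finite I" "\<And>i. i \<in> I \<Longrightarrow> t i \<in> T"
  shows "gaussian_rv M (\<lambda>\<omega>. \<Sum>i\<in>I. c i * X (t i) \<omega>)"
proof -
  have regroup: "(\<lambda>\<omega>. \<Sum>i\<in>I. c i * X (t i) \<omega>) = (\<lambda>\<omega>. \<Sum>s\<in>t ` I. (\<Sum>i\<in>{i\<in>I. t i = s}. c i) * X s \<omega>)"
  proof
    fix \<omega>
    have "(\<Sum>i\<in>I. c i * X (t i) \<omega>) = (\<Sum>s\<in>t ` I. \<Sum>i\<in>{i\<in>I. t i = s}. c i * X (t i) \<omega>)"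
      using I by (intro sum.image_gen)
    then show "(\<Sum>i\<in>I. c i * X (t i) \<omega>) = (\<Sum>s\<in>t ` I. (\<Sum>i\<in>{i\<in>I. t i = s}. c i) * X s \<omega>)"
      by (simp add: sum_distrib_right)
  qed
  show ?thesis
    unfolding regroup by (rule gp[unfolded gaussian_process_def, rule_format]) (use I in auto)
qed

context prob_space
begin

lemma integrable_mult_of_squares:
  fixes X Y :: "'a \<Rightarrow> real"
  assumes [measurable]: "X \<in> borel_measurable M" "Y \<in> borel_measurable M"
    and sq: "integrable M (\<lambda>\<omega>. (X \<omega>)\<^sup>2)" "integrable M (\<lambda>\<omega>. (Y \<omega>)\<^sup>2)"
  shows "integrable M (\<lambda>\<omega>. X \<omega> * Y \<omega>)"
proof (rule Bochner_Integration.integrable_bound[OF Bochner_Integration.integrable_add[OF sq]])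
  have "\<bar>x * y\<bar> \<le> x\<^sup>2 + y\<^sup>2" for x y :: real
  proof -
    have "2 * \<bar>x\<bar> * \<bar>y\<bar> \<le> x\<^sup>2 + y\<^sup>2" using sum_squares_bound[of "\<bar>x\<bar>" "\<bar>y\<bar>"] by simp
    moreover have "0 \<le> x\<^sup>2 + y\<^sup>2" by simp
    ultimately show ?thesis unfolding abs_mult by linarith
  qed
  then show "AE \<omega> in M. norm (X \<omega> * Y \<omega>) \<le> norm ((X \<omega>)\<^sup>2 + (Y \<omega>)\<^sup>2)" by simp
qed simp

text \<open>The variance is expanded bilinearly. The products are integrable because each single
  variable, being Gaussian, is square integrable. The lemma serves the bridge and both limit
  collections.\<close>

lemma gaussian_process_combination:
  assumes gp: "gaussian_process M X T" and mean: "\<And>t. t \<in> T \<Longrightarrow> expectation (X t) = 0"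
    and I: "finite I" "\<And>i. i \<in> I \<Longrightarrow> t i \<in> T"
  shows "centered_gaussian M (\<lambda>\<omega>. \<Sum>i\<in>I. c i * X (t i) \<omega>)
    (\<Sum>i\<in>I. \<Sum>j\<in>I. c i * c j * expectation (\<lambda>\<omega>. X (t i) \<omega> * X (t j) \<omega>))"
proof -
  have rv: "gaussian_rv M (X s)" if "s \<in> T" for s
    using gp[unfolded gaussian_process_def, rule_format, of "{s}" "\<lambda>_. 1"] that by simp
  then have meas: "X s \<in> borel_measurable M" if "s \<in> T" for s
    using that by (simp add: gaussian_rv_def)
  have sq: "integrable M (\<lambda>\<omega>. (X s \<omega>)\<^sup>2)" if "s \<in> T" for s
    using centered_gaussianI[OF rv[OF that] mean[OF that]] by (simp add: centered_gaussian_def)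
  have int: "integrable M (X s)" if "s \<in> T" for s
    by (rule square_integrable_imp_integrable[OF meas[OF that] sq[OF that]])
  have prod: "integrable M (\<lambda>\<omega>. X s \<omega> * X r \<omega>)" if "s \<in> T" "r \<in> T" for s r
    by (rule integrable_mult_of_squares[OF meas[OF that(1)] meas[OF that(2)] sq[OF that(1)] sq[OF that(2)]])
  have "gaussian_rv M (\<lambda>\<omega>. \<Sum>i\<in>I. c i * X (t i) \<omega>)"
    by (rule gaussian_process_indexed[OF gp I])
  moreover have "expectation (\<lambda>\<omega>. \<Sum>i\<in>I. c i * X (t i) \<omega>) = 0"
    by (subst Bochner_Integration.integral_sum) (auto simp: int I mean)
  ultimately have "centered_gaussian M (\<lambda>\<omega>. \<Sum>i\<in>I. c i * X (t i) \<omega>)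
      (expectation (\<lambda>\<omega>. (\<Sum>i\<in>I. c i * X (t i) \<omega>)\<^sup>2))"
    by (rule centered_gaussianI)
  also have "expectation (\<lambda>\<omega>. (\<Sum>i\<in>I. c i * X (t i) \<omega>)\<^sup>2)
      = expectation (\<lambda>\<omega>. \<Sum>i\<in>I. \<Sum>j\<in>I. (c i * c j) * (X (t i) \<omega> * X (t j) \<omega>))"
    by (simp add: power2_eq_square sum_product mult_ac)
  also have "\<dots> = (\<Sum>i\<in>I. expectation (\<lambda>\<omega>. \<Sum>j\<in>I. (c i * c j) * (X (t i) \<omega> * X (t j) \<omega>)))"
    by (intro Bochner_Integration.integral_sum Bochner_Integration.integrable_sum integrable_mult_right prod I)
  also have "\<dots> = (\<Sum>i\<in>I. \<Sum>j\<in>I. expectation (\<lambda>\<omega>. (c i * c j) * (X (t i) \<omega> * X (t j) \<omega>)))"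
    by (intro sum.cong refl Bochner_Integration.integral_sum integrable_mult_right prod I)
  finally show ?thesis by (simp only: integral_mult_right_zero)
qed

end

text \<open>The indicator of [0,t] projected orthogonally to the constants. On (0,1) the kernel
  vanishes for t = 0 and t = 1, matching \<open>B 0 = B 1 = 0\<close>.\<close>

definition bridge_kernel :: "real \<Rightarrow> real \<Rightarrow> real" where
  "bridge_kernel t r = (if r \<le> t then 1 else 0) - t"

lemma has_integral_initial_segment:
  fixes f :: "real \<Rightarrow> real"
  assumes "t \<in> {0..1}" "(f has_integral I) {0..t}"
  shows "((\<lambda>r. if r \<le> t then f r else 0) has_integral I) {0..1}"
proof -
  have "((\<lambda>r. if r \<in> {0..t} then f r else 0) has_integral I) {0..1}"
    using assms by (subst has_integral_restrict) auto
  then show ?thesis by (rule has_integral_eq[rotated]) auto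
qed

lemma bridge_kernel_inner:
  assumes "s \<in> {0..1}" "t \<in> {0..1}"
  shows "((\<lambda>r. bridge_kernel s r * bridge_kernel t r) has_integral (min s t - s * t)) {0..1}"
proof -
  have one: "((\<lambda>r. if r \<le> u then 1 else 0) has_integral u) {0..1}" if "u \<in> {0..1}" for u :: real
    using has_integral_initial_segment[OF that, of "\<lambda>_. 1" u] has_integral_const_real[of "1::real" 0 u] that by simp
  have c: "((\<lambda>r. s * t) has_integral (s * t)) {0..1::real}"
    using has_integral_const_real[of "s * t" 0 1] by simp
  have "((\<lambda>r. (if r \<le> min s t then 1 else 0) - t * (if r \<le> s then 1 else 0) - s * (if r \<le> t then 1 else 0) + s * t)
      has_integral (min s t - t * s - s * t + s * t)) {0..1::real}"
    by (intro has_integral_add has_integral_diff has_integral_mult_right one c) (use assms in auto)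
  then show ?thesis by (rule has_integral_eq[rotated, THEN has_integral_eq_rhs])
    (auto simp: bridge_kernel_def algebra_simps)
qed

text \<open>The isometry as a relation: a variable and a kernel are paired when one choice of times
  and coefficients produces both. Linearity then means merging coefficients, without a question of
  well-definedness.\<close>

definition bridge_combination :: "(real \<Rightarrow> 'a \<Rightarrow> real) \<Rightarrow> ('a \<Rightarrow> real) \<Rightarrow> (real \<Rightarrow> real) \<Rightarrow> bool" where
  "bridge_combination B Z \<phi> \<longleftrightarrow> (\<exists>S c. finite S \<and> S \<subseteq> {0..1} \<and>
     Z = (\<lambda>\<omega>. \<Sum>t\<in>S. c t * B t \<omega>) \<and> \<phi> = (\<lambda>r. \<Sum>t\<in>S. c t * bridge_kernel t r))"

lemma bridge_combination_single:
  "t \<in> {0..1} \<Longrightarrow> bridge_combination B (B t) (bridge_kernel t)"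
  unfolding bridge_combination_def by (rule exI[of _ "{t}"], rule exI[of _ "\<lambda>_. 1"]) auto

lemma bridge_combination_zero: "bridge_combination B (\<lambda>_. 0) (\<lambda>_. 0)"
  unfolding bridge_combination_def by (rule exI[of _ "{}"]) auto

lemma bridge_combination_scale:
  assumes "bridge_combination B Z \<phi>"
  shows "bridge_combination B (\<lambda>\<omega>. a * Z \<omega>) (\<lambda>r. a * \<phi> r)"
proof -
  from assms obtain S c where S: "finite S" "S \<subseteq> {0..1}" "Z = (\<lambda>\<omega>. \<Sum>t\<in>S. c t * B t \<omega>)"
    "\<phi> = (\<lambda>r. \<Sum>t\<in>S. c t * bridge_kernel t r)" unfolding bridge_combination_def by blast
  show ?thesis unfolding bridge_combination_def
    by (rule exI[of _ S], rule exI[of _ "\<lambda>t. a * c t"]) (auto simp: S sum_distrib_left mult.assoc)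
qed

lemma bridge_combination_add:
  assumes "bridge_combination B Z \<phi>" "bridge_combination B Z' \<phi>'"
  shows "bridge_combination B (\<lambda>\<omega>. Z \<omega> + Z' \<omega>) (\<lambda>r. \<phi> r + \<phi>' r)"
proof -
  from assms(1) obtain S c where S: "finite S" "S \<subseteq> {0..1}" "Z = (\<lambda>\<omega>. \<Sum>t\<in>S. c t * B t \<omega>)"
    "\<phi> = (\<lambda>r. \<Sum>t\<in>S. c t * bridge_kernel t r)" unfolding bridge_combination_def by blast
  from assms(2) obtain S' c' where S': "finite S'" "S' \<subseteq> {0..1}" "Z' = (\<lambda>\<omega>. \<Sum>t\<in>S'. c' t * B t \<omega>)"
    "\<phi>' = (\<lambda>r. \<Sum>t\<in>S'. c' t * bridge_kernel t r)" unfolding bridge_combination_def by blast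
  have ext: "(\<Sum>t\<in>S. c t * g t) + (\<Sum>t\<in>S'. c' t * g t)
      = (\<Sum>t\<in>S \<union> S'. ((if t \<in> S then c t else 0) + (if t \<in> S' then c' t else 0)) * g t)" for g :: "real \<Rightarrow> real"
  proof -
    have "(\<Sum>t\<in>S. c t * g t) = (\<Sum>t\<in>S \<union> S'. (if t \<in> S then c t else 0) * g t)"
      by (rule sum.mono_neutral_cong_left) (use S S' in auto)
    moreover have "(\<Sum>t\<in>S'. c' t * g t) = (\<Sum>t\<in>S \<union> S'. (if t \<in> S' then c' t else 0) * g t)"
      by (rule sum.mono_neutral_cong_left) (use S S' in auto)
    ultimately show ?thesis by (simp add: sum.distrib distrib_right)
  qed
  show ?thesis unfolding bridge_combination_def
    by (rule exI[of _ "S \<union> S'"], rule exI[of _ "\<lambda>t. (if t \<in> S then c t else 0) + (if t \<in> S' then c' t else 0)"])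
      (use S(1,2) S'(1,2) in \<open>simp add: S(3,4) S'(3,4) ext[abs_def]\<close>)
qed

lemma bridge_combination_sum:
  assumes "finite I" "\<And>i. i \<in> I \<Longrightarrow> bridge_combination B (Z i) (\<phi> i)"
  shows "bridge_combination B (\<lambda>\<omega>. \<Sum>i\<in>I. Z i \<omega>) (\<lambda>r. \<Sum>i\<in>I. \<phi> i r)"
  using assms by induction (auto intro: bridge_combination_zero bridge_combination_add)

text \<open>The Brownian bridge is an isometry of the span of the kernels \<open>1[r \<le> t] - t\<close> into the
  Gaussian variables, because their \<open>L\<^sup>2[0,1]\<close> inner products are \<open>min s t - s t\<close>.\<close>

lemma bridge_combination_gaussian:
  assumes bb: "brownian_bridge M B" and e: "bridge_combination B Z \<phi>"
  shows "\<exists>v. ((\<lambda>r. (\<phi> r)\<^sup>2) has_integral v) {0..1} \<and> centered_gaussian M Z v"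
proof -
  interpret prob_space M using bb by (simp add: brownian_bridge_def)
  from e obtain S c where S: "finite S" "S \<subseteq> {0..1}" "Z = (\<lambda>\<omega>. \<Sum>t\<in>S. c t * B t \<omega>)"
    "\<phi> = (\<lambda>r. \<Sum>t\<in>S. c t * bridge_kernel t r)" unfolding bridge_combination_def by blast
  define v where "v = (\<Sum>s\<in>S. \<Sum>t\<in>S. c s * c t * (min s t - s * t))"
  have "centered_gaussian M Z (\<Sum>s\<in>S. \<Sum>t\<in>S. c s * c t * expectation (\<lambda>\<omega>. B s \<omega> * B t \<omega>))"
    unfolding S(3) using bb S
    by (intro gaussian_process_combination[where T="{0..1}" and t="\<lambda>s. s"]) (auto simp: brownian_bridge_def)
  also have "(\<Sum>s\<in>S. \<Sum>t\<in>S. c s * c t * expectation (\<lambda>\<omega>. B s \<omega> * B t \<omega>)) = v"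
    unfolding v_def
  proof (intro sum.cong refl)
    fix s t assume "s \<in> S" "t \<in> S"
    then have "s \<in> {0..1}" "t \<in> {0..1}" using S(2) by auto
    then have "expectation (\<lambda>\<omega>. B s \<omega> * B t \<omega>) = min s t - s * t"
      using bb unfolding brownian_bridge_def by blast
    then show "c s * c t * expectation (\<lambda>\<omega>. B s \<omega> * B t \<omega>) = c s * c t * (min s t - s * t)" by simp
  qed
  finally have g: "centered_gaussian M Z v" .
  have "((\<lambda>r. \<Sum>s\<in>S. \<Sum>t\<in>S. c s * c t * (bridge_kernel s r * bridge_kernel t r)) has_integral v) {0..1}"
    unfolding v_def using S(1,2)
    by (intro has_integral_sum has_integral_mult_right bridge_kernel_inner) auto
  then have "((\<lambda>r. (\<phi> r)\<^sup>2) has_integral v) {0..1}"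
    by (rule has_integral_eq[rotated]) (simp add: S(4) power2_eq_square sum_product mult_ac)
  with g show ?thesis by blast
qed

text \<open>The endpoints are left out because the kernels of left-endpoint Riemann sums converge to the
  wrong value at \<open>r = 0\<close>.\<close>

definition wiener_rep :: "'a measure \<Rightarrow> (real \<Rightarrow> 'a \<Rightarrow> real) \<Rightarrow> ('a \<Rightarrow> real) \<Rightarrow> (real \<Rightarrow> real) \<Rightarrow> bool" where
  "wiener_rep M B Z \<phi> \<longleftrightarrow> (\<exists>Zs \<phi>s K. (\<forall>m::nat. bridge_combination B (Zs m) (\<phi>s m)) \<and>
     (\<forall>\<omega>\<in>space M. (\<lambda>m. Zs m \<omega>) \<longlonglongrightarrow> Z \<omega>) \<and>
     (\<forall>r\<in>{0<..<1}. (\<lambda>m. \<phi>s m r) \<longlonglongrightarrow> \<phi> r) \<and> (\<forall>r\<in>{0<..<1}. \<forall>m. \<bar>\<phi>s m r\<bar> \<le> (K::real)))"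

lemma wiener_repE:
  assumes "wiener_rep M B Z \<phi>"
  obtains Zs \<phi>s K where "\<And>m::nat. bridge_combination B (Zs m) (\<phi>s m)"
    "\<And>\<omega>. \<omega> \<in> space M \<Longrightarrow> (\<lambda>m. Zs m \<omega>) \<longlonglongrightarrow> Z \<omega>"
    "\<And>r. r \<in> {0<..<1} \<Longrightarrow> (\<lambda>m. \<phi>s m r) \<longlonglongrightarrow> \<phi> r"
    "\<And>r m. r \<in> {0<..<1} \<Longrightarrow> \<bar>\<phi>s m r\<bar> \<le> (K::real)"
  using assms unfolding wiener_rep_def by blast

lemma wiener_repI:
  assumes "\<And>m::nat. bridge_combination B (Zs m) (\<phi>s m)"
    "\<And>\<omega>. \<omega> \<in> space M \<Longrightarrow> (\<lambda>m. Zs m \<omega>) \<longlonglongrightarrow> Z \<omega>"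
    "\<And>r. r \<in> {0<..<1} \<Longrightarrow> (\<lambda>m. \<phi>s m r) \<longlonglongrightarrow> \<phi> r"
    "\<And>r m. r \<in> {0<..<1} \<Longrightarrow> \<bar>\<phi>s m r\<bar> \<le> (K::real)"
  shows "wiener_rep M B Z \<phi>"
  using assms unfolding wiener_rep_def by blast

lemma wiener_rep_combination:
  assumes "bridge_combination B Z \<phi>" "\<And>r. r \<in> {0<..<1} \<Longrightarrow> \<bar>\<phi> r\<bar> \<le> K"
  shows "wiener_rep M B Z \<phi>"
  by (rule wiener_repI[where Zs="\<lambda>_. Z" and \<phi>s="\<lambda>_. \<phi>"]) (use assms in auto)

lemma wiener_rep_single: "t \<in> {0..1} \<Longrightarrow> wiener_rep M B (B t) (bridge_kernel t)"
  by (rule wiener_rep_combination[OF bridge_combination_single, where K=1]) (auto simp: bridge_kernel_def)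

lemma wiener_rep_scale:
  assumes "wiener_rep M B Z \<phi>"
  shows "wiener_rep M B (\<lambda>\<omega>. a * Z \<omega>) (\<lambda>r. a * \<phi> r)"
  using assms
proof (rule wiener_repE)
  fix Zs \<phi>s K
  assume *: "\<And>m::nat. bridge_combination B (Zs m) (\<phi>s m)"
    "\<And>\<omega>. \<omega> \<in> space M \<Longrightarrow> (\<lambda>m. Zs m \<omega>) \<longlonglongrightarrow> Z \<omega>"
    "\<And>r. r \<in> {0<..<1} \<Longrightarrow> (\<lambda>m. \<phi>s m r) \<longlonglongrightarrow> \<phi> r"
    "\<And>r m. r \<in> {0<..<1} \<Longrightarrow> \<bar>\<phi>s m r\<bar> \<le> (K::real)"
  show ?thesis
    by (rule wiener_repI[where Zs="\<lambda>m \<omega>. a * Zs m \<omega>" and \<phi>s="\<lambda>m r. a * \<phi>s m r" and K="\<bar>a\<bar> * K"])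
      (auto intro!: bridge_combination_scale tendsto_intros mult_left_mono * simp: abs_mult)
qed

lemma wiener_rep_add:
  assumes "wiener_rep M B Z \<phi>" "wiener_rep M B Z' \<phi>'"
  shows "wiener_rep M B (\<lambda>\<omega>. Z \<omega> + Z' \<omega>) (\<lambda>r. \<phi> r + \<phi>' r)"
proof -
  obtain Zs \<phi>s K where 1: "\<And>m::nat. bridge_combination B (Zs m) (\<phi>s m)"
    "\<And>\<omega>. \<omega> \<in> space M \<Longrightarrow> (\<lambda>m. Zs m \<omega>) \<longlonglongrightarrow> Z \<omega>"
    "\<And>r. r \<in> {0<..<1} \<Longrightarrow> (\<lambda>m. \<phi>s m r) \<longlonglongrightarrow> \<phi> r"
    "\<And>r m. r \<in> {0<..<1} \<Longrightarrow> \<bar>\<phi>s m r\<bar> \<le> (K::real)" using wiener_repE[OF assms(1)] by blast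
  obtain Zs' \<phi>s' K' where 2: "\<And>m::nat. bridge_combination B (Zs' m) (\<phi>s' m)"
    "\<And>\<omega>. \<omega> \<in> space M \<Longrightarrow> (\<lambda>m. Zs' m \<omega>) \<longlonglongrightarrow> Z' \<omega>"
    "\<And>r. r \<in> {0<..<1} \<Longrightarrow> (\<lambda>m. \<phi>s' m r) \<longlonglongrightarrow> \<phi>' r"
    "\<And>r m. r \<in> {0<..<1} \<Longrightarrow> \<bar>\<phi>s' m r\<bar> \<le> (K'::real)" using wiener_repE[OF assms(2)] by blast
  show ?thesis
  proof (rule wiener_repI)
    show "bridge_combination B (\<lambda>\<omega>. Zs m \<omega> + Zs' m \<omega>) (\<lambda>r. \<phi>s m r + \<phi>s' m r)" for m
      by (intro bridge_combination_add 1 2)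
    show "\<bar>\<phi>s m r + \<phi>s' m r\<bar> \<le> K + K'" if "r \<in> {0<..<1}" for m r
      using 1(4)[OF that, of m] 2(4)[OF that, of m] by linarith
    show "(\<lambda>m. Zs m \<omega> + Zs' m \<omega>) \<longlonglongrightarrow> Z \<omega> + Z' \<omega>" if "\<omega> \<in> space M" for \<omega>
      by (intro tendsto_add 1 2 that)
    show "(\<lambda>m. \<phi>s m r + \<phi>s' m r) \<longlonglongrightarrow> \<phi> r + \<phi>' r" if "r \<in> {0<..<1}" for r
      by (intro tendsto_add 1 2 that)
  qed
qed

lemma wiener_rep_sum:
  assumes "finite I" "\<And>i. i \<in> I \<Longrightarrow> wiener_rep M B (Z i) (\<phi> i)"
  shows "wiener_rep M B (\<lambda>\<omega>. \<Sum>i\<in>I. Z i \<omega>) (\<lambda>r. \<Sum>i\<in>I. \<phi> i r)"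
  using assms
  by induction (auto intro: wiener_rep_add wiener_rep_combination[OF bridge_combination_zero, where K=0])

text \<open>Bounded pointwise convergence of the kernels on (0,1) plays the part of convergence in
  L2: with majorant K^2, the integrals of the squares converge, and these are the variances of the
  approximating combinations. Passing to the open interval does not change the integrals.\<close>

lemma wiener_rep_gaussian:
  assumes bb: "brownian_bridge M B" and rep: "wiener_rep M B Z \<phi>"
    and v: "((\<lambda>r. (\<phi> r)\<^sup>2) has_integral v) {0..1}"
  shows "centered_gaussian M Z v"
proof -
  interpret prob_space M using bb by (simp add: brownian_bridge_def)
  obtain Zs \<phi>s K where *: "\<And>m::nat. bridge_combination B (Zs m) (\<phi>s m)"
    "\<And>\<omega>. \<omega> \<in> space M \<Longrightarrow> (\<lambda>m. Zs m \<omega>) \<longlonglongrightarrow> Z \<omega>"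
    "\<And>r. r \<in> {0<..<1} \<Longrightarrow> (\<lambda>m. \<phi>s m r) \<longlonglongrightarrow> \<phi> r"
    "\<And>r m. r \<in> {0<..<1} \<Longrightarrow> \<bar>\<phi>s m r\<bar> \<le> (K::real)" using wiener_repE[OF rep] by blast
  obtain w where w: "\<And>m. ((\<lambda>r. (\<phi>s m r)\<^sup>2) has_integral w m) {0..1}" "\<And>m. centered_gaussian M (Zs m) (w m)"
    using bridge_combination_gaussian[OF bb *(1)] by metis
  have w': "((\<lambda>r. (\<phi>s m r)\<^sup>2) has_integral w m) {0<..<1}" for m
    using w(1) by (simp add: has_integral_Icc_iff_Ioo)
  have b: "(\<phi>s m r)\<^sup>2 \<le> K\<^sup>2" if "r \<in> {0<..<1}" for m r
    using *(4)[OF that, of m] abs_ge_zero[of "\<phi>s m r"] by (subst abs_le_square_iff[symmetric]) linarith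
  have "(\<lambda>m. integral {0<..<1} (\<lambda>r. (\<phi>s m r)\<^sup>2)) \<longlonglongrightarrow> integral {0<..<1} (\<lambda>r. (\<phi> r)\<^sup>2)"
  proof (rule dominated_convergence(2))
    show "(\<lambda>r. (\<phi>s m r)\<^sup>2) integrable_on {0<..<1}" for m using w' by blast
    show "(\<lambda>_. K\<^sup>2) integrable_on {0<..<1::real}"
      by (simp add: integrable_on_Icc_iff_Ioo[symmetric] integrable_const_ivl)
  qed (use b in \<open>auto intro!: tendsto_intros *\<close>)
  moreover have "integral {0<..<1} (\<lambda>r. (\<phi> r)\<^sup>2) = v"
    using v by (simp add: has_integral_Icc_iff_Ioo integral_unique)
  ultimately have "w \<longlonglongrightarrow> v" by (simp add: integral_unique[OF w'])
  from centered_gaussian_limit[OF w(2) *(2) this] show ?thesis .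
qed

section \<open>Integrals against the bridge\<close>

text \<open>On each cell the mean value inequality is applied to g(\<tau>) F - G with G a primitive
  of g F'. The derivative (g(\<tau>) - g) F' is at most e C in absolute value, and the n cells have
  total length 1. Tags are arbitrary within their cells because left and right endpoints both occur
  later.\<close>

lemma tagged_sum_error:
  fixes g F F' :: "real \<Rightarrow> real"
  assumes n: "n > 0" and \<tau>: "\<And>i. i < n \<Longrightarrow> \<tau> i \<in> {real i / real n..real (Suc i) / real n}"
    and F: "\<And>x. x \<in> {0..1} \<Longrightarrow> (F has_real_derivative F' x) (at x within {0..1})"
    and g: "continuous_on {0..1} g" and F': "continuous_on {0..1} F'"
    and C: "\<And>x. x \<in> {0..1} \<Longrightarrow> \<bar>F' x\<bar> \<le> C"
    and e: "\<And>x y. x \<in> {0..1} \<Longrightarrow> y \<in> {0..1} \<Longrightarrow> \<bar>x - y\<bar> \<le> 1 / real n \<Longrightarrow> \<bar>g x - g y\<bar> \<le> e"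
  shows "\<bar>(\<Sum>i<n. g (\<tau> i) * (F (real (Suc i) / real n) - F (real i / real n))) - integral {0..1} (\<lambda>r. g r * F' r)\<bar> \<le> e * C"
proof -
  define G where "G x = integral {0..x} (\<lambda>r. g r * F' r)" for x
  have G: "(G has_real_derivative g x * F' x) (at x within {0..1})" if "x \<in> {0..1}" for x
    unfolding G_def by (rule integral_has_real_derivative) (use that in \<open>auto intro!: continuous_intros g F'\<close>)
  have e0: "e \<ge> 0" using e[of 0 0] by simp
  have C0: "C \<ge> 0" using C[of 0] by fastforce
  have step: "\<bar>g (\<tau> i) * (F (real (Suc i) / real n) - F (real i / real n)) - (G (real (Suc i) / real n) - G (real i / real n))\<bar>
      \<le> e * C * (1 / real n)" if i: "i < n" for i
  proof -
    define a where "a = real i / real n"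
    define b where "b = real (Suc i) / real n"
    have ab: "0 \<le> a" "a \<le> b" "b \<le> 1" "b - a = 1 / real n"
      using n i by (auto simp: a_def b_def field_simps)
    have \<tau>': "\<tau> i \<in> {a..b}" using \<tau>[OF i] by (simp add: a_def b_def)
    have "norm ((g (\<tau> i) * F b - G b) - (g (\<tau> i) * F a - G a)) \<le> e * C * norm (b - a)"
    proof (rule field_differentiable_bound[where S="{a..b}" and f'="\<lambda>x. g (\<tau> i) * F' x - g x * F' x"])
      show "((\<lambda>x. g (\<tau> i) * F x - G x) has_real_derivative g (\<tau> i) * F' x - g x * F' x) (at x within {a..b})"
        if "x \<in> {a..b}" for x
        by (intro DERIV_diff DERIV_cmult DERIV_subset[OF F] DERIV_subset[OF G]) (use that ab in auto)
      show "norm (g (\<tau> i) * F' x - g x * F' x) \<le> e * C" if x: "x \<in> {a..b}" for x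
      proof -
        have "\<bar>g (\<tau> i) - g x\<bar> \<le> e" using x ab \<tau>' by (intro e) (auto simp: abs_le_iff)
        moreover have "\<bar>F' x\<bar> \<le> C" using x ab by (intro C) auto
        ultimately have "\<bar>g (\<tau> i) - g x\<bar> * \<bar>F' x\<bar> \<le> e * C" using e0 by (intro mult_mono) auto
        then show ?thesis by (simp add: abs_mult left_diff_distrib flip: abs_mult)
      qed
    qed (use ab in auto)
    also have "(g (\<tau> i) * F b - G b) - (g (\<tau> i) * F a - G a) = g (\<tau> i) * (F b - F a) - (G b - G a)"
      by (simp add: algebra_simps)
    finally show ?thesis using ab unfolding a_def b_def by simp
  qed
  have "(\<Sum>i<n. G (real (Suc i) / real n) - G (real i / real n)) = G 1 - G 0"
    using n by (subst sum_lessThan_telescope) simp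
  then have tel: "(\<Sum>i<n. G (real (Suc i) / real n) - G (real i / real n)) = integral {0..1} (\<lambda>r. g r * F' r)"
    by (simp add: G_def)
  have "\<bar>\<Sum>i<n. g (\<tau> i) * (F (real (Suc i) / real n) - F (real i / real n)) - (G (real (Suc i) / real n) - G (real i / real n))\<bar>
     \<le> (\<Sum>i<n. e * C * (1 / real n))"
    by (rule order_trans[OF sum_abs sum_mono]) (use step in auto)
  also have "\<dots> = e * C" using n by simp
  finally show ?thesis unfolding sum_subtractf[of _ "\<lambda>i. G (real (Suc i) / real n) - G (real i / real n)"] tel .
qed

lemma tagged_sum_tendsto:
  fixes g F F' :: "real \<Rightarrow> real"
  assumes \<tau>: "\<And>n i. i < n \<Longrightarrow> \<tau> n i \<in> {real i / real n..real (Suc i) / real n}"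
    and F: "\<And>x. x \<in> {0..1} \<Longrightarrow> (F has_real_derivative F' x) (at x within {0..1})"
    and g: "continuous_on {0..1} g" and F': "continuous_on {0..1} F'"
  shows "(\<lambda>n. \<Sum>i<n. g (\<tau> n i) * (F (real (Suc i) / real n) - F (real i / real n)))
    \<longlonglongrightarrow> integral {0..1} (\<lambda>r. g r * F' r)"
proof (rule metric_LIMSEQ_I)
  fix \<epsilon> :: real assume \<epsilon>: "\<epsilon> > 0"
  have "bounded (F' ` {0..1})" by (intro compact_imp_bounded compact_continuous_image F') auto
  then obtain C where C: "C > 0" "\<And>x. x \<in> {0..1} \<Longrightarrow> \<bar>F' x\<bar> \<le> C"
    unfolding bounded_pos by auto
  have "uniformly_continuous_on {0..1} g" by (intro compact_uniformly_continuous g) auto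
  moreover have "\<epsilon> / (2 * C) > 0" using \<epsilon> C by simp
  ultimately obtain d where d: "d > 0" "\<And>x y. x \<in> {0..1} \<Longrightarrow> y \<in> {0..1} \<Longrightarrow> dist y x < d \<Longrightarrow> dist (g y) (g x) < \<epsilon> / (2 * C)"
    unfolding uniformly_continuous_on_def by metis
  obtain N where N: "N > 0" "1 / real N < d" using d(1) nat_approx_posE by (metis zero_less_Suc)
  have "dist (\<Sum>i<n. g (\<tau> n i) * (F (real (Suc i) / real n) - F (real i / real n))) (integral {0..1} (\<lambda>r. g r * F' r)) < \<epsilon>"
    if "n \<ge> N" for n
  proof -
    have n: "n > 0" using that N by simp
    have nd: "1 / real n < d" using N that by (smt (verit) frac_le of_nat_0_less_iff of_nat_le_iff)
    have "\<bar>(\<Sum>i<n. g (\<tau> n i) * (F (real (Suc i) / real n) - F (real i / real n))) - integral {0..1} (\<lambda>r. g r * F' r)\<bar> \<le> \<epsilon> / (2 * C) * C"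
    proof (rule tagged_sum_error[OF n \<tau> F g F' C(2)])
      show "\<bar>g x - g y\<bar> \<le> \<epsilon> / (2 * C)" if "x \<in> {0..1}" "y \<in> {0..1}" "\<bar>x - y\<bar> \<le> 1 / real n" for x y
        using d(2)[of y x] that nd by (auto simp: dist_real_def)
    qed auto
    then show ?thesis using C \<epsilon> by (simp add: dist_real_def)
  qed
  then show "\<exists>N. \<forall>n\<ge>N. dist (\<Sum>i<n. g (\<tau> n i) * (F (real (Suc i) / real n) - F (real i / real n))) (integral {0..1} (\<lambda>r. g r * F' r)) < \<epsilon>"
    by blast
qed

definition riemann_sum :: "(real \<Rightarrow> real) \<Rightarrow> (real \<Rightarrow> 'a \<Rightarrow> real) \<Rightarrow> nat \<Rightarrow> 'a \<Rightarrow> real" where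
  "riemann_sum f B n \<omega> = (\<Sum>i<n. f (real i / real n) * (B (real (Suc i) / real n) \<omega> - B (real i / real n) \<omega>))"

text \<open>Paths are merely continuous, so Abel summation shifts the increments to
  \<open>f\<close>. The boundary terms contain \<open>B 0\<close> and \<open>B 1\<close> and vanish;
  what remains is a Riemann-Stieltjes sum of the path against \<open>f\<close>, tagged at right
  endpoints.\<close>

lemma riemann_sum_tendsto:
  assumes f: "\<And>x. (f has_real_derivative f' x) (at x)" and f': "continuous_on {0..1} f'"
    and B: "continuous_on {0..1} (\<lambda>t. B t \<omega>)" "B 0 \<omega> = 0" "B 1 \<omega> = 0"
  shows "(\<lambda>n. riemann_sum f B n \<omega>) \<longlonglongrightarrow> - integral {0..1} (\<lambda>r. B r \<omega> * f' r)"
proof -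
  have abel: "riemann_sum f B n \<omega> = - (\<Sum>i<n. B (real (Suc i) / real n) \<omega> * (f (real (Suc i) / real n) - f (real i / real n)))" for n
  proof -
    have "riemann_sum f B n \<omega> + (\<Sum>i<n. B (real (Suc i) / real n) \<omega> * (f (real (Suc i) / real n) - f (real i / real n)))
       = (\<Sum>i<n. f (real (Suc i) / real n) * B (real (Suc i) / real n) \<omega> - f (real i / real n) * B (real i / real n) \<omega>)"
      unfolding riemann_sum_def sum.distrib[symmetric] by (intro sum.cong refl) (simp add: algebra_simps)
    also have "\<dots> = f (real n / real n) * B (real n / real n) \<omega> - f (real 0 / real n) * B (real 0 / real n) \<omega>"
      by (rule sum_lessThan_telescope)
    also have "\<dots> = 0" using B by (cases "n = 0") auto
    finally show ?thesis by linarith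
  qed
  show ?thesis unfolding abel
    by (intro tendsto_minus tagged_sum_tendsto[where \<tau>="\<lambda>n i. real (Suc i) / real n"] B f')
      (auto intro!: DERIV_subset[OF f] divide_right_mono)
qed

text \<open>The kernel of a Riemann sum is the step function with value f(i/n) on (i/n, (i+1)/n],
  minus the Riemann sum of \<open>f\<close> itself. This explains the limit \<open>f\<close> minus
  its mean.\<close>

lemma riemann_sum_rep:
  assumes f: "\<And>x. (f has_real_derivative f' x) (at x)" and f': "continuous_on {0..1} f'"
    and bb: "brownian_bridge M B"
  shows "wiener_rep M B (\<lambda>\<omega>. - integral {0..1} (\<lambda>r. B r \<omega> * f' r)) (\<lambda>r. f r - integral {0..1} f)"
proof -
  have fc: "continuous_on {0..1} f"
    using f by (meson DERIV_isCont continuous_at_imp_continuous_on)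
  have "bounded (f ` {0..1})" by (intro compact_imp_bounded compact_continuous_image fc) auto
  then obtain K where K: "K > 0" "\<And>x. x \<in> {0..1} \<Longrightarrow> \<bar>f x\<bar> \<le> K" unfolding bounded_pos by auto
  have "bounded (f' ` {0..1})" by (intro compact_imp_bounded compact_continuous_image f') auto
  then obtain C where C: "C > 0" "\<And>x. x \<in> {0..1} \<Longrightarrow> \<bar>f' x\<bar> \<le> C" unfolding bounded_pos by auto
  define J where "J n i r = (if r \<le> real i / real n then 1 else 0 :: real)" for n i r
  have Jm: "0 \<le> J n (Suc i) r - J n i r" for n i r
  proof -
    have "real i / real n \<le> real (Suc i) / real n" by (intro divide_right_mono) auto
    then show ?thesis by (auto simp: J_def)
  qed
  \<comment> \<open>The differences of \<open>J\<close> are the indicators of cells open on the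
    left; they partition (0,1], but none contains 0.\<close>
  have Jt: "(\<Sum>i<n. J n (Suc i) r - J n i r) = 1" if "r \<in> {0<..<1}" "n > 0" for n r
    using that by (subst sum_lessThan_telescope) (auto simp: J_def)
  define \<phi> where "\<phi> n r = (\<Sum>i<n. f (real i / real n) * (bridge_kernel (real (Suc i) / real n) r - bridge_kernel (real i / real n) r))" for n r
  have grid: "real i / real n \<in> {0..1}" "real (Suc i) / real n \<in> {0..1}" if "i < n" for i n
    using that by (auto simp: field_simps)
  have \<phi>: "\<phi> n r = (\<Sum>i<n. f (real i / real n) * (J n (Suc i) r - J n i r))
      - (\<Sum>i<n. f (real i / real n) * (real (Suc i) / real n - real i / real n))" for n r
    unfolding \<phi>_def sum_subtractf[symmetric] by (intro sum.cong refl) (simp add: bridge_kernel_def J_def algebra_simps)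
  show ?thesis
  proof (rule wiener_repI)
    show "bridge_combination B (riemann_sum f B n) (\<phi> n)" for n
    proof -
      have "bridge_combination B (\<lambda>\<omega>. \<Sum>i<n. f (real i / real n) * (B (real (Suc i) / real n) \<omega> + (-1) * B (real i / real n) \<omega>))
         (\<lambda>r. \<Sum>i<n. f (real i / real n) * (bridge_kernel (real (Suc i) / real n) r + (-1) * bridge_kernel (real i / real n) r))"
        using grid by (intro bridge_combination_sum bridge_combination_scale bridge_combination_add bridge_combination_single) auto
      then show ?thesis by (simp add: riemann_sum_def[abs_def] \<phi>_def[abs_def])
    qed
    show "(\<lambda>n. riemann_sum f B n \<omega>) \<longlonglongrightarrow> - integral {0..1} (\<lambda>r. B r \<omega> * f' r)" if "\<omega> \<in> space M" for \<omega>
      using bb that by (intro riemann_sum_tendsto[OF f f']) (auto simp: brownian_bridge_def)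
    show "(\<lambda>n. \<phi> n r) \<longlonglongrightarrow> f r - integral {0..1} f" if r: "r \<in> {0<..<1}" for r
    proof -
      have 1: "(\<lambda>n. \<Sum>i<n. f (real i / real n) * (J n (Suc i) r - J n i r)) \<longlonglongrightarrow> f r"
      proof (rule LIM_zero_cancel, rule Lim_null_comparison)
        show "(\<lambda>n. C / real n) \<longlonglongrightarrow> 0" by real_asymp
        show "\<forall>\<^sub>F n in sequentially. norm ((\<Sum>i<n. f (real i / real n) * (J n (Suc i) r - J n i r)) - f r) \<le> C / real n"
        proof (rule eventually_sequentiallyI[of 1])
          fix n :: nat assume n: "1 \<le> n"
          have "(\<Sum>i<n. f (real i / real n) * (J n (Suc i) r - J n i r)) - f r
             = (\<Sum>i<n. (f (real i / real n) - f r) * (J n (Suc i) r - J n i r))"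
            using Jt[OF r, of n] n by (simp add: left_diff_distrib sum_subtractf flip: sum_distrib_left)
          also have "\<bar>\<dots>\<bar> \<le> (\<Sum>i<n. C / real n * (J n (Suc i) r - J n i r))"
          proof (rule order_trans[OF sum_abs sum_mono])
            fix i assume i: "i \<in> {..<n}"
            show "\<bar>(f (real i / real n) - f r) * (J n (Suc i) r - J n i r)\<bar> \<le> C / real n * (J n (Suc i) r - J n i r)"
            proof (cases "J n (Suc i) r - J n i r = 0")
              case False
              \<comment> \<open>Only the cell containing \<open>r\<close> contributes, and its left
                endpoint is within 1/n of \<open>r\<close>.\<close>
              then have ri: "real i / real n < r" "r \<le> real (Suc i) / real n"
                using Jm[of n i r] by (auto simp: J_def split: if_splits)
              have "norm (f (real i / real n) - f r) \<le> C * norm (real i / real n - r)"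
                by (rule field_differentiable_bound[where S="{0..1}" and f'=f'])
                  (use C(2) r grid[of i n] i in \<open>auto intro: DERIV_subset[OF f]\<close>)
              also have "\<dots> \<le> C * (1 / real n)"
                using ri C(1) by (intro mult_left_mono) (auto simp: add_divide_distrib)
              finally show ?thesis unfolding abs_mult abs_of_nonneg[OF Jm]
                by (intro mult_right_mono Jm) simp
            qed simp
          qed
          also have "\<dots> = C / real n"
            unfolding sum_distrib_left[symmetric] using Jt[OF r, of n] n by simp
          finally show "norm ((\<Sum>i<n. f (real i / real n) * (J n (Suc i) r - J n i r)) - f r) \<le> C / real n" by simp
        qed
      qed
      have "(\<lambda>n. \<Sum>i<n. f (real i / real n) * (real (Suc i) / real n - real i / real n)) \<longlonglongrightarrow> integral {0..1} (\<lambda>r. f r * 1)"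
        by (rule tagged_sum_tendsto[where F="\<lambda>x. x" and \<tau>="\<lambda>n i. real i / real n"])
          (auto intro!: derivative_eq_intros fc divide_right_mono)
      with 1 show ?thesis unfolding \<phi> by (intro tendsto_diff) simp_all
    qed
    show "\<bar>\<phi> n r\<bar> \<le> K + K" if r: "r \<in> {0<..<1}" for n r
    proof (cases "n = 0")
      case False
      have "\<bar>\<Sum>i<n. f (real i / real n) * (J n (Suc i) r - J n i r)\<bar> \<le> (\<Sum>i<n. K * (J n (Suc i) r - J n i r))"
        by (rule order_trans[OF sum_abs sum_mono]) (use K(2) grid Jm in \<open>auto simp: abs_mult intro!: mult_right_mono\<close>)
      then have 1: "\<bar>\<Sum>i<n. f (real i / real n) * (J n (Suc i) r - J n i r)\<bar> \<le> K"
        using Jt[OF r, of n] False by (simp flip: sum_distrib_left)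
      have d: "real (Suc i) / real n - real i / real n = 1 / real n" for i
        by (simp add: add_divide_distrib)
      have "\<bar>\<Sum>i<n. f (real i / real n) * (real (Suc i) / real n - real i / real n)\<bar> \<le> (\<Sum>i<n. K * (1 / real n))"
        unfolding d by (rule order_trans[OF sum_abs sum_mono])
          (use K(2) grid in \<open>auto simp: abs_mult intro!: mult_right_mono divide_right_mono\<close>)
      then have 2: "\<bar>\<Sum>i<n. f (real i / real n) * (real (Suc i) / real n - real i / real n)\<bar> \<le> K"
        using False by simp
      from 1 2 show ?thesis unfolding \<phi> by linarith
    qed (use K(1) in \<open>simp add: \<phi>_def\<close>)
  qed
qed

section \<open>Identification of the stochastic integral\<close>

lemma (in prob_space) converges_in_probability_of_pointwise:
  assumes [measurable]: "\<And>n. X n \<in> borel_measurable M"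
    and lim: "\<And>\<omega>. \<omega> \<in> space M \<Longrightarrow> (\<lambda>n. X n \<omega>) \<longlonglongrightarrow> Z \<omega>"
  shows "converges_in_probability M X Z"
proof -
  have [measurable]: "Z \<in> borel_measurable M" by (rule borel_measurable_LIMSEQ_real[OF lim]) auto
  have "(\<lambda>n. prob {\<omega> \<in> space M. \<epsilon> < \<bar>X n \<omega> - Z \<omega>\<bar>}) \<longlonglongrightarrow> 0" if "\<epsilon> > 0" for \<epsilon>
  proof -
    have "(\<lambda>n. expectation (indicat_real {\<omega> \<in> space M. \<epsilon> < \<bar>X n \<omega> - Z \<omega>\<bar>})) \<longlonglongrightarrow> expectation (\<lambda>_. 0)"
    proof (rule integral_dominated_convergence[where w="\<lambda>_. 1"])
      show "AE \<omega> in M. (\<lambda>n. indicat_real {\<omega> \<in> space M. \<epsilon> < \<bar>X n \<omega> - Z \<omega>\<bar>} \<omega>) \<longlonglongrightarrow> 0"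
      proof (rule AE_I2)
        fix \<omega> assume "\<omega> \<in> space M"
        from tendstoD[OF lim[OF this] \<open>\<epsilon> > 0\<close>]
        have "\<forall>\<^sub>F n in sequentially. indicat_real {\<omega> \<in> space M. \<epsilon> < \<bar>X n \<omega> - Z \<omega>\<bar>} \<omega> = 0"
          by eventually_elim (auto simp: dist_real_def)
        then show "(\<lambda>n. indicat_real {\<omega> \<in> space M. \<epsilon> < \<bar>X n \<omega> - Z \<omega>\<bar>} \<omega>) \<longlonglongrightarrow> 0"
          by (rule tendsto_eventually)
      qed
    qed (auto simp: indicator_def)
    then show ?thesis by simp
  qed
  then show ?thesis by (simp add: converges_in_probability_def)
qed

text \<open>If Y and Z differ by more than 2 \<epsilon>, then X n differs from one of them by more
  than \<epsilon>, an event of vanishing probability. The null sets for \<epsilon> = 1/(k+1) are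
  then united.\<close>

lemma (in prob_space) converges_in_probability_unique:
  assumes Y: "converges_in_probability M X Y" and Z: "converges_in_probability M X Z"
  shows "AE \<omega> in M. Y \<omega> = Z \<omega>"
proof -
  have [measurable]: "\<And>n. X n \<in> borel_measurable M" "Y \<in> borel_measurable M" "Z \<in> borel_measurable M"
    using assms by (auto simp: converges_in_probability_def)
  have null: "prob {\<omega> \<in> space M. 2 * \<epsilon> < \<bar>Y \<omega> - Z \<omega>\<bar>} = 0" if e: "\<epsilon> > 0" for \<epsilon>
  proof -
    have "prob {\<omega> \<in> space M. 2 * \<epsilon> < \<bar>Y \<omega> - Z \<omega>\<bar>} \<le>
      prob {\<omega> \<in> space M. \<epsilon> < \<bar>X n \<omega> - Y \<omega>\<bar>} + prob {\<omega> \<in> space M. \<epsilon> < \<bar>X n \<omega> - Z \<omega>\<bar>}" for n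
    proof -
      have "prob {\<omega> \<in> space M. 2 * \<epsilon> < \<bar>Y \<omega> - Z \<omega>\<bar>} \<le>
        prob ({\<omega> \<in> space M. \<epsilon> < \<bar>X n \<omega> - Y \<omega>\<bar>} \<union> {\<omega> \<in> space M. \<epsilon> < \<bar>X n \<omega> - Z \<omega>\<bar>})"
        by (rule finite_measure_mono) auto
      also have "\<dots> \<le> prob {\<omega> \<in> space M. \<epsilon> < \<bar>X n \<omega> - Y \<omega>\<bar>} + prob {\<omega> \<in> space M. \<epsilon> < \<bar>X n \<omega> - Z \<omega>\<bar>}"
        by (rule measure_Un_le) auto
      finally show ?thesis .
    qed
    moreover have "(\<lambda>n. prob {\<omega> \<in> space M. \<epsilon> < \<bar>X n \<omega> - Y \<omega>\<bar>} + prob {\<omega> \<in> space M. \<epsilon> < \<bar>X n \<omega> - Z \<omega>\<bar>}) \<longlonglongrightarrow> 0 + 0"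
      using Y Z e by (intro tendsto_add) (auto simp: converges_in_probability_def)
    ultimately have "prob {\<omega> \<in> space M. 2 * \<epsilon> < \<bar>Y \<omega> - Z \<omega>\<bar>} \<le> 0"
      by (intro LIMSEQ_le_const) auto
    then show ?thesis by (simp add: measure_le_0_iff)
  qed
  have "AE \<omega> in M. \<not> 2 * (1 / real (Suc k)) < \<bar>Y \<omega> - Z \<omega>\<bar>" for k
    using null[of "1 / real (Suc k)"] prob_eq_0[of "{\<omega> \<in> space M. 2 * (1 / real (Suc k)) < \<bar>Y \<omega> - Z \<omega>\<bar>}"]
    by (auto elim: eventually_mono)
  then have "AE \<omega> in M. \<forall>k. \<not> 2 * (1 / real (Suc k)) < \<bar>Y \<omega> - Z \<omega>\<bar>" by (simp add: AE_all_countable)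
  then show ?thesis
  proof eventually_elim
    case (elim \<omega>)
    have "(\<lambda>k. 2 * (1 / real (Suc k))) \<longlonglongrightarrow> 0" by real_asymp
    then have "\<bar>Y \<omega> - Z \<omega>\<bar> \<le> 0"
      by (rule LIMSEQ_le_const) (use elim not_less in blast)
    then show ?case by simp
  qed
qed

lemma brownian_bridge_measurable:
  assumes "brownian_bridge M B" "t \<in> {0..1}"
  shows "B t \<in> borel_measurable M"
proof -
  have "gaussian_process M B {0..1}" using assms by (simp add: brownian_bridge_def)
  from this[unfolded gaussian_process_def, rule_format, of "{t}" "\<lambda>_. 1"]
  have "gaussian_rv M (\<lambda>\<omega>. \<Sum>s\<in>{t}. 1 * B s \<omega>)" using assms by simp
  then show ?thesis by (simp add: gaussian_rv_def)
qed

text \<open>The pathwise limit of the Riemann sums witnesses that a limit in probability exists, so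
  the choice operator returns a genuine one; almost sure uniqueness compares the two.\<close>

lemma stoch_integral_by_parts:
  assumes f: "\<And>x. (f has_real_derivative f' x) (at x)" and f': "continuous_on {0..1} f'"
    and bb: "brownian_bridge M B"
  shows "stoch_integral M B f \<in> borel_measurable M"
    "AE \<omega> in M. stoch_integral M B f \<omega> = - integral {0..1} (\<lambda>r. B r \<omega> * f' r)"
proof -
  interpret prob_space M using bb by (simp add: brownian_bridge_def)
  have "riemann_sum f B n \<in> borel_measurable M" for n
  proof -
    have "B (real i / real n) \<in> borel_measurable M" "B (real (Suc i) / real n) \<in> borel_measurable M" if "i < n" for i
      using that by (auto intro!: brownian_bridge_measurable[OF bb] simp: field_simps)
    then show ?thesis unfolding riemann_sum_def[abs_def]
      by (intro borel_measurable_sum borel_measurable_times borel_measurable_diff) auto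
  qed
  then have c: "converges_in_probability M (riemann_sum f B) (\<lambda>\<omega>. - integral {0..1} (\<lambda>r. B r \<omega> * f' r))"
    using bb by (intro converges_in_probability_of_pointwise riemann_sum_tendsto[OF f f']) (auto simp: brownian_bridge_def)
  have s: "converges_in_probability M (riemann_sum f B) (stoch_integral M B f)"
    using someI[of "converges_in_probability M (riemann_sum f B)", OF c]
    by (simp add: stoch_integral_def riemann_sum_def[abs_def])
  show "stoch_integral M B f \<in> borel_measurable M" using s by (simp add: converges_in_probability_def)
  show "AE \<omega> in M. stoch_integral M B f \<omega> = - integral {0..1} (\<lambda>r. B r \<omega> * f' r)"
    by (rule converges_in_probability_unique[OF s c])
qed

section \<open>Fourier remainders\<close>

lemma has_integral_of_derivative:
  fixes f f' :: "real \<Rightarrow> real"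
  assumes "a \<le> b" "\<And>x. (f has_real_derivative f' x) (at x)"
  shows "(f' has_integral (f b - f a)) {a..b}"
  using assms
  by (intro fundamental_theorem_of_calculus)
    (auto simp: has_real_derivative_iff_has_vector_derivative[symmetric] intro: DERIV_subset)

lemma has_integral_cos_int:
  assumes "n \<noteq> 0"
  shows "((\<lambda>r. cos (of_int n * pi * r)) has_integral 0) {0..1}"
proof -
  have "((\<lambda>r. cos (of_int n * pi * r)) has_integral (sin (of_int n * pi * 1) / (of_int n * pi) - sin (of_int n * pi * 0) / (of_int n * pi))) {0..1}"
    by (rule has_integral_of_derivative) (use assms in \<open>auto intro!: derivative_eq_intros\<close>)
  moreover have "sin (of_int n * pi) = 0" by (auto simp: sin_zero_iff_int2)
  ultimately show ?thesis by simp
qed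

lemma has_integral_cos_period:
  assumes "n \<noteq> 0"
  shows "((\<lambda>r. cos (c - 2 * of_int n * pi * r)) has_integral 0) {0..1}"
proof -
  have "((\<lambda>r. cos (c - 2 * of_int n * pi * r)) has_integral
    (- sin (c - 2 * of_int n * pi * 1) / (2 * of_int n * pi) - (- sin (c - 2 * of_int n * pi * 0) / (2 * of_int n * pi)))) {0..1}"
    by (rule has_integral_of_derivative) (use assms in \<open>auto intro!: derivative_eq_intros\<close>)
  moreover have "sin (c - 2 * of_int n * pi * 1) = sin c"
  proof -
    have "cos (2 * of_int n * pi) = 1" "sin (2 * of_int n * pi) = 0"
      using cos_int_2pin[of n] sin_int_2pin[of n] by (simp_all add: mult_ac)
    then show ?thesis by (simp add: sin_diff)
  qed
  ultimately show ?thesis by simp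
qed

text \<open>The polarized form of |x - Px|^2 = |x|^2 - |Px|^2 for an orthogonal projection P. Both
  cross sums and the double sum equal the sum of the c k, whence I - 2 sum c + sum c. Both Fourier
  bases use it, with x and y belonging to different times.\<close>

lemma has_integral_residual_product:
  fixes x y :: "real \<Rightarrow> real" and u v :: "'k \<Rightarrow> real \<Rightarrow> real"
  assumes K: "finite K" and xy: "((\<lambda>r. x r * y r) has_integral I) A"
    and xv: "\<And>k. k \<in> K \<Longrightarrow> ((\<lambda>r. x r * v k r) has_integral c k) A"
    and uy: "\<And>k. k \<in> K \<Longrightarrow> ((\<lambda>r. u k r * y r) has_integral c k) A"
    and uv: "\<And>j k. j \<in> K \<Longrightarrow> k \<in> K \<Longrightarrow> ((\<lambda>r. u j r * v k r) has_integral (if j = k then c k else 0)) A"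
  shows "((\<lambda>r. (x r - (\<Sum>k\<in>K. u k r)) * (y r - (\<Sum>k\<in>K. v k r))) has_integral (I - (\<Sum>k\<in>K. c k))) A"
proof -
  have "((\<lambda>r. x r * y r - (\<Sum>k\<in>K. x r * v k r) - (\<Sum>k\<in>K. u k r * y r) + (\<Sum>j\<in>K. \<Sum>k\<in>K. u j r * v k r))
    has_integral (I - (\<Sum>k\<in>K. c k) - (\<Sum>k\<in>K. c k) + (\<Sum>j\<in>K. \<Sum>k\<in>K. if j = k then c k else 0))) A"
    by (intro has_integral_add has_integral_diff has_integral_sum xy xv uy uv K)
  also have "(I - (\<Sum>k\<in>K. c k) - (\<Sum>k\<in>K. c k) + (\<Sum>j\<in>K. \<Sum>k\<in>K. if j = k then c k else 0)) = I - (\<Sum>k\<in>K. c k)"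
    using K by simp
  also have "(\<lambda>r. x r * y r - (\<Sum>k\<in>K. x r * v k r) - (\<Sum>k\<in>K. u k r * y r) + (\<Sum>j\<in>K. \<Sum>k\<in>K. u j r * v k r))
    = (\<lambda>r. (x r - (\<Sum>k\<in>K. u k r)) * (y r - (\<Sum>k\<in>K. v k r)))"
  proof
    fix r
    have 1: "(\<Sum>k\<in>K. x r * v k r) = x r * (\<Sum>k\<in>K. v k r)" by (rule sum_distrib_left[symmetric])
    have 2: "(\<Sum>k\<in>K. u k r * y r) = (\<Sum>k\<in>K. u k r) * y r" by (rule sum_distrib_right[symmetric])
    have 3: "(\<Sum>j\<in>K. \<Sum>k\<in>K. u j r * v k r) = (\<Sum>k\<in>K. u k r) * (\<Sum>k\<in>K. v k r)" by (rule sum_product[symmetric])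
    show "x r * y r - (\<Sum>k\<in>K. x r * v k r) - (\<Sum>k\<in>K. u k r * y r) + (\<Sum>j\<in>K. \<Sum>k\<in>K. u j r * v k r)
      = (x r - (\<Sum>k\<in>K. u k r)) * (y r - (\<Sum>k\<in>K. v k r))"
      unfolding 1 2 3 by (simp add: algebra_simps)
  qed
  finally show ?thesis .
qed

definition residual_kernel1 :: "nat \<Rightarrow> real \<Rightarrow> real \<Rightarrow> real" where
  "residual_kernel1 N t r = bridge_kernel t r - (\<Sum>k=1..N. 2 * sin (real k * pi * t) / (real k * pi) * cos (real k * pi * r))"

lemma bridge_kernel_cos:
  assumes "t \<in> {0..1}" "k \<ge> 1"
  shows "((\<lambda>r. bridge_kernel t r * cos (real k * pi * r)) has_integral sin (real k * pi * t) / (real k * pi)) {0..1}"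
proof -
  have "((\<lambda>r. cos (real k * pi * r)) has_integral (sin (real k * pi * t) / (real k * pi) - sin (real k * pi * 0) / (real k * pi))) {0..t}"
    by (rule has_integral_of_derivative) (use assms in \<open>auto intro!: derivative_eq_intros\<close>)
  then have 1: "((\<lambda>r. if r \<le> t then cos (real k * pi * r) else 0) has_integral sin (real k * pi * t) / (real k * pi)) {0..1}"
    using assms by (intro has_integral_initial_segment) auto
  have "((\<lambda>r. t * cos (real k * pi * r)) has_integral t * 0) {0..1}"
    using has_integral_cos_int[of "int k"] assms by (intro has_integral_mult_right) auto
  from has_integral_diff[OF 1 this] show ?thesis
    by (rule has_integral_eq[rotated, THEN has_integral_eq_rhs]) (auto simp: bridge_kernel_def algebra_simps)
qed

text \<open>The squared norm 1/2 is the reason for the factor 2 in the coefficients of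
  \<open>residual_kernel1\<close>: they are the inner products from \<open>bridge_kernel_cos\<close>
  divided by it, so the sum there is an orthogonal projection.\<close>

lemma cos_orthogonal:
  assumes "j \<ge> 1" "k \<ge> 1"
  shows "((\<lambda>r. cos (real j * pi * r) * cos (real k * pi * r)) has_integral (if j = k then 1 / 2 else 0)) {0..1}"
proof -
  have 1: "((\<lambda>r. cos (of_int (int j - int k) * pi * r)) has_integral (if j = k then 1 else 0)) {0..1}"
    using has_integral_cos_int[of "int j - int k"] has_integral_const_real[of "1::real" 0 1] by (cases "j = k") auto
  have 2: "((\<lambda>r. cos (of_int (int j + int k) * pi * r)) has_integral 0) {0..1}"
    using assms by (intro has_integral_cos_int) auto
  have "((\<lambda>r. (1/2) * (cos (of_int (int j - int k) * pi * r) + cos (of_int (int j + int k) * pi * r)))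
      has_integral (1/2) * ((if j = k then 1 else 0) + 0)) {0..1}"
    by (intro has_integral_mult_right has_integral_add 1 2)
  then show ?thesis
    by (rule has_integral_eq[rotated, THEN has_integral_eq_rhs]) (auto simp: cos_times_cos algebra_simps)
qed

lemma residual_kernel1_inner:
  assumes "s \<in> {0..1}" "t \<in> {0..1}"
  shows "((\<lambda>r. residual_kernel1 N s r * residual_kernel1 N t r) has_integral
    (cosine_remainder N (pi * \<bar>s - t\<bar>) - cosine_remainder N (pi * (s + t))) / pi\<^sup>2) {0..1}"
proof -
  define c where "c k = 2 * sin (real k * pi * s) * sin (real k * pi * t) / (real k * pi)\<^sup>2" for k
  have "((\<lambda>r. residual_kernel1 N s r * residual_kernel1 N t r) has_integral
     ((min s t - s * t) - (\<Sum>k=1..N. c k))) {0..1}"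
    unfolding residual_kernel1_def
  proof (rule has_integral_residual_product)
    fix k assume k: "k \<in> {1..N}"
    from has_integral_mult_right[OF bridge_kernel_cos[of s k], of "2 * sin (real k * pi * t) / (real k * pi)"] k assms
    show "((\<lambda>r. bridge_kernel s r * (2 * sin (real k * pi * t) / (real k * pi) * cos (real k * pi * r))) has_integral c k) {0..1}"
      by (simp add: c_def mult_ac power2_eq_square)
    from has_integral_mult_right[OF bridge_kernel_cos[of t k], of "2 * sin (real k * pi * s) / (real k * pi)"] k assms
    show "((\<lambda>r. 2 * sin (real k * pi * s) / (real k * pi) * cos (real k * pi * r) * bridge_kernel t r) has_integral c k) {0..1}"
      by (simp add: c_def mult_ac power2_eq_square)
    fix j assume j: "j \<in> {1..N}"
    from has_integral_mult_right[OF cos_orthogonal[of j k], of "2 * sin (real j * pi * s) / (real j * pi) * (2 * sin (real k * pi * t) / (real k * pi))"] j k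
    show "((\<lambda>r. 2 * sin (real j * pi * s) / (real j * pi) * cos (real j * pi * r) *
        (2 * sin (real k * pi * t) / (real k * pi) * cos (real k * pi * r))) has_integral (if j = k then c k else 0)) {0..1}"
      by (cases "j = k") (simp_all add: c_def mult_ac power2_eq_square)
  qed (use bridge_kernel_inner[OF assms] in auto)
  moreover have "(min s t - s * t) - (\<Sum>k=1..N. c k) =
    (cosine_remainder N (pi * \<bar>s - t\<bar>) - cosine_remainder N (pi * (s + t))) / pi\<^sup>2"
  proof -
    have "c k = (cos (real k * (pi * \<bar>s - t\<bar>)) / (real k)\<^sup>2 - cos (real k * (pi * (s + t))) / (real k)\<^sup>2) / pi\<^sup>2" for k
    proof -
      have "cos (real k * (pi * \<bar>s - t\<bar>)) = cos (real k * pi * s - real k * pi * t)"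
        using cos_abs_real[of "real k * pi * s - real k * pi * t"]
        by (simp add: abs_mult right_diff_distrib[symmetric] mult.assoc)
      moreover have "cos (real k * (pi * (s + t))) = cos (real k * pi * s + real k * pi * t)"
        by (simp add: algebra_simps)
      ultimately have "cos (real k * (pi * \<bar>s - t\<bar>)) - cos (real k * (pi * (s + t))) = 2 * sin (real k * pi * s) * sin (real k * pi * t)"
        by (simp add: cos_diff cos_add)
      then show ?thesis unfolding c_def diff_divide_distrib[symmetric] by (simp add: power_mult_distrib)
    qed
    then have S: "(\<Sum>k=1..N. c k) = ((\<Sum>k=1..N. cos (real k * (pi * \<bar>s - t\<bar>)) / (real k)\<^sup>2) - (\<Sum>k=1..N. cos (real k * (pi * (s + t))) / (real k)\<^sup>2)) / pi\<^sup>2"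
      by (simp add: sum_subtractf flip: sum_divide_distrib)
    \<comment> \<open>The bridge covariance is itself a difference of two values of the polynomial
      in \<open>cosine_remainder\<close>: s + t - |s - t| = 2 min s t, the squares leave - s t, and
      pi^2/6 cancels.\<close>
    have P: "(- pi * (pi * \<bar>s - t\<bar>) / 2 + (pi * \<bar>s - t\<bar>)\<^sup>2 / 4 - (- pi * (pi * (s + t)) / 2 + (pi * (s + t))\<^sup>2 / 4)) / pi\<^sup>2 = min s t - s * t"
      by (cases "s \<le> t") (simp_all add: field_simps power2_eq_square min_def)
    show ?thesis unfolding S P[symmetric] cosine_remainder_def diff_divide_distrib[symmetric]
      by (rule arg_cong[where f="\<lambda>z. z / pi\<^sup>2"]) simp
  qed
  ultimately show ?thesis by simp
qed

lemma wiener_rep_cong: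
  assumes "wiener_rep M B Z \<phi>" "\<And>\<omega>. \<omega> \<in> space M \<Longrightarrow> Z \<omega> = Z' \<omega>" "\<And>r. r \<in> {0<..<1} \<Longrightarrow> \<phi> r = \<phi>' r"
  shows "wiener_rep M B Z' \<phi>'"
  using assms unfolding wiener_rep_def by simp

text \<open>\<open>wiener_rep\<close> asks for convergence at every sample point, while
  \<open>stoch_integral\<close> is known only almost surely. The representation is therefore given
  for a version \<open>Z\<close> built from the pathwise integrals \<open>J\<close>, and
  measurability of the process itself is shown separately.\<close>

lemma F_process1_rep:
  assumes bb: "brownian_bridge M B" and t: "t \<in> {0..1}"
  shows "\<exists>Z. wiener_rep M B Z (\<lambda>r. sqrt (real N) * residual_kernel1 N t r) \<and>
      (AE \<omega> in M. F_process1 M B N t \<omega> = Z \<omega>)"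
    "F_process1 M B N t \<in> borel_measurable M"
proof -
  define J where "J k \<omega> = - integral {0..1} (\<lambda>r. B r \<omega> * (- sin (real k * pi * r) * (real k * pi)))" for k \<omega>
  have d: "((\<lambda>r. cos (real k * pi * r)) has_real_derivative - sin (real k * pi * r) * (real k * pi)) (at r)" for k r
    by (auto intro!: derivative_eq_intros)
  have c: "continuous_on {0..1} (\<lambda>r. - sin (real k * pi * r) * (real k * pi))" for k
    by (intro continuous_intros)
  have J: "wiener_rep M B (J k) (\<lambda>r. cos (real k * pi * r))" if "k \<ge> 1" for k
  proof -
    have "integral {0..1} (\<lambda>r. cos (real k * pi * r)) = 0"
      using has_integral_cos_int[of "int k"] that by (auto simp: integral_unique)
    with riemann_sum_rep[OF d c bb, of k] show ?thesis by (simp add: J_def[abs_def])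
  qed
  define Z where "Z \<omega> = sqrt (real N) * (B t \<omega> + (\<Sum>k=1..N. (- (2 * sin (real k * pi * t) / (real k * pi))) * J k \<omega>))" for \<omega>
  have "wiener_rep M B Z (\<lambda>r. sqrt (real N) * (bridge_kernel t r + (\<Sum>k=1..N. (- (2 * sin (real k * pi * t) / (real k * pi))) * cos (real k * pi * r))))"
    unfolding Z_def by (intro wiener_rep_scale wiener_rep_add wiener_rep_sum wiener_rep_single t J) auto
  then have 1: "wiener_rep M B Z (\<lambda>r. sqrt (real N) * residual_kernel1 N t r)"
    by (simp add: residual_kernel1_def sum_negf)
  have "AE \<omega> in M. \<forall>k. stoch_integral M B (\<lambda>r. cos (real k * pi * r)) \<omega> = J k \<omega>"
    unfolding AE_all_countable J_def using stoch_integral_by_parts(2)[OF d c bb] by blast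
  then have "AE \<omega> in M. F_process1 M B N t \<omega> = Z \<omega>"
    by eventually_elim (simp add: F_process1_def Z_def sum_negf)
  with 1 show "\<exists>Z. wiener_rep M B Z (\<lambda>r. sqrt (real N) * residual_kernel1 N t r) \<and>
      (AE \<omega> in M. F_process1 M B N t \<omega> = Z \<omega>)" by blast
  have "stoch_integral M B (\<lambda>r. cos (real k * pi * r)) \<in> borel_measurable M" for k
    by (rule stoch_integral_by_parts(1)[OF d c bb])
  then show "F_process1 M B N t \<in> borel_measurable M"
    using brownian_bridge_measurable[OF bb t] unfolding F_process1_def[abs_def] by measurable
qed

text \<open>The term a_0/2 is the integral of the path and has kernel 1/2 - r. Subtracting it from
  the bridge kernel leaves the sawtooth 1/2 - u with u = t - r modulo 1 (up to the value at the
  jump), whose Fourier series has the terms sin (2 k pi u) / (k pi). Each cosine-sine pair has thus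
  merged into one shifted sine.\<close>

definition residual_kernel2 :: "nat \<Rightarrow> real \<Rightarrow> real \<Rightarrow> real" where
  "residual_kernel2 N t r = ((if r \<le> t then 1 else 0) + (r - (t + 1/2))) -
     (\<Sum>k=1..N. sin (2 * real k * pi * (t - r)) / (real k * pi))"

text \<open>Integration by parts over a full period: the indicator and the linear part leave
  opposite terms cos (m t) / m, and only the jump at r = s contributes.\<close>

lemma sawtooth_sin:
  assumes "s \<in> {0..1}" "k \<ge> 1"
  shows "((\<lambda>r. ((if r \<le> s then 1 else 0) + (r - (s + 1/2))) * (sin (2 * real k * pi * (t - r)) / (real k * pi)))
    has_integral cos (2 * real k * pi * (s - t)) / (2 * (real k * pi)\<^sup>2)) {0..1}"
proof -
  define m where "m = 2 * real k * pi"
  have m: "m \<noteq> 0" using assms by (simp add: m_def)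
  have "((\<lambda>r. sin (m * (t - r))) has_integral (cos (m * (t - s)) / m - cos (m * (t - 0)) / m)) {0..s}"
    by (rule has_integral_of_derivative) (use assms m in \<open>auto intro!: derivative_eq_intros\<close>)
  then have 1: "((\<lambda>r. if r \<le> s then sin (m * (t - r)) else 0) has_integral (cos (m * (t - s)) / m - cos (m * (t - 0)) / m)) {0..1}"
    using assms by (intro has_integral_initial_segment) auto
  have d: "((\<lambda>r. (r - (s + 1/2)) * (cos (m * (t - r)) / m) + sin (m * (t - r)) / m / m) has_real_derivative
      (r - (s + 1/2)) * sin (m * (t - r))) (at r)" for r
    using m by (auto intro!: derivative_eq_intros simp: add_divide_distrib)
  have "cos m = 1" "sin m = 0"
    using cos_2npi[of k] sin_2npi[of k] by (simp_all add: m_def mult_ac)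
  then have p: "cos (m * (t - 1)) = cos (m * t)" "sin (m * (t - 1)) = sin (m * t)"
    by (simp_all add: right_diff_distrib cos_diff sin_diff)
  have "((\<lambda>r. (r - (s + 1/2)) * sin (m * (t - r))) has_integral
      ((1 - (s + 1/2)) * (cos (m * (t - 1)) / m) + sin (m * (t - 1)) / m / m -
        ((0 - (s + 1/2)) * (cos (m * (t - 0)) / m) + sin (m * (t - 0)) / m / m))) {0..1}"
    by (rule has_integral_of_derivative[OF zero_le_one d])
  moreover have "(1 - (s + 1/2)) * (cos (m * (t - 1)) / m) + sin (m * (t - 1)) / m / m -
        ((0 - (s + 1/2)) * (cos (m * (t - 0)) / m) + sin (m * (t - 0)) / m / m) = cos (m * t) / m"
    unfolding p diff_0_right using m by (simp add: field_simps)
  ultimately have 2: "((\<lambda>r. (r - (s + 1/2)) * sin (m * (t - r))) has_integral cos (m * t) / m) {0..1}"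
    by simp
  have "((\<lambda>r. ((if r \<le> s then sin (m * (t - r)) else 0) + (r - (s + 1/2)) * sin (m * (t - r))) * (1 / (real k * pi)))
     has_integral (cos (m * (t - s)) / m - cos (m * (t - 0)) / m + cos (m * t) / m) * (1 / (real k * pi))) {0..1}"
    by (intro has_integral_mult_left has_integral_add 1 2)
  moreover have "(cos (m * (t - s)) / m - cos (m * (t - 0)) / m + cos (m * t) / m) * (1 / (real k * pi))
     = cos (2 * real k * pi * (s - t)) / (2 * (real k * pi)\<^sup>2)"
  proof -
    have "cos (m * (t - s)) = cos (2 * real k * pi * (s - t))"
      using cos_minus[of "m * (s - t)"] by (simp add: m_def algebra_simps)
    then show ?thesis by (simp add: m_def power2_eq_square)
  qed
  ultimately have "((\<lambda>r. ((if r \<le> s then sin (m * (t - r)) else 0) + (r - (s + 1/2)) * sin (m * (t - r))) * (1 / (real k * pi)))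
     has_integral cos (2 * real k * pi * (s - t)) / (2 * (real k * pi)\<^sup>2)) {0..1}" by simp
  then show ?thesis
    by (rule has_integral_eq[rotated]) (auto simp: m_def distrib_right)
qed

lemma shifted_sin_orthogonal:
  assumes "j \<ge> 1" "k \<ge> 1"
  shows "((\<lambda>r. sin (2 * real j * pi * (s - r)) * sin (2 * real k * pi * (t - r))) has_integral
    (if j = k then cos (2 * real k * pi * (s - t)) / 2 else 0)) {0..1}"
proof -
  have 1: "((\<lambda>r. cos ((2 * real j * pi * s - 2 * real k * pi * t) - 2 * of_int (int j - int k) * pi * r)) has_integral
     (if j = k then cos (2 * real k * pi * (s - t)) else 0)) {0..1}"
  proof (cases "j = k")
    case True
    then show ?thesis using has_integral_const_real[of "cos (2 * real k * pi * (s - t))" 0 1]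
      by (simp add: right_diff_distrib)
  next
    case False
    then show ?thesis using has_integral_cos_period[of "int j - int k"] by auto
  qed
  have 2: "((\<lambda>r. cos ((2 * real j * pi * s + 2 * real k * pi * t) - 2 * of_int (int j + int k) * pi * r)) has_integral 0) {0..1}"
    using assms by (intro has_integral_cos_period) auto
  have "((\<lambda>r. (1/2) * (cos ((2 * real j * pi * s - 2 * real k * pi * t) - 2 * of_int (int j - int k) * pi * r)
      - cos ((2 * real j * pi * s + 2 * real k * pi * t) - 2 * of_int (int j + int k) * pi * r)))
      has_integral (1/2) * ((if j = k then cos (2 * real k * pi * (s - t)) else 0) - 0)) {0..1}"
    by (intro has_integral_mult_right has_integral_diff 1 2)
  then show ?thesis
    by (rule has_integral_eq[rotated, THEN has_integral_eq_rhs]) (auto simp: sin_times_sin algebra_simps)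
qed

text \<open>The value is half the Bernoulli polynomial B_2 at |s - t|; at x = 2 pi |s - t| the
  polynomial of \<open>cosine_remainder\<close> is pi^2 times the same B_2, which accounts for the
  factor 1/(2 pi^2) in \<open>residual_kernel2_inner\<close>.\<close>

lemma sawtooth_inner:
  fixes s t :: real
  assumes "s \<in> {0..1}" "t \<in> {0..1}"
  shows "((\<lambda>r. ((if r \<le> s then 1 else 0) + (r - (s + 1/2))) * ((if r \<le> t then 1 else 0) + (r - (t + 1/2))))
    has_integral ((s - t)\<^sup>2 - \<bar>s - t\<bar> + 1/6) / 2) {0..1}"
proof -
  have q: "((\<lambda>r. r - b) has_integral (u\<^sup>2 / 2 - b * u)) {0..u}" if "0 \<le> u" for b u :: real
  proof -
    have "((\<lambda>r. r - b) has_integral ((u\<^sup>2 / 2 - b * u) - (0\<^sup>2 / 2 - b * 0))) {0..u}"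
      by (rule has_integral_of_derivative) (use that in \<open>auto intro!: derivative_eq_intros\<close>)
    then show ?thesis by simp
  qed
  have one: "((\<lambda>r. if r \<le> min s t then 1 else 0) has_integral min s t) {0..1}"
    using has_integral_initial_segment[of "min s t" "\<lambda>_. 1" "min s t"]
      has_integral_const_real[of "1::real" 0 "min s t"] assms by (simp add: min_le_iff_disj)
  have lin1: "((\<lambda>r. if r \<le> s then r - (t + 1/2) else 0) has_integral (s\<^sup>2 / 2 - (t + 1/2) * s)) {0..1}"
    using assms by (intro has_integral_initial_segment q) auto
  have lin2: "((\<lambda>r. if r \<le> t then r - (s + 1/2) else 0) has_integral (t\<^sup>2 / 2 - (s + 1/2) * t)) {0..1}"
    using assms by (intro has_integral_initial_segment q) auto
  have quad: "((\<lambda>r. (r - a) * (r - b)) has_integral (1/3 - (a + b) / 2 + a * b)) {0..1}" for a b :: real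
  proof -
    have "((\<lambda>r. (r - a) * (r - b)) has_integral ((1^3 / 3 - (a + b) / 2 * 1\<^sup>2 + a * b * 1) - (0^3 / 3 - (a + b) / 2 * 0\<^sup>2 + a * b * 0))) {0..1}"
      by (rule has_integral_of_derivative) (auto intro!: derivative_eq_intros simp: field_simps power2_eq_square)
    then show ?thesis by simp
  qed
  have A: "((\<lambda>r. (if r \<le> min s t then 1 else 0) + (if r \<le> s then r - (t + 1/2) else 0) + (if r \<le> t then r - (s + 1/2) else 0)
     + (r - (s + 1/2)) * (r - (t + 1/2))) has_integral
     (min s t + (s\<^sup>2 / 2 - (t + 1/2) * s) + (t\<^sup>2 / 2 - (s + 1/2) * t) + (1/3 - ((s + 1/2) + (t + 1/2)) / 2 + (s + 1/2) * (t + 1/2)))) {0..1}"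
    by (intro has_integral_add one lin1 lin2 quad)
  have E: "min s t + (s\<^sup>2 / 2 - (t + 1/2) * s) + (t\<^sup>2 / 2 - (s + 1/2) * t) + (1/3 - ((s + 1/2) + (t + 1/2)) / 2 + (s + 1/2) * (t + 1/2))
     = ((s - t)\<^sup>2 - \<bar>s - t\<bar> + 1/6) / 2"
    by (cases "s \<le> t") (simp_all add: field_simps power2_eq_square min_def)
  show ?thesis by (rule has_integral_eq[OF _ A[unfolded E]]) (auto simp: distrib_left distrib_right)
qed

lemma residual_kernel2_inner:
  assumes "s \<in> {0..1}" "t \<in> {0..1}"
  shows "((\<lambda>r. residual_kernel2 N s r * residual_kernel2 N t r) has_integral
    cosine_remainder N (2 * pi * \<bar>s - t\<bar>) / (2 * pi\<^sup>2)) {0..1}"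
proof -
  define c where "c k = cos (2 * real k * pi * (s - t)) / (2 * (real k * pi)\<^sup>2)" for k
  have "((\<lambda>r. residual_kernel2 N s r * residual_kernel2 N t r) has_integral
     (((s - t)\<^sup>2 - \<bar>s - t\<bar> + 1/6) / 2 - (\<Sum>k=1..N. c k))) {0..1}"
    unfolding residual_kernel2_def
  proof (rule has_integral_residual_product)
    fix k assume k: "k \<in> {1..N}"
    from sawtooth_sin[of s k t] k assms
    show "((\<lambda>r. ((if r \<le> s then 1 else 0) + (r - (s + 1/2))) * (sin (2 * real k * pi * (t - r)) / (real k * pi))) has_integral c k) {0..1}"
      by (simp add: c_def)
    have "cos (2 * real k * pi * (t - s)) = cos (2 * real k * pi * (s - t))"
      using cos_minus[of "2 * real k * pi * (s - t)"] by (simp add: algebra_simps)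
    with sawtooth_sin[of t k s] k assms
    show "((\<lambda>r. sin (2 * real k * pi * (s - r)) / (real k * pi) * ((if r \<le> t then 1 else 0) + (r - (t + 1/2)))) has_integral c k) {0..1}"
      by (simp add: c_def mult.commute)
    fix j assume j: "j \<in> {1..N}"
    from has_integral_mult_right[OF shifted_sin_orthogonal[of j k s t], of "1 / (real j * pi) * (1 / (real k * pi))"] j k
    show "((\<lambda>r. sin (2 * real j * pi * (s - r)) / (real j * pi) * (sin (2 * real k * pi * (t - r)) / (real k * pi)))
        has_integral (if j = k then c k else 0)) {0..1}"
      by (cases "j = k") (simp_all add: c_def mult_ac power2_eq_square)
  qed (use sawtooth_inner[OF assms] in auto)
  moreover have "((s - t)\<^sup>2 - \<bar>s - t\<bar> + 1/6) / 2 - (\<Sum>k=1..N. c k) = cosine_remainder N (2 * pi * \<bar>s - t\<bar>) / (2 * pi\<^sup>2)"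
  proof -
    have "c k = cos (real k * (2 * pi * \<bar>s - t\<bar>)) / (real k)\<^sup>2 / (2 * pi\<^sup>2)" for k
    proof -
      have "cos (real k * (2 * pi * \<bar>s - t\<bar>)) = cos (2 * real k * pi * (s - t))"
      proof -
        have "real k * (2 * pi * \<bar>s - t\<bar>) = \<bar>2 * real k * pi * (s - t)\<bar>" by (simp add: abs_mult)
        then show ?thesis by (simp only: cos_abs_real)
      qed
      then show ?thesis by (simp add: c_def power_mult_distrib mult_ac)
    qed
    then have S: "(\<Sum>k=1..N. c k) = (\<Sum>k=1..N. cos (real k * (2 * pi * \<bar>s - t\<bar>)) / (real k)\<^sup>2) / (2 * pi\<^sup>2)"
      by (simp add: sum_divide_distrib)
    have P: "(pi\<^sup>2 / 6 - pi * (2 * pi * \<bar>s - t\<bar>) / 2 + (2 * pi * \<bar>s - t\<bar>)\<^sup>2 / 4) / (2 * pi\<^sup>2) = ((s - t)\<^sup>2 - \<bar>s - t\<bar> + 1/6) / 2"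
      by (simp add: field_simps power2_eq_square)
    show ?thesis unfolding S P[symmetric] cosine_remainder_def by (simp add: diff_divide_distrib)
  qed
  ultimately show ?thesis by simp
qed

text \<open>By the addition theorem the Fourier partial sum is one integral of the path against a
  Dirichlet kernel. It is written as - integral B f' so that it has the shape of an integral against
  the bridge in \<open>riemann_sum_rep\<close>.\<close>

lemma fourier_partial_sum_integral:
  assumes c: "continuous_on {0..1} (\<lambda>r. B r \<omega>)"
  shows "1 / 2 * fourier_a B 0 \<omega> + (\<Sum>k=1..N. fourier_a B k \<omega> * cos (2 * real k * pi * t) + fourier_b B k \<omega> * sin (2 * real k * pi * t))
    = - integral {0..1} (\<lambda>r. B r \<omega> * (- 1 - (\<Sum>k=1..N. 2 * cos (2 * real k * pi * (t - r)))))"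
proof -
  have I: "((\<lambda>r. h r * B r \<omega>) has_integral (LBINT r:{0..1}. h r * B r \<omega>)) {0..1}" if "continuous_on {0..1} h" for h
  proof -
    have "set_integrable lborel {0..1} (\<lambda>r. h r * B r \<omega>)"
      by (rule borel_integrable_atLeastAtMost') (intro continuous_intros c that)
    from set_borel_integral_eq_integral[OF this] show ?thesis by (simp add: has_integral_integrable_integral)
  qed
  have a: "((\<lambda>r. 2 * (cos (2 * real k * pi * r) * B r \<omega>)) has_integral fourier_a B k \<omega>) {0..1}" for k
    unfolding fourier_a_def by (intro has_integral_mult_right I continuous_intros)
  have b: "((\<lambda>r. 2 * (sin (2 * real k * pi * r) * B r \<omega>)) has_integral fourier_b B k \<omega>) {0..1}" for k
    unfolding fourier_b_def by (intro has_integral_mult_right I continuous_intros)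
  have "((\<lambda>r. 1 / 2 * (2 * (cos (2 * real 0 * pi * r) * B r \<omega>)) + (\<Sum>k=1..N. 2 * (cos (2 * real k * pi * r) * B r \<omega>) * cos (2 * real k * pi * t)
      + 2 * (sin (2 * real k * pi * r) * B r \<omega>) * sin (2 * real k * pi * t))) has_integral
     (1 / 2 * fourier_a B 0 \<omega> + (\<Sum>k=1..N. fourier_a B k \<omega> * cos (2 * real k * pi * t) + fourier_b B k \<omega> * sin (2 * real k * pi * t)))) {0..1}"
    by (intro has_integral_add has_integral_sum has_integral_mult_right has_integral_mult_left a b) auto
  then have "((\<lambda>r. - (B r \<omega> * (- 1 - (\<Sum>k=1..N. 2 * cos (2 * real k * pi * (t - r)))))) has_integral
     (1 / 2 * fourier_a B 0 \<omega> + (\<Sum>k=1..N. fourier_a B k \<omega> * cos (2 * real k * pi * t) + fourier_b B k \<omega> * sin (2 * real k * pi * t)))) {0..1}"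
  proof (rule has_integral_eq[rotated])
    fix r :: real
    have "2 * (cos (2 * real k * pi * r) * B r \<omega>) * cos (2 * real k * pi * t) + 2 * (sin (2 * real k * pi * r) * B r \<omega>) * sin (2 * real k * pi * t)
        = B r \<omega> * (2 * cos (2 * real k * pi * (t - r)))" for k
      by (simp add: right_diff_distrib cos_diff algebra_simps)
    then show "1 / 2 * (2 * (cos (2 * real 0 * pi * r) * B r \<omega>)) + (\<Sum>k=1..N. 2 * (cos (2 * real k * pi * r) * B r \<omega>) * cos (2 * real k * pi * t)
      + 2 * (sin (2 * real k * pi * r) * B r \<omega>) * sin (2 * real k * pi * t)) = - (B r \<omega> * (- 1 - (\<Sum>k=1..N. 2 * cos (2 * real k * pi * (t - r)))))"
      by (simp add: algebra_simps flip: sum_distrib_left)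
  qed
  from integral_unique[OF this] show ?thesis by (simp only: integral_neg)
qed

text \<open>Only Lebesgue integrals of continuous paths occur, so the representation holds at every
  sample point for the process itself.\<close>

lemma F_process2_rep:
  assumes bb: "brownian_bridge M B" and t: "t \<in> {0..1}"
  shows "wiener_rep M B (F_process2 B N t) (\<lambda>r. sqrt (2 * real N) * residual_kernel2 N t r)"
proof -
  \<comment> \<open>A primitive of the negated Dirichlet kernel \<open>f'\<close>. Its mean is -1/2,
    so the Fourier partial sum of the path has kernel f + 1/2.\<close>
  define f where "f r = - r + (\<Sum>k=1..N. sin (2 * real k * pi * (t - r)) / (real k * pi))" for r
  define f' where "f' r = - 1 - (\<Sum>k=1..N. 2 * cos (2 * real k * pi * (t - r)))" for r
  have d: "(f has_real_derivative f' r) (at r)" for r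
  proof -
    have "((\<lambda>r. sin (2 * real k * pi * (t - r)) / (real k * pi)) has_real_derivative - (2 * cos (2 * real k * pi * (t - r)))) (at r)"
      if "k \<in> {1..N}" for k
      using that by (auto intro!: derivative_eq_intros)
    then have "(f has_real_derivative (- 1 + (\<Sum>k=1..N. - (2 * cos (2 * real k * pi * (t - r)))))) (at r)"
      unfolding f_def by (intro DERIV_add DERIV_sum) (auto intro!: derivative_eq_intros)
    then show ?thesis by (simp add: f'_def sum_negf)
  qed
  have c: "continuous_on {0..1} f'" unfolding f'_def by (intro continuous_intros)
  have "(f has_integral (- (1/2) + (\<Sum>k=1..N. 0))) {0..1}"
    unfolding f_def
  proof (intro has_integral_add has_integral_sum)
    show "(uminus has_integral - (1/2)) {0..1::real}"
    proof -
      have "((\<lambda>r. - (r\<^sup>2 / 2)) has_real_derivative - r) (at r)" for r :: real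
        by (auto intro!: derivative_eq_intros)
      from has_integral_of_derivative[OF zero_le_one this] show ?thesis by simp
    qed
    show "((\<lambda>r. sin (2 * real k * pi * (t - r)) / (real k * pi)) has_integral 0) {0..1}" if "k \<in> {1..N}" for k
    proof -
      \<comment> \<open>The phase - pi/2 turns the cosine into the required sine.\<close>
      have "((\<lambda>r. cos ((2 * real k * pi * t - pi / 2) - 2 * of_int (int k) * pi * r) / (real k * pi)) has_integral 0 / (real k * pi)) {0..1}"
        using that by (intro has_integral_divide has_integral_cos_period) auto
      moreover have "cos ((2 * real k * pi * t - pi / 2) - 2 * of_int (int k) * pi * r) = sin (2 * real k * pi * (t - r))" for r
        by (simp add: sin_cos_eq[of "2 * real k * pi * (t - r)"] algebra_simps cos_diff cos_add sin_diff sin_add)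
      ultimately show ?thesis by simp
    qed
  qed auto
  then have "integral {0..1} f = - (1/2)" by (simp add: integral_unique)
  with riemann_sum_rep[OF d c bb]
  have r: "wiener_rep M B (\<lambda>\<omega>. - integral {0..1} (\<lambda>r. B r \<omega> * f' r)) (\<lambda>r. f r + 1/2)" by simp
  have "wiener_rep M B (\<lambda>\<omega>. sqrt (2 * real N) * (B t \<omega> + (- 1) * (- integral {0..1} (\<lambda>r. B r \<omega> * f' r))))
     (\<lambda>r. sqrt (2 * real N) * (bridge_kernel t r + (- 1) * (f r + 1/2)))"
    by (intro wiener_rep_scale wiener_rep_add wiener_rep_single t r)
  then show ?thesis
  proof (rule wiener_rep_cong)
    fix \<omega> assume "\<omega> \<in> space M"
    then have "continuous_on {0..1} (\<lambda>r. B r \<omega>)" using bb by (simp add: brownian_bridge_def)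
    note F = fourier_partial_sum_integral[where B=B and \<omega>=\<omega> and N=N and t=t, OF this]
    show "sqrt (2 * real N) * (B t \<omega> + (- 1) * (- integral {0..1} (\<lambda>r. B r \<omega> * f' r))) = F_process2 B N t \<omega>"
      unfolding F_process2_def f'_def F[symmetric] by simp
  next
    show "sqrt (2 * real N) * (bridge_kernel t r + (- 1) * (f r + 1/2)) = sqrt (2 * real N) * residual_kernel2 N t r" for r
      by (simp add: bridge_kernel_def f_def residual_kernel2_def)
  qed
qed

section \<open>Convergence of the fluctuation processes\<close>

lemma (in prob_space) centered_gaussian_cong_AE:
  assumes "centered_gaussian M Z v" and ae: "AE \<omega> in M. Z \<omega> = Z' \<omega>" and [measurable]: "Z' \<in> borel_measurable M"
  shows "centered_gaussian M Z' v"
proof -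
  have [measurable]: "Z \<in> borel_measurable M" using assms(1) by (simp add: centered_gaussian_def)
  have "expectation (\<lambda>\<omega>. cos (a * Z' \<omega> + b)) = expectation (\<lambda>\<omega>. cos (a * Z \<omega> + b))" for a b
    by (rule integral_cong_AE) (use ae in auto)
  moreover have "expectation (\<lambda>\<omega>. (Z' \<omega>)\<^sup>2) = expectation (\<lambda>\<omega>. (Z \<omega>)\<^sup>2)"
    by (rule integral_cong_AE) (use ae in auto)
  moreover have "integrable M (\<lambda>\<omega>. (Z' \<omega>)\<^sup>2) \<longleftrightarrow> integrable M (\<lambda>\<omega>. (Z \<omega>)\<^sup>2)"
    by (rule integrable_cong_AE) (use ae in auto)
  ultimately show ?thesis using assms(1) by (simp add: centered_gaussian_def)
qed

lemma wiener_rep_sum_gaussian: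
  assumes bb: "brownian_bridge M B" and I: "finite I"
    and rep: "\<And>i. i \<in> I \<Longrightarrow> wiener_rep M B (Z i) (\<phi> i)"
    and inner: "\<And>i j. i \<in> I \<Longrightarrow> j \<in> I \<Longrightarrow> ((\<lambda>r. \<phi> i r * \<phi> j r) has_integral C i j) {0..1}"
  shows "centered_gaussian M (\<lambda>\<omega>. \<Sum>i\<in>I. u i * Z i \<omega>) (\<Sum>i\<in>I. \<Sum>j\<in>I. u i * u j * C i j)"
proof (rule wiener_rep_gaussian[OF bb])
  show "wiener_rep M B (\<lambda>\<omega>. \<Sum>i\<in>I. u i * Z i \<omega>) (\<lambda>r. \<Sum>i\<in>I. u i * \<phi> i r)"
    by (intro wiener_rep_sum wiener_rep_scale rep I)
  have "((\<lambda>r. \<Sum>i\<in>I. \<Sum>j\<in>I. u i * u j * (\<phi> i r * \<phi> j r)) has_integral (\<Sum>i\<in>I. \<Sum>j\<in>I. u i * u j * C i j)) {0..1}"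
    by (intro has_integral_sum has_integral_mult_right inner I)
  then show "((\<lambda>r. (\<Sum>i\<in>I. u i * \<phi> i r)\<^sup>2) has_integral (\<Sum>i\<in>I. \<Sum>j\<in>I. u i * u j * C i j)) {0..1}"
    by (rule has_integral_eq[rotated]) (simp add: power2_eq_square sum_product mult_ac)
qed

text \<open>In the spirit of Cramer-Wold, only linear combinations enter, and their laws are
  determined by quadratic forms. Convergence of the covariances gives convergence of the
  characteristic functions and also, being convergent, bounds the second moments uniformly in
  N.\<close>

lemma converges_fdd_gaussianI:
  assumes prob: "prob_space M" "prob_space L"
    and meas: "\<And>N t. t \<in> T \<Longrightarrow> X N t \<in> borel_measurable M" "\<And>t. t \<in> T \<Longrightarrow> Y t \<in> borel_measurable L"
    and gX: "\<And>N n (t :: nat \<Rightarrow> real) u. (\<And>i. i < n \<Longrightarrow> t i \<in> T) \<Longrightarrow>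
      centered_gaussian M (\<lambda>\<omega>. \<Sum>i<n. u i * X N (t i) \<omega>) (\<Sum>i<n. \<Sum>j<n. u i * u j * C N (t i) (t j))"
    and gY: "\<And>n (t :: nat \<Rightarrow> real) u. (\<And>i. i < n \<Longrightarrow> t i \<in> T) \<Longrightarrow>
      centered_gaussian L (\<lambda>\<omega>. \<Sum>i<n. u i * Y (t i) \<omega>) (\<Sum>i<n. \<Sum>j<n. u i * u j * D (t i) (t j))"
    and lim: "\<And>s t. s \<in> T \<Longrightarrow> t \<in> T \<Longrightarrow> (\<lambda>N. C N s t) \<longlonglongrightarrow> D s t"
  shows "converges_fdd T M X L Y"
  unfolding converges_fdd_def
proof (intro conjI allI ballI impI meas)
  fix n :: nat and t :: "nat \<Rightarrow> real"
  assume "\<forall>i<n. t i \<in> T"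
  then have t: "\<And>i. i < n \<Longrightarrow> t i \<in> T" by blast
  have varX: "integrable M (\<lambda>\<omega>. (X N (t i) \<omega>)\<^sup>2) \<and> (\<integral>\<omega>. (X N (t i) \<omega>)\<^sup>2 \<partial>M) \<le> C N (t i) (t i)" if "i < n" for N i
    using gX[of 1 "\<lambda>_. t i" "\<lambda>_. 1" N] t[OF that] by (simp add: centered_gaussian_def)
  have varY: "integrable L (\<lambda>\<omega>. (Y (t i) \<omega>)\<^sup>2) \<and> (\<integral>\<omega>. (Y (t i) \<omega>)\<^sup>2 \<partial>L) \<le> D (t i) (t i)" if "i < n" for i
    using gY[of 1 "\<lambda>_. t i" "\<lambda>_. 1"] t[OF that] by (simp add: centered_gaussian_def)
  have "\<exists>b. i < n \<longrightarrow> (\<forall>N. \<bar>C N (t i) (t i)\<bar> \<le> b)" for i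
  proof (cases "i < n")
    case True
    have "Bseq (\<lambda>N. C N (t i) (t i))"
      using lim[of "t i" "t i"] t[OF True] by (intro convergent_imp_Bseq convergentI[of _ "D (t i) (t i)"]) simp
    then obtain K where "\<forall>N. norm (C N (t i) (t i)) \<le> K" by (rule BseqE)
    then show ?thesis by (intro exI[of _ K]) simp
  qed simp
  then have "\<exists>b. \<forall>i. i < n \<longrightarrow> (\<forall>N. \<bar>C N (t i) (t i)\<bar> \<le> b i)" by (intro choice allI)
  then obtain b where "\<forall>i. i < n \<longrightarrow> (\<forall>N. \<bar>C N (t i) (t i)\<bar> \<le> b i)" by (rule exE)
  then have b: "\<bar>C N (t i) (t i)\<bar> \<le> b i" if "i < n" for i N using that by blast
  \<comment> \<open>A sum of nonnegative terms dominates each of them, so one constant serves all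
    coordinates of the sequence and of the limit.\<close>
  define V where "V = (\<Sum>i<n. \<bar>b i\<bar> + \<bar>D (t i) (t i)\<bar>)"
  have V: "\<bar>b i\<bar> + \<bar>D (t i) (t i)\<bar> \<le> V" if "i < n" for i
    unfolding V_def using that by (intro member_le_sum[where f="\<lambda>i. \<bar>b i\<bar> + \<bar>D (t i) (t i)\<bar>"]) auto
  show "converges_in_distribution (Euclidean_space n) M (\<lambda>N \<omega> i. if i < n then X N (t i) \<omega> else 0)
      L (\<lambda>\<omega> i. if i < n then Y (t i) \<omega> else 0)"
  proof (rule converges_in_distribution_charI[OF prob, where V=V])
    show "(\<lambda>\<omega>. if i < n then X N (t i) \<omega> else 0) \<in> borel_measurable M" for N i
      using meas(1)[OF t, of i N] by (cases "i < n") auto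
    show "(\<lambda>\<omega>. if i < n then Y (t i) \<omega> else 0) \<in> borel_measurable L" for i
      using meas(2)[OF t, of i] by (cases "i < n") auto
    fix u :: "nat \<Rightarrow> real" and a :: real
    have "(\<integral>\<omega>. cos ((\<Sum>i<n. u i * (if i < n then X N (t i) \<omega> else 0)) + a) \<partial>M)
        = exp (- ((\<Sum>i<n. \<Sum>j<n. u i * u j * C N (t i) (t j)) / 2)) * cos a" for N
      using centered_gaussian_expectation_cos[OF gX[OF t, where u=u and N=N]] by simp
    moreover have "(\<integral>\<omega>. cos ((\<Sum>i<n. u i * (if i < n then Y (t i) \<omega> else 0)) + a) \<partial>L)
        = exp (- ((\<Sum>i<n. \<Sum>j<n. u i * u j * D (t i) (t j)) / 2)) * cos a"
      using centered_gaussian_expectation_cos[OF gY[OF t, where u=u]] by simp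
    moreover have "(\<lambda>N. exp (- ((\<Sum>i<n. \<Sum>j<n. u i * u j * C N (t i) (t j)) / 2)) * cos a) \<longlonglongrightarrow>
        exp (- ((\<Sum>i<n. \<Sum>j<n. u i * u j * D (t i) (t j)) / 2)) * cos a"
      by (intro tendsto_intros lim) (use t in auto)
    ultimately show "(\<lambda>N. \<integral>\<omega>. cos ((\<Sum>i<n. u i * (if i < n then X N (t i) \<omega> else 0)) + a) \<partial>M) \<longlonglongrightarrow>
        (\<integral>\<omega>. cos ((\<Sum>i<n. u i * (if i < n then Y (t i) \<omega> else 0)) + a) \<partial>L)" by simp
  next
    fix N i assume i: "i < n"
    show "integrable M (\<lambda>\<omega>. (if i < n then X N (t i) \<omega> else 0)\<^sup>2)" "integrable L (\<lambda>\<omega>. (if i < n then Y (t i) \<omega> else 0)\<^sup>2)"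
      using varX[OF i] varY[OF i] i by simp_all
    show "(\<integral>\<omega>. (if i < n then X N (t i) \<omega> else 0)\<^sup>2 \<partial>M) \<le> V"
    proof -
      have "(\<integral>\<omega>. (X N (t i) \<omega>)\<^sup>2 \<partial>M) \<le> V"
        using varX[OF i, of N] b[OF i, of N] V[OF i] by linarith
      then show ?thesis using i by simp
    qed
    show "(\<integral>\<omega>. (if i < n then Y (t i) \<omega> else 0)\<^sup>2 \<partial>L) \<le> V"
    proof -
      have "(\<integral>\<omega>. (Y (t i) \<omega>)\<^sup>2 \<partial>L) \<le> V"
        using varY[OF i] V[OF i] by linarith
      then show ?thesis using i by simp
    qed
  qed auto
qed

lemma F_process1_fdd:
  assumes bb: "brownian_bridge M B" and L: "prob_space L"
    and Y: "\<And>t. t \<in> {0..1} \<Longrightarrow> Y t \<in> borel_measurable L"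
      "\<And>n (t :: nat \<Rightarrow> real) u. (\<And>i. i < n \<Longrightarrow> t i \<in> {0..1}) \<Longrightarrow>
      centered_gaussian L (\<lambda>\<omega>. \<Sum>i<n. u i * Y (t i) \<omega>)
        (\<Sum>i<n. \<Sum>j<n. u i * u j * (if t i = t j \<and> 0 < t i \<and> t i < 1 then 1 / pi\<^sup>2 else 0))"
  shows "converges_fdd {0..1} M (F_process1 M B) L Y"
proof -
  interpret prob_space M using bb by (simp add: brownian_bridge_def)
  define C where "C N s t = real N * ((cosine_remainder N (pi * \<bar>s - t\<bar>) - cosine_remainder N (pi * (s + t))) / pi\<^sup>2)" for N s t
  \<comment> \<open>A version is fixed for each N and t; the exceptional null sets of finitely many
    times are united below.\<close>
  define Z where "Z N t = (SOME Z. wiener_rep M B Z (\<lambda>r. sqrt (real N) * residual_kernel1 N t r) \<and>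
    (AE \<omega> in M. F_process1 M B N t \<omega> = Z \<omega>))" for N t
  have "wiener_rep M B (Z N t) (\<lambda>r. sqrt (real N) * residual_kernel1 N t r) \<and>
    (AE \<omega> in M. F_process1 M B N t \<omega> = Z N t \<omega>)" if "t \<in> {0..1}" for N t
    unfolding Z_def by (rule someI_ex[OF F_process1_rep(1)[OF bb that]])
  then have Z: "\<And>N t. t \<in> {0..1} \<Longrightarrow> wiener_rep M B (Z N t) (\<lambda>r. sqrt (real N) * residual_kernel1 N t r)"
    "\<And>N t. t \<in> {0..1} \<Longrightarrow> AE \<omega> in M. F_process1 M B N t \<omega> = Z N t \<omega>" by auto
  note Z = Z F_process1_rep(2)[OF bb]
  show ?thesis
  proof (rule converges_fdd_gaussianI[where C=C and D="\<lambda>s t. if s = t \<and> 0 < s \<and> s < 1 then 1 / pi\<^sup>2 else 0"])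
    show "centered_gaussian M (\<lambda>\<omega>. \<Sum>i<n. u i * F_process1 M B N (t i) \<omega>) (\<Sum>i<n. \<Sum>j<n. u i * u j * C N (t i) (t j))"
      if t: "\<And>i. i < n \<Longrightarrow> t i \<in> {0..1}" for N n and t :: "nat \<Rightarrow> real" and u
    proof (rule centered_gaussian_cong_AE)
      show "centered_gaussian M (\<lambda>\<omega>. \<Sum>i<n. u i * Z N (t i) \<omega>) (\<Sum>i<n. \<Sum>j<n. u i * u j * C N (t i) (t j))"
      proof (rule wiener_rep_sum_gaussian[OF bb])
        fix i j assume "i \<in> {..<n}" "j \<in> {..<n}"
        then have "((\<lambda>r. real N * (residual_kernel1 N (t i) r * residual_kernel1 N (t j) r)) has_integral C N (t i) (t j)) {0..1}"
          unfolding C_def using t by (intro has_integral_mult_right residual_kernel1_inner) auto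
        moreover have "sqrt (real N) * x * (sqrt (real N) * y) = real N * (x * y)" for x y
          using real_sqrt_mult_self[of "real N"] by (simp add: algebra_simps)
        ultimately show "((\<lambda>r. sqrt (real N) * residual_kernel1 N (t i) r * (sqrt (real N) * residual_kernel1 N (t j) r)) has_integral C N (t i) (t j)) {0..1}"
          by (simp only:)
      qed (use Z(1) t in auto)
      have "AE \<omega> in M. \<forall>i\<in>{..<n}. F_process1 M B N (t i) \<omega> = Z N (t i) \<omega>"
        using Z(2) t by (intro AE_finite_allI) auto
      then show "AE \<omega> in M. (\<Sum>i<n. u i * Z N (t i) \<omega>) = (\<Sum>i<n. u i * F_process1 M B N (t i) \<omega>)"
        by eventually_elim auto
      show "(\<lambda>\<omega>. \<Sum>i<n. u i * F_process1 M B N (t i) \<omega>) \<in> borel_measurable M"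
        using Z(3) t by (intro borel_measurable_sum borel_measurable_times) auto
    qed
    show "(\<lambda>N. C N s t) \<longlonglongrightarrow> (if s = t \<and> 0 < s \<and> s < 1 then 1 / pi\<^sup>2 else 0)" if st: "s \<in> {0..1}" "t \<in> {0..1}" for s t
    proof -
      have pi2: "pi * x = 2 * pi \<longleftrightarrow> x = 2" for x
        using mult_cancel_left[of pi x 2] by (simp only: mult.commute[of pi 2]) simp
      \<comment> \<open>Since |s - t| <= 1, the first argument never reaches 2 pi. The second meets
        0 or 2 pi only for s = t = 0 and s = t = 1, where its contribution cancels the
        variance.\<close>
      have 1: "pi * \<bar>s - t\<bar> = 0 \<or> pi * \<bar>s - t\<bar> = 2 * pi \<longleftrightarrow> s = t" using st unfolding pi2 by auto
      have 2: "pi * (s + t) = 0 \<or> pi * (s + t) = 2 * pi \<longleftrightarrow> s = t \<and> \<not> (0 < s \<and> s < 1)"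
        using st unfolding pi2 by auto
      have "pi * \<bar>s - t\<bar> \<le> pi * 2" "pi * (s + t) \<le> pi * 2" using st by (intro mult_left_mono; auto)+
      then have m: "pi * \<bar>s - t\<bar> \<in> {0..2*pi}" "pi * (s + t) \<in> {0..2*pi}" using st by auto
      have "(\<lambda>N. (real N * cosine_remainder N (pi * \<bar>s - t\<bar>) - real N * cosine_remainder N (pi * (s + t))) / pi\<^sup>2)
        \<longlonglongrightarrow> ((if s = t then 1 else 0) - (if s = t \<and> \<not> (0 < s \<and> s < 1) then 1 else 0)) / pi\<^sup>2"
        using scaled_cosine_remainder[OF m(1), unfolded 1] scaled_cosine_remainder[OF m(2), unfolded 2]
        by (intro tendsto_intros) auto
      also have "((if s = t then 1 else 0) - (if s = t \<and> \<not> (0 < s \<and> s < 1) then 1 else 0)) / pi\<^sup>2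
        = (if s = t \<and> 0 < s \<and> s < 1 then 1 / pi\<^sup>2 else 0)" by auto
      finally show ?thesis by (simp add: C_def right_diff_distrib)
    qed
  qed (use L Y Z(3) in \<open>auto intro: prob_space_axioms\<close>)
qed

lemma F_process2_fdd:
  assumes bb: "brownian_bridge M B" and L: "prob_space L"
    and Y: "\<And>t. t \<in> {0..1} \<Longrightarrow> Y t \<in> borel_measurable L"
      "\<And>n (t :: nat \<Rightarrow> real) u. (\<And>i. i < n \<Longrightarrow> t i \<in> {0..1}) \<Longrightarrow>
      centered_gaussian L (\<lambda>\<omega>. \<Sum>i<n. u i * Y (t i) \<omega>)
        (\<Sum>i<n. \<Sum>j<n. u i * u j * (if t i = t j \<or> t i \<in> {0, 1} \<and> t j \<in> {0, 1} then 1 / pi\<^sup>2 else 0))"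
  shows "converges_fdd {0..1} M (F_process2 B) L Y"
proof -
  interpret prob_space M using bb by (simp add: brownian_bridge_def)
  define C where "C N s t = 2 * real N * (cosine_remainder N (2 * pi * \<bar>s - t\<bar>) / (2 * pi\<^sup>2))" for N s t
  have G: "centered_gaussian M (\<lambda>\<omega>. \<Sum>i<n. u i * F_process2 B N (t i) \<omega>) (\<Sum>i<n. \<Sum>j<n. u i * u j * C N (t i) (t j))"
    if t: "\<And>i. i < n \<Longrightarrow> t i \<in> {0..1}" for N n and t :: "nat \<Rightarrow> real" and u
  proof (rule wiener_rep_sum_gaussian[OF bb])
    fix i j assume "i \<in> {..<n}" "j \<in> {..<n}"
    then have I: "((\<lambda>r. 2 * real N * (residual_kernel2 N (t i) r * residual_kernel2 N (t j) r)) has_integral C N (t i) (t j)) {0..1}"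
      unfolding C_def using t by (intro has_integral_mult_right residual_kernel2_inner) auto
    have "sqrt (2 * real N) * x * (sqrt (2 * real N) * y) = 2 * real N * (x * y)" for x y
      using real_sqrt_mult_self[of "2 * real N"] by (simp add: mult_ac)
    note sq = this
    from I show "((\<lambda>r. sqrt (2 * real N) * residual_kernel2 N (t i) r * (sqrt (2 * real N) * residual_kernel2 N (t j) r)) has_integral C N (t i) (t j)) {0..1}"
      unfolding sq .
  qed (use F_process2_rep[OF bb] t in auto)
  show ?thesis
  proof (rule converges_fdd_gaussianI[where C=C and D="\<lambda>s t. if s = t \<or> s \<in> {0, 1} \<and> t \<in> {0, 1} then 1 / pi\<^sup>2 else 0"])
    show "F_process2 B N t \<in> borel_measurable M" if "t \<in> {0..1}" for N t
      using G[of 1 "\<lambda>_. t" "\<lambda>_. 1" N] that by (simp add: centered_gaussian_def)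
    show "(\<lambda>N. C N s t) \<longlonglongrightarrow> (if s = t \<or> s \<in> {0, 1} \<and> t \<in> {0, 1} then 1 / pi\<^sup>2 else 0)"
      if st: "s \<in> {0..1}" "t \<in> {0..1}" for s t
    proof -
      \<comment> \<open>The value 2 pi is attained only when s and t are opposite endpoints of
        [0,1].\<close>
      have 1: "2 * pi * \<bar>s - t\<bar> = 0 \<or> 2 * pi * \<bar>s - t\<bar> = 2 * pi \<longleftrightarrow> s = t \<or> s \<in> {0, 1} \<and> t \<in> {0, 1}"
        using st by auto
      have "2 * pi * \<bar>s - t\<bar> \<le> 2 * pi * 1" using st by (intro mult_left_mono) auto
      then have "2 * pi * \<bar>s - t\<bar> \<in> {0..2*pi}" by simp
      from tendsto_divide[OF scaled_cosine_remainder[OF this, unfolded 1] tendsto_const[of "pi\<^sup>2"]]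
      have "(\<lambda>N. real N * cosine_remainder N (2 * pi * \<bar>s - t\<bar>) / pi\<^sup>2) \<longlonglongrightarrow>
         (if s = t \<or> s \<in> {0, 1} \<and> t \<in> {0, 1} then 1 else 0) / pi\<^sup>2" by simp
      then show ?thesis by (simp add: C_def if_distrib[where f="\<lambda>z. z / pi\<^sup>2"] cong: if_cong)
    qed
  qed (use L Y G in \<open>auto intro: prob_space_axioms\<close>)
qed

section \<open>The limit collections\<close>

context prob_space
begin

lemma gaussian_rv_cong_AE:
  assumes g: "gaussian_rv M Z" and ae: "AE \<omega> in M. Z \<omega> = Z' \<omega>" and [measurable]: "Z' \<in> borel_measurable M"
  shows "gaussian_rv M Z'"
proof -
  have [measurable]: "Z \<in> borel_measurable M" using g by (simp add: gaussian_rv_def)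
  have d: "distr M lborel Z' = distr M lborel Z"
    by (rule distr_cong_AE) (use ae in auto)
  have "AE \<omega> in M. Z' \<omega> = \<mu>" if "AE \<omega> in M. Z \<omega> = \<mu>" for \<mu>
    using that ae by eventually_elim simp
  then show ?thesis using g d by (auto simp: gaussian_rv_def distributed_def)
qed

lemma gaussian_rv_normal:
  assumes "0 < \<sigma>" "distributed M lborel X (\<lambda>x. ennreal (normal_density \<mu> \<sigma> x))"
  shows "gaussian_rv M X"
  using assms distributed_measurable[OF assms(2)] unfolding gaussian_rv_def by auto

lemma gaussian_rv_scale:
  assumes "gaussian_rv M X" shows "gaussian_rv M (\<lambda>\<omega>. c * X \<omega>)"
proof (cases "c = 0")
  case False
  have [measurable]: "X \<in> borel_measurable M" using assms by (simp add: gaussian_rv_def)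
  consider \<mu> where "AE \<omega> in M. X \<omega> = \<mu>"
    | \<mu> \<sigma> where "0 < \<sigma>" "distributed M lborel X (\<lambda>x. ennreal (normal_density \<mu> \<sigma> x))"
    using assms by (auto simp: gaussian_rv_def)
  then show ?thesis
  proof cases
    case 1
    then have "AE \<omega> in M. c * X \<omega> = c * \<mu>" by eventually_elim simp
    then show ?thesis by (auto simp: gaussian_rv_def)
  next
    case 2
    then have "distributed M lborel (\<lambda>\<omega>. c * X \<omega>) (\<lambda>x. ennreal (normal_density (c * \<mu>) (\<bar>c\<bar> * \<sigma>) x))"
      using normal_density_affine[OF 2(2,1) False, of 0] by simp
    moreover have "0 < \<bar>c\<bar> * \<sigma>" using 2 False by simp
    ultimately show ?thesis unfolding gaussian_rv_def by auto
  qed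
qed (auto simp: gaussian_rv_def)

text \<open>The convolution theorem for normal laws requires densities, whereas scaled variables may
  be degenerate. The sum is restricted to the set \<open>D\<close> of times with a density; the
  other terms are almost surely constant, hence almost surely 0 because their means vanish.\<close>

lemma gaussian_process_of_indep:
  assumes ind: "indep_vars (\<lambda>_. borel) X T" and g: "\<And>t. t \<in> T \<Longrightarrow> gaussian_rv M (X t)"
    and mean: "\<And>t. t \<in> T \<Longrightarrow> expectation (X t) = 0"
  shows "gaussian_process M X T"
  unfolding gaussian_process_def
proof (intro allI impI)
  fix S :: "real set" and c :: "real \<Rightarrow> real"
  assume S: "finite S" "S \<subseteq> T"
  define D where "D = {t \<in> S. \<exists>\<mu> \<sigma>. 0 < \<sigma> \<and> distributed M lborel (\<lambda>\<omega>. c t * X t \<omega>) (\<lambda>x. ennreal (normal_density \<mu> \<sigma> x))}"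
  have m: "(\<lambda>\<omega>. c t * X t \<omega>) \<in> borel_measurable M" if "t \<in> S" for t
    using gaussian_rv_scale[OF g, of t "c t"] that S by (auto simp: gaussian_rv_def)
  have D: "D \<subseteq> S" "finite D" using S by (auto simp: D_def intro: finite_subset)
  have null: "AE \<omega> in M. c t * X t \<omega> = 0" if t: "t \<in> S - D" for t
  proof -
    have "\<exists>\<mu>. AE \<omega> in M. c t * X t \<omega> = \<mu>"
      using gaussian_rv_scale[OF g, of t "c t"] t S by (auto simp: gaussian_rv_def D_def)
    then obtain \<mu> where \<mu>: "AE \<omega> in M. c t * X t \<omega> = \<mu>" by blast
    have "expectation (\<lambda>\<omega>. c t * X t \<omega>) = expectation (\<lambda>_. \<mu>)"
      by (rule integral_cong_AE) (use \<mu> m t in auto)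
    then have "\<mu> = 0" using mean[of t] t S by (auto simp: prob_space)
    then show ?thesis using \<mu> by simp
  qed
  have "AE \<omega> in M. \<forall>t\<in>S - D. c t * X t \<omega> = 0"
    using S null by (intro AE_finite_allI) auto
  then have ae: "AE \<omega> in M. (\<Sum>t\<in>D. c t * X t \<omega>) = (\<Sum>t\<in>S. c t * X t \<omega>)"
    by eventually_elim (intro sum.mono_neutral_left D S; simp)
  have "gaussian_rv M (\<lambda>\<omega>. \<Sum>t\<in>D. c t * X t \<omega>)"
  proof (cases "D = {}")
    case False
    have "\<forall>t\<in>D. \<exists>p. 0 < snd p \<and> distributed M lborel (\<lambda>\<omega>. c t * X t \<omega>) (\<lambda>x. ennreal (normal_density (fst p) (snd p) x))"
      by (auto simp: D_def)
    from bchoice[OF this] obtain p where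
      "\<forall>t\<in>D. 0 < snd (p t) \<and> distributed M lborel (\<lambda>\<omega>. c t * X t \<omega>) (\<lambda>x. ennreal (normal_density (fst (p t)) (snd (p t)) x))"
      by (rule exE)
    then have p: "\<And>t. t \<in> D \<Longrightarrow> 0 < snd (p t)"
      "\<And>t. t \<in> D \<Longrightarrow> distributed M lborel (\<lambda>\<omega>. c t * X t \<omega>) (\<lambda>x. ennreal (normal_density (fst (p t)) (snd (p t)) x))"
      by blast+
    have iD: "indep_vars (\<lambda>_. borel) (\<lambda>t \<omega>. c t * X t \<omega>) D"
      by (rule indep_vars_compose2[OF indep_vars_subset[OF ind], of D "\<lambda>t x. c t * x" "\<lambda>_. borel"]) (use D S in auto)
    have "distributed M lborel (\<lambda>\<omega>. \<Sum>t\<in>D. c t * X t \<omega>)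
       (\<lambda>x. ennreal (normal_density (\<Sum>t\<in>D. fst (p t)) (sqrt (\<Sum>t\<in>D. (snd (p t))\<^sup>2)) x))"
      by (rule sum_indep_normal[OF D(2) False iD p])
    moreover have "0 < sqrt (\<Sum>t\<in>D. (snd (p t))\<^sup>2)"
    proof -
      have "0 < (\<Sum>t\<in>D. (snd (p t))\<^sup>2)"
        by (intro sum_pos zero_less_power p(1) D(2) False)
      then show ?thesis by simp
    qed
    moreover have "(\<lambda>\<omega>. \<Sum>t\<in>D. c t * X t \<omega>) \<in> borel_measurable M"
      using m D by (intro borel_measurable_sum) auto
    ultimately show ?thesis unfolding gaussian_rv_def by blast
  qed (auto simp: gaussian_rv_def)
  moreover have "(\<lambda>\<omega>. \<Sum>t\<in>S. c t * X t \<omega>) \<in> borel_measurable M"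
    using m by (intro borel_measurable_sum) auto
  ultimately show "gaussian_rv M (\<lambda>\<omega>. \<Sum>t\<in>S. c t * X t \<omega>)"
    by (rule gaussian_rv_cong_AE[OF _ ae])
qed

lemma indep_gaussian_uncorrelated:
  assumes ind: "indep_vars (\<lambda>_. borel) X T" and g: "\<And>t. t \<in> T \<Longrightarrow> gaussian_rv M (X t)"
    and mean: "\<And>t. t \<in> T \<Longrightarrow> expectation (X t) = 0" and st: "s \<in> T" "t \<in> T" "s \<noteq> t"
  shows "expectation (\<lambda>\<omega>. X s \<omega> * X t \<omega>) = 0"
proof -
  have int: "integrable M (X r)" if "r \<in> T" for r
    using centered_gaussianI[OF g[OF that] mean[OF that]]
    by (auto simp: centered_gaussian_def intro: square_integrable_imp_integrable)
  have "expectation (\<lambda>\<omega>. \<Prod>r\<in>{s, t}. X r \<omega>) = (\<Prod>r\<in>{s, t}. expectation (X r))"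
    by (rule indep_vars_lebesgue_integral) (use st int in \<open>auto intro: indep_vars_subset[OF ind]\<close>)
  then show ?thesis using st mean by simp
qed

end

text \<open>Coordinates under the product measure, which exists over an arbitrary, in particular
  uncountable, index set. Independence holds because the joint law of the coordinates is the product
  measure itself.\<close>

lemma indep_std_normal_family:
  obtains L :: "('t \<Rightarrow> real) measure" where "prob_space L"
    "prob_space.indep_vars L (\<lambda>_. borel) (\<lambda>t \<omega>. \<omega> t) UNIV"
    "\<And>t. distributed L lborel (\<lambda>\<omega>. \<omega> t) std_normal_density"
proof
  define L :: "('t \<Rightarrow> real) measure" where "L = PiM UNIV (\<lambda>_. std_normal_distribution)"
  have p: "prob_space std_normal_distribution" by (rule prob_space_normal_density) simp
  show L: "prob_space L" unfolding L_def by (rule prob_space_PiM) (rule p)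
  interpret prob_space L by (rule L)
  have sL: "sets L = sets (PiM UNIV (\<lambda>_. borel))"
    unfolding L_def by (rule sets_PiM_cong) auto
  have meas: "(\<lambda>\<omega>. \<omega> t) \<in> borel_measurable L" for t
    by (subst measurable_cong_sets[OF sL refl]) measurable
  have comp: "distr L lborel (\<lambda>\<omega>. \<omega> t) = std_normal_distribution" for t
  proof -
    have "distr L lborel (\<lambda>\<omega>. \<omega> t) = distr L std_normal_distribution (\<lambda>\<omega>. \<omega> t)"
      by (rule distr_cong) auto
    then show ?thesis unfolding L_def using distr_PiM_component[of UNIV "\<lambda>_. std_normal_distribution" t] p by simp
  qed
  show "distributed L lborel (\<lambda>\<omega>. \<omega> t) std_normal_density" for t
    using comp meas by (simp add: distributed_def)
  have compb: "distr L borel (\<lambda>\<omega>. \<omega> t) = std_normal_distribution" for t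
    unfolding comp[of t, symmetric] by (rule distr_cong) auto
  show "indep_vars (\<lambda>_. borel) (\<lambda>t \<omega>. \<omega> t) UNIV"
  proof (subst indep_vars_iff_distr_eq_PiM)
    have "distr L (PiM UNIV (\<lambda>_. borel)) (\<lambda>\<omega>. \<lambda>i\<in>UNIV. \<omega> i) = distr L L (\<lambda>\<omega>. \<omega>)"
      by (rule distr_cong) (auto simp: sL)
    also have "\<dots> = L" by (rule distr_id)
    also have "\<dots> = PiM UNIV (\<lambda>i. distr L borel (\<lambda>\<omega>. \<omega> i))" unfolding compb by (rule L_def)
    finally show "distr L (PiM UNIV (\<lambda>_. borel)) (\<lambda>\<omega>. \<lambda>i\<in>UNIV. \<omega> i) = PiM UNIV (\<lambda>i. distr L borel (\<lambda>\<omega>. \<omega> i))" .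
  qed (use meas in auto)
qed

text \<open>Independent standard normals scaled by 1/pi inside the interval and by 0 at the
  endpoints, where the variables become point masses.\<close>

lemma limit_collection1_exists: "\<exists>(L :: (real \<Rightarrow> real) measure) F. limit_collection1 L F"
proof (rule indep_std_normal_family)
  fix L :: "(real \<Rightarrow> real) measure"
  assume L: "prob_space L" and ind: "prob_space.indep_vars L (\<lambda>_. borel) (\<lambda>t \<omega>. \<omega> t) UNIV"
    and N: "\<And>t. distributed L lborel (\<lambda>\<omega>. \<omega> t) std_normal_density"
  interpret prob_space L by fact
  define c :: "real \<Rightarrow> real" where "c t = (if 0 < t \<and> t < 1 then 1 / pi else 0)" for t
  have g: "gaussian_rv L (\<lambda>\<omega>. \<omega> t)" for t
    by (rule gaussian_rv_normal[OF zero_less_one N])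
  have mean: "expectation (\<lambda>\<omega>. \<omega> t) = 0" for t by (rule standard_normal_distributed_expectation[OF N])
  have var: "expectation (\<lambda>\<omega>. (\<omega> t)\<^sup>2) = 1" for t
    using standard_normal_distributed_variance[OF N, of t] mean by simp
  have "limit_collection1 L (\<lambda>t \<omega>. c t * \<omega> t)"
    unfolding limit_collection1_def
  proof (intro conjI ballI L)
    show "indep_vars (\<lambda>_. borel) (\<lambda>t \<omega>. c t * \<omega> t) {0..1}"
      by (rule indep_vars_compose2[OF indep_vars_subset[OF ind], of "{0..1}" "\<lambda>t x. c t * x" "\<lambda>_. borel"]) auto
    fix t :: real
    show "gaussian_rv L (\<lambda>\<omega>. c t * \<omega> t)" by (rule gaussian_rv_scale[OF g])
    show "expectation (\<lambda>\<omega>. c t * \<omega> t) = 0" by (simp add: mean)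
    show "expectation (\<lambda>\<omega>. (c t * \<omega> t)\<^sup>2) = (if 0 < t \<and> t < 1 then 1 / pi\<^sup>2 else 0)"
      by (simp add: power_mult_distrib var c_def power_divide)
  qed
  then show ?thesis by blast
qed

lemma limit_collection2_exists: "\<exists>(L :: (real \<Rightarrow> real) measure) F. limit_collection2 L F"
proof (rule indep_std_normal_family)
  fix L :: "(real \<Rightarrow> real) measure"
  assume L: "prob_space L" and ind: "prob_space.indep_vars L (\<lambda>_. borel) (\<lambda>t \<omega>. \<omega> t) UNIV"
    and N: "\<And>t. distributed L lborel (\<lambda>\<omega>. \<omega> t) std_normal_density"
  interpret prob_space L by fact
  \<comment> \<open>Both endpoints read the same coordinate, which makes the limit variables at 0
    and 1 equal and so produces their covariance 1/pi^2.\<close>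
  define w :: "real \<Rightarrow> real" where "w t = (if t = 1 then 0 else t)" for t
  have g: "gaussian_rv L (\<lambda>\<omega>. \<omega> t)" for t
    by (rule gaussian_rv_normal[OF zero_less_one N])
  have mean: "expectation (\<lambda>\<omega>. \<omega> t) = 0" for t by (rule standard_normal_distributed_expectation[OF N])
  have var: "expectation (\<lambda>\<omega>. (\<omega> t)\<^sup>2) = 1" for t
    using standard_normal_distributed_variance[OF N, of t] mean by simp
  have cov: "expectation (\<lambda>\<omega>. \<omega> s * \<omega> t) = (if s = t then 1 else 0)" for s t
    using indep_gaussian_uncorrelated[OF ind g mean, of s t] var[of t] by (auto simp: power2_eq_square)
  have "limit_collection2 L (\<lambda>t \<omega>. \<omega> (w t) / pi)"
    unfolding limit_collection2_def
  proof (intro conjI ballI L)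
    show "gaussian_process L (\<lambda>t \<omega>. \<omega> (w t) / pi) {0..1}"
      unfolding gaussian_process_def
    proof (intro allI impI)
      fix S :: "real set" and c :: "real \<Rightarrow> real" assume "finite S"
      with gaussian_process_indexed[OF gaussian_process_of_indep[OF ind g mean], of S w "\<lambda>t. c t / pi"]
      show "gaussian_rv L (\<lambda>\<omega>. \<Sum>t\<in>S. c t * (\<omega> (w t) / pi))" by simp
    qed
    fix t :: real assume t: "t \<in> {0..1}"
    show "expectation (\<lambda>\<omega>. \<omega> (w t) / pi) = 0" by (simp add: mean)
    fix s :: real assume s: "s \<in> {0..1}"
    have "expectation (\<lambda>\<omega>. \<omega> (w t) / pi * (\<omega> (w s) / pi)) = expectation (\<lambda>\<omega>. \<omega> (w t) * \<omega> (w s) / (pi * pi))"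
      by simp
    also have "\<dots> = (if w t = w s then 1 else 0) / (pi * pi)"
      by (simp only: integral_divide_zero cov)
    finally show "expectation (\<lambda>\<omega>. \<omega> (w t) / pi * (\<omega> (w s) / pi)) =
        (if t = s \<or> t \<in> {0, 1} \<and> s \<in> {0, 1} then 1 / pi\<^sup>2 else 0)"
      by (auto simp: w_def power2_eq_square)
  qed
  then show ?thesis by blast
qed

lemma limit_collection1_gaussian:
  fixes n :: nat
  assumes F: "limit_collection1 L F" and t: "\<And>i. i < n \<Longrightarrow> t i \<in> {0..1}"
  shows "centered_gaussian L (\<lambda>\<omega>. \<Sum>i<n. u i * F (t i) \<omega>)
    (\<Sum>i<n. \<Sum>j<n. u i * u j * (if t i = t j \<and> 0 < t i \<and> t i < 1 then 1 / pi\<^sup>2 else 0))"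
proof -
  interpret prob_space L using F by (simp add: limit_collection1_def)
  have ind: "indep_vars (\<lambda>_. borel) F {0..1}" using F by (simp add: limit_collection1_def)
  have g: "gaussian_rv L (F r)" and mean: "expectation (F r) = 0"
    and var: "expectation (\<lambda>\<omega>. (F r \<omega>)\<^sup>2) = (if 0 < r \<and> r < 1 then 1 / pi\<^sup>2 else 0)" if "r \<in> {0..1}" for r
    using F that unfolding limit_collection1_def by blast+
  have cov: "expectation (\<lambda>\<omega>. F r \<omega> * F s \<omega>) = (if r = s \<and> 0 < r \<and> r < 1 then 1 / pi\<^sup>2 else 0)"
    if "r \<in> {0..1}" "s \<in> {0..1}" for r s
    using indep_gaussian_uncorrelated[OF ind g mean that] var[OF that(1)] by (cases "r = s") (simp_all add: power2_eq_square)
  have "centered_gaussian L (\<lambda>\<omega>. \<Sum>i<n. u i * F (t i) \<omega>)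
      (\<Sum>i<n. \<Sum>j<n. u i * u j * expectation (\<lambda>\<omega>. F (t i) \<omega> * F (t j) \<omega>))"
    by (rule gaussian_process_combination[OF gaussian_process_of_indep[OF ind g mean] mean]) (use t in auto)
  also have "(\<Sum>i<n. \<Sum>j<n. u i * u j * expectation (\<lambda>\<omega>. F (t i) \<omega> * F (t j) \<omega>))
     = (\<Sum>i<n. \<Sum>j<n. u i * u j * (if t i = t j \<and> 0 < t i \<and> t i < 1 then 1 / pi\<^sup>2 else 0))"
    by (intro sum.cong refl arg_cong[where f="\<lambda>z. _ * z"] cov) (use t in auto)
  finally show ?thesis .
qed

lemma limit_collection2_gaussian:
  fixes n :: nat
  assumes F: "limit_collection2 L F" and t: "\<And>i. i < n \<Longrightarrow> t i \<in> {0..1}"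
  shows "centered_gaussian L (\<lambda>\<omega>. \<Sum>i<n. u i * F (t i) \<omega>)
    (\<Sum>i<n. \<Sum>j<n. u i * u j * (if t i = t j \<or> t i \<in> {0, 1} \<and> t j \<in> {0, 1} then 1 / pi\<^sup>2 else 0))"
proof -
  interpret prob_space L using F by (simp add: limit_collection2_def)
  have gp: "gaussian_process L F {0..1}" using F by (simp add: limit_collection2_def)
  have mean: "expectation (F r) = 0" if "r \<in> {0..1}" for r
    using F that unfolding limit_collection2_def by blast
  have cov: "expectation (\<lambda>\<omega>. F r \<omega> * F s \<omega>) = (if r = s \<or> r \<in> {0, 1} \<and> s \<in> {0, 1} then 1 / pi\<^sup>2 else 0)"
    if "r \<in> {0..1}" "s \<in> {0..1}" for r s
    using F that unfolding limit_collection2_def by blast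
  have "centered_gaussian L (\<lambda>\<omega>. \<Sum>i<n. u i * F (t i) \<omega>)
      (\<Sum>i<n. \<Sum>j<n. u i * u j * expectation (\<lambda>\<omega>. F (t i) \<omega> * F (t j) \<omega>))"
    by (rule gaussian_process_combination[OF gp mean]) (use t in auto)
  also have "(\<Sum>i<n. \<Sum>j<n. u i * u j * expectation (\<lambda>\<omega>. F (t i) \<omega> * F (t j) \<omega>))
     = (\<Sum>i<n. \<Sum>j<n. u i * u j * (if t i = t j \<or> t i \<in> {0, 1} \<and> t j \<in> {0, 1} then 1 / pi\<^sup>2 else 0))"
    by (intro sum.cong refl arg_cong[where f="\<lambda>z. _ * z"] cov) (use t in auto)
  finally show ?thesis .
qed

theorem theorem1p1:
  fixes M :: "'a measure" and B :: "real \<Rightarrow> 'a \<Rightarrow> real"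
  assumes "brownian_bridge M B"
  shows "((\<exists>(L :: (real \<Rightarrow> real) measure) F. limit_collection1 L F) \<and>
          (\<forall>(L :: 'b measure) F. limit_collection1 L F \<longrightarrow>
             converges_fdd {0..1} M (F_process1 M B) L F)) \<and>
         ((\<exists>(L :: (real \<Rightarrow> real) measure) F. limit_collection2 L F) \<and>
          (\<forall>(L :: 'b measure) F. limit_collection2 L F \<longrightarrow>
             converges_fdd {0..1} M (F_process2 B) L F))"
proof (intro conjI allI impI limit_collection1_exists limit_collection2_exists)
  fix L :: "'b measure" and F
  assume F: "limit_collection1 L F"
  then show "converges_fdd {0..1} M (F_process1 M B) L F"
    by (intro F_process1_fdd[OF assms] limit_collection1_gaussian)
      (auto simp: limit_collection1_def gaussian_rv_def)
next
  fix L :: "'b measure" and F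
  assume F: "limit_collection2 L F"
  have "gaussian_rv L (F t)" if "t \<in> {0..1}" for t
    using F gaussian_process_indexed[of L F "{0..1}" "{t}" "\<lambda>s. s" "\<lambda>_. 1"] that
    by (simp add: limit_collection2_def)
  with F show "converges_fdd {0..1} M (F_process2 B) L F"
    by (intro F_process2_fdd[OF assms] limit_collection2_gaussian)
      (auto simp: limit_collection2_def gaussian_rv_def)
qed

end
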